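(* Let $G=(V,E)$ be a graph with reflective symmetry, with involution $\phi$, and let $G_+$, $G_-$ be the two graphs it gives rise to. The linear map $f:\mathbf{Z}E_+\oplus\mathbf{Z}E_-\to\mathbf{Z}E$ induces a group homomorphism $$f^*:K(G_+)\oplus K(G_-)\to K(G)$$ such that $\ker(f^* )$ and $\operatorname{coker}(f^* )$ are $2$-torsion groups. Moreover, $\ker(f^* )$ is isomorphic to the space of $\psi$-fixed bicycles of the disjoint union $G_+\cup G_-$, and $\operatorname{coker}(f^* )$ is isomorphic to the space of $\phi$-fixed bicycles of $G$. If $G_+$ is connected, then $$\frac{|K(G)|}{|K(G_+)\oplus K(G_-)|}=\frac{|\operatorname{coker}(f^* )|}{|\ker(f^* )|}=2^{|V^\phi|-|E^\phi|-1}.$$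
   Context: A graph with reflective symmetry is a finite graph $G=(V,E)$ with a distinguished non-degenerate drawing in $\mathbf{R}^2$ such that (1) reflection about a (vertical) line $\ell$ maps the drawing into itself, and (2) every edge fixed by this reflection is fixed pointwise (so no edge crosses $\ell$). The reflection induces an involution $\phi$ on $V$ and on $E$. This gives partitions $E=E_L\cup E^\phi\cup E_R$ (edges left of $\ell$, $\phi$-fixed edges, edges right of $\ell$) and $V=V_L\cup V^\phi\cup V_R$ likewise; $\phi$ swaps $E_L$ and $E_R$. A subgraph is specified by a set of edges, its vertices being their endpoints. $G_+=(V_+,E_+)$ is obtained from the subgraph with edge set $E_L\cup E^\phi$ by subdividing each edge of $E^\phi$ (each $e\in E^\phi$ is replaced by two edges $e',e''$ through a new vertex). $G_-=(V_-,E_-)$ is obtained from the subgraph with edge set $E_R$ by identifying its $\phi$-fixed vertices to a single vertex (multiple edges may arise). Edges of $E_+$ not arising by subdivision are identified with the corresponding edges of $E_L$; edges of $E_-$ are identified with edges of $E_R$. Critical group: for a graph $H$ with oriented edges, let $\partial:\mathbf{Z}E_H\to\mathbf{Z}V_H$ be the boundary map (with $-e$ meaning $e$ with reversed orientation) and $\partial^t$ its transpose (coboundary) with respect to the standard bases. The cycle space is $Z=\ker\partial$, the bond space is $B=\operatorname{im}\partial^t$, and $K(H):=\mathbf{Z}E_H/(Z+B)$, a finite abelian group whose order is the number of spanning forests of $H$. Orient $G$ so that $\phi$ preserves orientations; this induces orientations on $G_+$ (both halves of a subdivided edge oriented consistently with the original) and on $G_-$. Define $\mathbf{Z}$-linear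 $f:\mathbf{Z}E_+\oplus\mathbf{Z}E_-\to\mathbf{Z}E$ by: $f(e,0)=e+\phi(e)$ for $e\in E_+$ coming from $E_L$; $f(e,0)=e_0$ if $e\in E_+$ is one of the two halves of $e_0\in E^\phi$; $f(0,e)=e-\phi(e)$ for $e\in E_-=E_R$. The map $f$ sends cycles of $G_+$ and $G_-$ to cycles of $G$ and bonds to bonds, so it induces $f^*$. Mod 2: for a graph $H$, $Z_2(H)=\ker(\partial:(\mathbf{Z}/2)E_H\to(\mathbf{Z}/2)V_H)$ and $B_2(H)=\operatorname{im}(\partial^t:(\mathbf{Z}/2)V_H\to(\mathbf{Z}/2)E_H)$; the (2-)bicycle space of $H$ is $Z_2(H)\cap B_2(H)$. The bicycle space of the disjoint union $G_+\cup G_-$ is $(Z_2(G_+)\oplus Z_2(G_-))\cap(B_2(G_+)\oplus B_2(G_-))\subset(\mathbf{Z}/2)E_+\oplus(\mathbf{Z}/2)E_-$. $\phi$ acts on $(\mathbf{Z}/2)E$ by permuting edges. $\psi$ is the linear involution of $(\mathbf{Z}/2)E_+\oplus(\mathbf{Z}/2)E_-$ that swaps the two halves $e',e''$ of each subdivided edge, and swaps $(e,0)$ with $(0,\phi(e))$ for each $e\in E_L$.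
   Formalization: The final equality with 2^{|V^φ|-|E^φ|-1} is stated only when V^φ is nonempty and no vertex of V^φ is isolated in G; without this it fails, e.g. for two mirror copies of a connected graph disjoint from the axis (ratio 1, not 1/2). *)

theory Defs
  imports
    "HOL-Analysis.Analysis"
    "HOL-Algebra.Algebra"
    "HOL-Library.Z2"
    "Graph_Theory.Digraph_Component"
begin

section \<open>Cycles, bonds and the critical group of an oriented graph\<close>

text \<open>
  Graphs may have loops and multiple edges.  A graph together with an orientation is a
  \<open>pre_digraph\<close>.  Chains with coefficients in a ring \<open>'r\<close> are finitely supported functions;
  \<open>'r = int\<close> and \<open>'r = bit\<close> (the field with two elements) are the two cases of interest.
\<close>

definition chains :: "'x set \<Rightarrow> ('x \<Rightarrow>\<^sub>0 'r::comm_ring_1) set" where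
  "chains S = {c. Poly_Mapping.keys c \<subseteq> S}"

definition boundary :: "('v, 'e) pre_digraph \<Rightarrow> ('e \<Rightarrow>\<^sub>0 'r::comm_ring_1) \<Rightarrow> ('v \<Rightarrow>\<^sub>0 'r)" where
  "boundary H c =
    (\<Sum>e\<in>Poly_Mapping.keys c.
       Poly_Mapping.single (head H e) (Poly_Mapping.lookup c e)
     - Poly_Mapping.single (tail H e) (Poly_Mapping.lookup c e))"

definition coboundary :: "('v, 'e) pre_digraph \<Rightarrow> ('v \<Rightarrow>\<^sub>0 'r::comm_ring_1) \<Rightarrow> ('e \<Rightarrow>\<^sub>0 'r)" where
  "coboundary H y =
    (\<Sum>e\<in>arcs H.
       Poly_Mapping.single e (Poly_Mapping.lookup y (head H e) - Poly_Mapping.lookup y (tail H e)))"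

definition cycle_space :: "('v, 'e) pre_digraph \<Rightarrow> ('e \<Rightarrow>\<^sub>0 'r::comm_ring_1) set" where
  "cycle_space H = {c \<in> chains (arcs H). boundary H c = 0}"

definition bond_space :: "('v, 'e) pre_digraph \<Rightarrow> ('e \<Rightarrow>\<^sub>0 'r::comm_ring_1) set" where
  "bond_space H = coboundary H ` chains (verts H)"

definition cycles_plus_bonds :: "('v, 'e) pre_digraph \<Rightarrow> ('e \<Rightarrow>\<^sub>0 int) set" where
  "cycles_plus_bonds H = {z + b | z b. z \<in> cycle_space H \<and> b \<in> bond_space H}"

definition critical_group :: "('v, 'e) pre_digraph \<Rightarrow> ('e \<Rightarrow>\<^sub>0 int) set monoid" where
  "critical_group H = free_Abelian_group (arcs H) Mod cycles_plus_bonds H"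

definition critical_class :: "('v, 'e) pre_digraph \<Rightarrow> ('e \<Rightarrow>\<^sub>0 int) \<Rightarrow> ('e \<Rightarrow>\<^sub>0 int) set" where
  "critical_class H x = cycles_plus_bonds H #>\<^bsub>free_Abelian_group (arcs H)\<^esub> x"

definition bicycle_space :: "('v, 'e) pre_digraph \<Rightarrow> ('e \<Rightarrow>\<^sub>0 bit) set" where
  "bicycle_space H = cycle_space H \<inter> bond_space H"

definition additive_group :: "'a::ab_group_add set \<Rightarrow> 'a monoid" where
  "additive_group S = \<lparr>carrier = S, monoid.mult = (+), one = 0\<rparr>"

definition two_torsion :: "('a, 'm) monoid_scheme \<Rightarrow> bool" where
  "two_torsion A \<longleftrightarrow> (\<forall>x\<in>carrier A. x [^]\<^bsub>A\<^esub> (2::nat) = \<one>\<^bsub>A\<^esub>)"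

definition ker_group :: "('a, 'm) monoid_scheme \<Rightarrow> ('b, 'n) monoid_scheme \<Rightarrow> ('a \<Rightarrow> 'b) \<Rightarrow> ('a, 'm) monoid_scheme" where
  "ker_group A B h = A\<lparr>carrier := kernel A B h\<rparr>"

definition coker_group :: "('a, 'm) monoid_scheme \<Rightarrow> ('b, 'n) monoid_scheme \<Rightarrow> ('a \<Rightarrow> 'b) \<Rightarrow> 'b set monoid" where
  "coker_group A B h = B Mod (h ` carrier A)"


section \<open>Graphs with reflective symmetry\<close>

text \<open>
  \<open>axis D\<close> is the abscissa of the vertical line.  Curves are parametrised from tail to head;
  this only fixes a parametrisation, the conditions below depend on the curves as point sets.
\<close>

record ('v, 'e) drawing =
  point :: "'v \<Rightarrow> real \<times> real"
  curve :: "'e \<Rightarrow> real \<Rightarrow> real \<times> real"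
  axis :: real

definition reflect :: "real \<Rightarrow> real \<times> real \<Rightarrow> real \<times> real" where
  "reflect a p = (2 * a - fst p, snd p)"

text \<open>
  Curves of different edges may cross: planarity is not required.  Closed curves (for loops)
  are allowed by \<open>simple_path\<close>.
\<close>

definition nondegenerate_drawing :: "('v, 'e) pre_digraph \<Rightarrow> ('v, 'e) drawing \<Rightarrow> bool" where
  "nondegenerate_drawing G D \<longleftrightarrow>
     inj_on (point D) (verts G) \<and>
     (\<forall>e\<in>arcs G. simple_path (curve D e) \<and>
        pathstart (curve D e) = point D (tail G e) \<and>
        pathfinish (curve D e) = point D (head G e) \<and>
        (\<forall>t\<in>{0<..<1}. curve D e t \<notin> point D ` verts G)) \<and>
     inj_on (\<lambda>e. path_image (curve D e)) (arcs G)"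

definition reflection_invariant :: "('v, 'e) pre_digraph \<Rightarrow> ('v, 'e) drawing \<Rightarrow> bool" where
  "reflection_invariant G D \<longleftrightarrow>
     (\<forall>v\<in>verts G. \<exists>w\<in>verts G. point D w = reflect (axis D) (point D v)) \<and>
     (\<forall>e\<in>arcs G. \<exists>e'\<in>arcs G.
        path_image (curve D e') = reflect (axis D) ` path_image (curve D e))"

definition phi_vert :: "('v, 'e) pre_digraph \<Rightarrow> ('v, 'e) drawing \<Rightarrow> 'v \<Rightarrow> 'v" where
  "phi_vert G D v = (THE w. w \<in> verts G \<and> point D w = reflect (axis D) (point D v))"

definition phi_edge :: "('v, 'e) pre_digraph \<Rightarrow> ('v, 'e) drawing \<Rightarrow> 'e \<Rightarrow> 'e" where
  "phi_edge G D e = (THE e'. e' \<in> arcs G \<and>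
     path_image (curve D e') = reflect (axis D) ` path_image (curve D e))"

definition left_side :: "('v, 'e) drawing \<Rightarrow> 'e \<Rightarrow> bool" where
  "left_side D e \<longleftrightarrow> (\<forall>p\<in>path_image (curve D e). fst p \<le> axis D)"

definition right_side :: "('v, 'e) drawing \<Rightarrow> 'e \<Rightarrow> bool" where
  "right_side D e \<longleftrightarrow> (\<forall>p\<in>path_image (curve D e). fst p \<ge> axis D)"

text \<open>
  The last condition says that no edge crosses the axis.  For plane drawings it follows from
  the previous one; without planarity an edge and its distinct mirror image could cross on the axis.
\<close>

definition reflective_symmetry :: "('v, 'e) pre_digraph \<Rightarrow> ('v, 'e) drawing \<Rightarrow> bool" where
  "reflective_symmetry G D \<longleftrightarrow>
     fin_digraph G \<and> nondegenerate_drawing G D \<and> reflection_invariant G D \<and>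
     (\<forall>e\<in>arcs G. phi_edge G D e = e \<longrightarrow>
        (\<forall>p\<in>path_image (curve D e). reflect (axis D) p = p)) \<and>
     (\<forall>e\<in>arcs G. left_side D e \<or> right_side D e)"

definition phi_preserves_orientation :: "('v, 'e) pre_digraph \<Rightarrow> ('v, 'e) drawing \<Rightarrow> bool" where
  "phi_preserves_orientation G D \<longleftrightarrow>
     (\<forall>e\<in>arcs G. tail G (phi_edge G D e) = phi_vert G D (tail G e) \<and>
                 head G (phi_edge G D e) = phi_vert G D (head G e))"

definition V_fix :: "('v, 'e) pre_digraph \<Rightarrow> ('v, 'e) drawing \<Rightarrow> 'v set" where
  "V_fix G D = {v \<in> verts G. phi_vert G D v = v}"

definition E_fix :: "('v, 'e) pre_digraph \<Rightarrow> ('v, 'e) drawing \<Rightarrow> 'e set" where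
  "E_fix G D = {e \<in> arcs G. phi_edge G D e = e}"

definition E_left :: "('v, 'e) pre_digraph \<Rightarrow> ('v, 'e) drawing \<Rightarrow> 'e set" where
  "E_left G D = {e \<in> arcs G. phi_edge G D e \<noteq> e \<and> left_side D e}"

definition E_right :: "('v, 'e) pre_digraph \<Rightarrow> ('v, 'e) drawing \<Rightarrow> 'e set" where
  "E_right G D = {e \<in> arcs G. phi_edge G D e \<noteq> e \<and> right_side D e}"

definition endpoints :: "('v, 'e) pre_digraph \<Rightarrow> 'e set \<Rightarrow> 'v set" where
  "endpoints G F = tail G ` F \<union> head G ` F"


section \<open>The graphs \<open>G\<^sub>+\<close> and \<open>G\<^sub>-\<close>\<close>

datatype ('v, 'e) plus_vert = Old 'v | Mid 'e

datatype 'e plus_edge = Whole 'e | First_half 'e | Second_half 'e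

fun plus_tail :: "('v, 'e) pre_digraph \<Rightarrow> 'e plus_edge \<Rightarrow> ('v, 'e) plus_vert" where
  "plus_tail G (Whole e) = Old (tail G e)"
| "plus_tail G (First_half e) = Old (tail G e)"
| "plus_tail G (Second_half e) = Mid e"

fun plus_head :: "('v, 'e) pre_digraph \<Rightarrow> 'e plus_edge \<Rightarrow> ('v, 'e) plus_vert" where
  "plus_head G (Whole e) = Old (head G e)"
| "plus_head G (First_half e) = Mid e"
| "plus_head G (Second_half e) = Old (head G e)"

definition G_plus ::
  "('v, 'e) pre_digraph \<Rightarrow> ('v, 'e) drawing \<Rightarrow> (('v, 'e) plus_vert, 'e plus_edge) pre_digraph" where
  "G_plus G D = \<lparr>
     verts = Old ` endpoints G (E_left G D \<union> E_fix G D) \<union> Mid ` E_fix G D,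
     arcs = Whole ` E_left G D \<union> First_half ` E_fix G D \<union> Second_half ` E_fix G D,
     tail = plus_tail G,
     head = plus_head G\<rparr>"

text \<open>\<open>None\<close> is the vertex to which the fixed vertices are identified.\<close>

definition minus_vert :: "('v, 'e) pre_digraph \<Rightarrow> ('v, 'e) drawing \<Rightarrow> 'v \<Rightarrow> 'v option" where
  "minus_vert G D v = (if v \<in> V_fix G D then None else Some v)"

definition G_minus ::
  "('v, 'e) pre_digraph \<Rightarrow> ('v, 'e) drawing \<Rightarrow> ('v option, 'e) pre_digraph" where
  "G_minus G D = \<lparr>
     verts = minus_vert G D ` endpoints G (E_right G D),
     arcs = E_right G D,
     tail = (\<lambda>e. minus_vert G D (tail G e)),
     head = (\<lambda>e. minus_vert G D (head G e))\<rparr>"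


section \<open>The map \<open>f\<close> and the involutions modulo 2\<close>

fun f_plus :: "('v, 'e) pre_digraph \<Rightarrow> ('v, 'e) drawing \<Rightarrow> 'e plus_edge \<Rightarrow> ('e \<Rightarrow>\<^sub>0 int)" where
  "f_plus G D (Whole e) = frag_of e + frag_of (phi_edge G D e)"
| "f_plus G D (First_half e) = frag_of e"
| "f_plus G D (Second_half e) = frag_of e"

definition f_minus :: "('v, 'e) pre_digraph \<Rightarrow> ('v, 'e) drawing \<Rightarrow> 'e \<Rightarrow> ('e \<Rightarrow>\<^sub>0 int)" where
  "f_minus G D e = frag_of e - frag_of (phi_edge G D e)"

definition f_map :: "('v, 'e) pre_digraph \<Rightarrow> ('v, 'e) drawing \<Rightarrow>
    ('e plus_edge \<Rightarrow>\<^sub>0 int) \<times> ('e \<Rightarrow>\<^sub>0 int) \<Rightarrow> ('e \<Rightarrow>\<^sub>0 int)" where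
  "f_map G D = (\<lambda>(x, y). frag_extend (f_plus G D) x + frag_extend (f_minus G D) y)"

definition phi_act :: "('v, 'e) pre_digraph \<Rightarrow> ('v, 'e) drawing \<Rightarrow> ('e \<Rightarrow>\<^sub>0 bit) \<Rightarrow> ('e \<Rightarrow>\<^sub>0 bit)" where
  "phi_act G D c =
    (\<Sum>e\<in>Poly_Mapping.keys c. Poly_Mapping.single (phi_edge G D e) (Poly_Mapping.lookup c e))"

text \<open>Images under \<open>\<psi>\<close> of the multiples of basis vectors.\<close>

fun psi_plus :: "('v, 'e) pre_digraph \<Rightarrow> ('v, 'e) drawing \<Rightarrow> 'e plus_edge \<Rightarrow> bit \<Rightarrow>
    ('e plus_edge \<Rightarrow>\<^sub>0 bit) \<times> ('e \<Rightarrow>\<^sub>0 bit)" where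
  "psi_plus G D (Whole e) r = (0, Poly_Mapping.single (phi_edge G D e) r)"
| "psi_plus G D (First_half e) r = (Poly_Mapping.single (Second_half e) r, 0)"
| "psi_plus G D (Second_half e) r = (Poly_Mapping.single (First_half e) r, 0)"

definition psi_minus :: "('v, 'e) pre_digraph \<Rightarrow> ('v, 'e) drawing \<Rightarrow> 'e \<Rightarrow> bit \<Rightarrow>
    ('e plus_edge \<Rightarrow>\<^sub>0 bit) \<times> ('e \<Rightarrow>\<^sub>0 bit)" where
  "psi_minus G D e r = (Poly_Mapping.single (Whole (phi_edge G D e)) r, 0)"

definition psi_act :: "('v, 'e) pre_digraph \<Rightarrow> ('v, 'e) drawing \<Rightarrow>
    ('e plus_edge \<Rightarrow>\<^sub>0 bit) \<times> ('e \<Rightarrow>\<^sub>0 bit) \<Rightarrow> ('e plus_edge \<Rightarrow>\<^sub>0 bit) \<times> ('e \<Rightarrow>\<^sub>0 bit)" where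
  "psi_act G D = (\<lambda>(x, y).
     (\<Sum>a\<in>Poly_Mapping.keys x. psi_plus G D a (Poly_Mapping.lookup x a)) +
     (\<Sum>e\<in>Poly_Mapping.keys y. psi_minus G D e (Poly_Mapping.lookup y e)))"

definition phi_fixed_bicycles :: "('v, 'e) pre_digraph \<Rightarrow> ('v, 'e) drawing \<Rightarrow> ('e \<Rightarrow>\<^sub>0 bit) set" where
  "phi_fixed_bicycles G D = {b \<in> bicycle_space G. phi_act G D b = b}"

definition psi_fixed_bicycles :: "('v, 'e) pre_digraph \<Rightarrow> ('v, 'e) drawing \<Rightarrow>
    (('e plus_edge \<Rightarrow>\<^sub>0 bit) \<times> ('e \<Rightarrow>\<^sub>0 bit)) set" where
  "psi_fixed_bicycles G D =
     {w \<in> (cycle_space (G_plus G D) \<times> cycle_space (G_minus G D)) \<inter>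
           (bond_space (G_plus G D) \<times> bond_space (G_minus G D)). psi_act G D w = w}"

end

theory Submission
  imports Defs
begin

text \<open>
  Let \<open>f\<^sup>t\<close> be the transpose of \<open>f\<close>.  Both maps send bonds to bonds, hence by orthogonality cycles
  to cycles.  On chains \<open>f f\<^sup>t = 2\<close>, and \<open>f\<^sup>t f = 2\<close> up to the bonds at the midpoints.

  If \<open>f x = z + b\<close> with a cycle \<open>z\<close> and a bond \<open>b\<close>, then \<open>2x\<close> is the cycle \<open>f\<^sup>t z\<close> plus a bond.
  The reduction of \<open>f\<^sup>t z\<close> modulo 2 is a \<open>\<psi>\<close>-fixed bicycle, and this identifies the kernel.
  The cokernel is a quotient of the chains modulo 2 by a subspace whose orthogonal space consists of
  the \<open>\<phi>\<close>-fixed bicycles that vanish on the axis.  They all do, because the edges on the axis are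
  non-overlapping segments of a line and hence form a forest.

  Restricted to the left half of \<open>G\<close>, the two spaces of fixed bicycles are the left and the right
  kernel of the same pairing over the field with two elements, so the quotient of their
  cardinalities is the quotient of the cardinalities of the two paired spaces.
\<close>

text \<open>Over the integers, cycles and bonds meet only in 0 and both spaces are closed under
  halving. Hence the splitting \<open>2x = z + b\<close> is unique, and the reduction of
  \<open>z\<close> determines the class of \<open>x\<close>. To reach every \<psi>-fixed bicycle, it
  is lifted both to an integral cycle \<open>z\<close> and to an integral bond \<open>b\<close>, and
  \<open>x\<close> is half of \<open>z + b\<close>. A bond is lifted through its potential; lifting
  a cycle is the obstacle, and for its sake bonds over any ring are characterised by orthogonality
  to integral cycles.

  For the cokernel, \<open>f f^t = 2\<close> puts all doubled chains into the image, so reduction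
  modulo 2 loses nothing.

  The exponent: let \<open>V'\<close> be the vertices of the unsubdivided left half. Its bonds
  modulo 2 number \<open>2^(|V'| - 1)\<close>, the -1 coming from the constant potentials. They are
  paired with the edge functions given on left edges by a potential vanishing on the axis and
  arbitrary on axis edges. These number \<open>2^(|V'| - |V_fix| + |E_fix|)\<close>: a nonempty axis
  rules out nonzero constants, and \<open>V_fix\<close> lies in \<open>V'\<close> if no axis vertex
  is isolated.\<close>

text \<open>By default the simplifier turns the field operations of \<open>bit\<close> into bit operations.\<close>

declare add_bit_eq_xor [simp del] mult_bit_eq_and [simp del] minus_bit_def [simp del]
  uminus_bit_def [simp del] bit_not_zero_iff [simp del] bit_not_one_iff [simp del]

lemma bit_add_self [simp]: "x + x = 0" for x :: bit
  by (simp add: add_bit_eq_xor)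

lemma bit_uminus [simp]: "- x = x" for x :: bit
  by (simp add: uminus_bit_def)

lemma bit_diff [simp]: "x - y = x + y" for x y :: bit
  by (simp add: minus_bit_def)

lemma bit_add_eq_0_iff: "x + y = 0 \<longleftrightarrow> x = y" for x y :: bit
  by (metis add.inverse_unique bit_uminus bit_add_self)

lemma of_int_bit_eq_0_iff: "(of_int n :: bit) = 0 \<longleftrightarrow> even n"
proof
  assume "even n"
  then obtain k where "n = 2 * k" by (elim evenE)
  then show "(of_int n :: bit) = 0" by simp
next
  show "even n" if "(of_int n :: bit) = 0"
  proof (rule ccontr)
    assume "odd n"
    then obtain k where "n = 2 * k + 1" by (elim oddE)
    then have "(of_int n :: bit) = 1" by simp
    with that show False by simp
  qed
qed

lemma of_int_bit_cases: obtains n :: int where "of_int n = (x::bit)"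
  by (metis bit.exhaust of_int_0 of_int_1)

section \<open>Chains\<close>

abbreviation coef :: "('a \<Rightarrow>\<^sub>0 'b::zero) \<Rightarrow> 'a \<Rightarrow> 'b" where
  "coef \<equiv> Poly_Mapping.lookup"

definition chain_of :: "'a set \<Rightarrow> ('a \<Rightarrow> 'r::comm_ring_1) \<Rightarrow> 'a \<Rightarrow>\<^sub>0 'r" where
  "chain_of S g = (\<Sum>s\<in>S. Poly_Mapping.single s (g s))"

text \<open>The target of interest is \<open>bit\<close>, where this is reduction modulo 2.\<close>

definition base_change :: "('a \<Rightarrow>\<^sub>0 int) \<Rightarrow> ('a \<Rightarrow>\<^sub>0 'r::comm_ring_1)" where
  "base_change c = Poly_Mapping.map of_int c"

lemma coef_sum: "coef (\<Sum>i\<in>I. c i) e = (\<Sum>i\<in>I. coef (c i) e)"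
  by (induction I rule: infinite_finite_induct) (auto simp: lookup_add)

lemma coef_base_change [simp]: "coef (base_change c) e = of_int (coef c e)"
  unfolding base_change_def by transfer (auto simp: when_def)

lemma base_change_add: "base_change (x + y) = base_change x + base_change y"
  by (rule poly_mapping_eqI) (simp add: lookup_add)

lemma base_change_0 [simp]: "base_change 0 = 0"
  by (rule poly_mapping_eqI) simp

lemma coef_chain_of: "finite S \<Longrightarrow> coef (chain_of S g) e = (if e \<in> S then g e else 0)"
  unfolding chain_of_def by (simp add: coef_sum lookup_single when_def sum.delta)

lemma mem_chains_iff: "c \<in> chains S \<longleftrightarrow> (\<forall>e. e \<notin> S \<longrightarrow> coef c e = 0)"
  by (auto simp: chains_def subset_iff in_keys_iff)

lemma coef_outside: "c \<in> chains S \<Longrightarrow> e \<notin> S \<Longrightarrow> coef c e = 0"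
  by (simp add: mem_chains_iff)

lemma chain_of_mem [simp]: "finite S \<Longrightarrow> chain_of S g \<in> chains S"
  by (simp add: mem_chains_iff coef_chain_of)

lemma chains_eqI:
  assumes "x \<in> chains S" "y \<in> chains S" "\<And>e. e \<in> S \<Longrightarrow> coef x e = coef y e"
  shows "x = y"
  using assms by (metis mem_chains_iff poly_mapping_eqI)

lemma chains_0 [simp]: "0 \<in> chains S"
  by (simp add: mem_chains_iff)

lemma chains_add: "x \<in> chains S \<Longrightarrow> y \<in> chains S \<Longrightarrow> x + y \<in> chains S"
  by (simp add: mem_chains_iff lookup_add)

lemma chains_diff: "x \<in> chains S \<Longrightarrow> y \<in> chains S \<Longrightarrow> x - y \<in> chains S"
  by (simp add: mem_chains_iff lookup_minus)

lemma base_change_mem: "c \<in> chains S \<Longrightarrow> base_change c \<in> chains S"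
  by (simp add: mem_chains_iff)

lemma bit_chain_add_self [simp]: "x + x = 0" for x :: "'a \<Rightarrow>\<^sub>0 bit"
  by (rule poly_mapping_eqI) (simp add: lookup_add)

lemma bit_chain_diff: "x - y = x + y" for x y :: "'a \<Rightarrow>\<^sub>0 bit"
  by (rule poly_mapping_eqI) (simp add: lookup_add lookup_minus)

lemma bit_chain_uminus: "- x = x" for x :: "'a \<Rightarrow>\<^sub>0 bit"
  by (rule poly_mapping_eqI) simp

lemma base_change_bit_cases:
  assumes "finite S" "x \<in> chains S"
  obtains c where "c \<in> chains S" "base_change c = (x :: 'a \<Rightarrow>\<^sub>0 bit)"
proof
  let ?c = "chain_of S (\<lambda>e. if coef x e = 0 then 0 else 1)"
  show "?c \<in> chains S" using assms by simp
  show "base_change ?c = x"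
    using assms by (intro chains_eqI[of _ S] base_change_mem) (auto simp: coef_chain_of bit_not_zero_iff)
qed

section \<open>Cycles, bonds and potentials\<close>

lemma coef_coboundary:
  assumes "finite (arcs H)"
  shows "coef (coboundary H y) e =
    (if e \<in> arcs H then coef y (head H e) - coef y (tail H e) else 0)"
  using assms coef_chain_of[of "arcs H" "\<lambda>e. coef y (head H e) - coef y (tail H e)" e]
  unfolding coboundary_def chain_of_def by simp

text \<open>The potential is an arbitrary function on the vertex type: only its values at ends of
  arcs matter, and these lie in \<open>verts G\<close>. Later potentials can therefore be defined by
  cases without restricting their support.\<close>

lemma (in fin_digraph) mem_bond_space_iff:
  "b \<in> bond_space G \<longleftrightarrow> b \<in> chains (arcs G) \<and>
     (\<exists>Y. \<forall>e\<in>arcs G. coef b e = Y (head G e) - Y (tail G e))"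
proof
  assume "b \<in> bond_space G"
  then obtain y where "b = coboundary G y" by (auto simp: bond_space_def)
  then show "b \<in> chains (arcs G) \<and> (\<exists>Y. \<forall>e\<in>arcs G. coef b e = Y (head G e) - Y (tail G e))"
    by (auto simp: mem_chains_iff coef_coboundary)
next
  assume "b \<in> chains (arcs G) \<and> (\<exists>Y. \<forall>e\<in>arcs G. coef b e = Y (head G e) - Y (tail G e))"
  then obtain Y where b: "b \<in> chains (arcs G)" "\<forall>e\<in>arcs G. coef b e = Y (head G e) - Y (tail G e)"
    by blast
  have "b = coboundary G (chain_of (verts G) Y)"
    by (rule chains_eqI[OF b(1)])
      (auto simp: b mem_chains_iff coef_coboundary coef_chain_of)
  then show "b \<in> bond_space G" by (auto simp: bond_space_def)
qed

text \<open>Boundary and coboundary are adjoint (\<open>adj\<close>), so zero boundary makes the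
  pairing with every coboundary vanish. Conversely, the indicator of a vertex as potential returns
  the boundary coefficient there.\<close>

lemma (in fin_digraph) mem_cycle_space_iff:
  "c \<in> cycle_space G \<longleftrightarrow> c \<in> chains (arcs G) \<and>
     (\<forall>Y. (\<Sum>e\<in>arcs G. coef c e * (Y (head G e) - Y (tail G e))) = 0)"
proof -
  have bd: "coef (boundary G c) v =
      (\<Sum>e\<in>arcs G. coef c e * (of_bool (head G e = v) - of_bool (tail G e = v)))"
    if "c \<in> chains (arcs G)" for v
  proof -
    have "coef (boundary G c) v = (\<Sum>e\<in>Poly_Mapping.keys c.
        coef c e * (of_bool (head G e = v) - of_bool (tail G e = v)))"
      unfolding boundary_def coef_sum
      by (intro sum.cong) (auto simp: lookup_minus lookup_single when_def algebra_simps)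
    also have "\<dots> = (\<Sum>e\<in>arcs G. coef c e * (of_bool (head G e = v) - of_bool (tail G e = v)))"
      using that by (intro sum.mono_neutral_left) (auto simp: chains_def in_keys_iff)
    finally show ?thesis .
  qed
  have adj: "(\<Sum>e\<in>arcs G. coef c e * (Y (head G e) - Y (tail G e))) =
      (\<Sum>v\<in>verts G. coef (boundary G c) v * Y v)"
    if "c \<in> chains (arcs G)" for Y
  proof -
    have "(\<Sum>v\<in>verts G. coef (boundary G c) v * Y v) = (\<Sum>v\<in>verts G. \<Sum>e\<in>arcs G.
        coef c e * (of_bool (head G e = v) * Y v - of_bool (tail G e = v) * Y v))"
      unfolding bd[OF that] by (simp add: sum_distrib_left sum_distrib_right algebra_simps)
    also have "\<dots> = (\<Sum>e\<in>arcs G. \<Sum>v\<in>verts G.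
        coef c e * (of_bool (head G e = v) * Y v - of_bool (tail G e = v) * Y v))"
      by (rule sum.swap)
    also have "\<dots> = (\<Sum>e\<in>arcs G. coef c e *
        ((\<Sum>v\<in>verts G. if head G e = v then Y v else 0) - (\<Sum>v\<in>verts G. if tail G e = v then Y v else 0)))"
      by (simp add: sum_distrib_left [symmetric] sum_subtractf of_bool_def if_distrib[of "\<lambda>x. x * _"]
          cong: if_cong)
    also have "\<dots> = (\<Sum>e\<in>arcs G. coef c e * (Y (head G e) - Y (tail G e)))"
      by (intro sum.cong) auto
    finally show ?thesis by simp
  qed
  show ?thesis
  proof (cases "c \<in> chains (arcs G)")
    case True
    have "boundary G c = 0 \<longleftrightarrow> (\<forall>Y. (\<Sum>e\<in>arcs G. coef c e * (Y (head G e) - Y (tail G e))) = 0)"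
    proof
      assume "boundary G c = 0"
      then show "\<forall>Y. (\<Sum>e\<in>arcs G. coef c e * (Y (head G e) - Y (tail G e))) = 0"
        using adj[OF True] by simp
    next
      assume *: "\<forall>Y. (\<Sum>e\<in>arcs G. coef c e * (Y (head G e) - Y (tail G e))) = 0"
      show "boundary G c = 0"
      proof (rule poly_mapping_eqI)
        fix v show "coef (boundary G c) v = coef 0 v"
          using bd[OF True, of v] *[rule_format, of "\<lambda>w. of_bool (w = v)"] by simp
      qed
    qed
    with True show ?thesis by (simp add: cycle_space_def)
  qed (simp add: cycle_space_def)
qed

text \<open>A potential with values in any ring is a combination of indicators of the finitely many
  ends, and indicators are integral. Bare end maps instead of a digraph make this applicable to the
  growing edge set in \<open>potential_exists\<close>.\<close>

lemma int_cycle_test: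
  fixes z :: "'e \<Rightarrow> int" and Y :: "'v \<Rightarrow> 'r::comm_ring_1"
  assumes "finite F" and cyc: "\<And>Y :: 'v \<Rightarrow> int. (\<Sum>e\<in>F. z e * (Y (h e) - Y (t e))) = 0"
  shows "(\<Sum>e\<in>F. of_int (z e) * (Y (h e) - Y (t e))) = 0"
proof -
  let ?W = "h ` F \<union> t ` F"
  have "(\<Sum>e\<in>F. of_int (z e) * (Y (h e) - Y (t e))) =
      (\<Sum>e\<in>F. of_int (z e) * ((\<Sum>w\<in>?W. Y w * of_bool (h e = w)) - (\<Sum>w\<in>?W. Y w * of_bool (t e = w))))"
  proof (rule sum.cong[OF refl])
    fix e assume e: "e \<in> F"
    have "(\<Sum>w\<in>?W. Y w * of_bool (u = w)) = Y u" if "u \<in> ?W" for u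
    proof -
      have "(\<Sum>w\<in>?W. Y w * of_bool (u = w)) = (\<Sum>w\<in>?W. if u = w then Y w else 0)"
        by (intro sum.cong) auto
      then show ?thesis using that assms(1) by (simp add: sum.delta')
    qed
    then show "of_int (z e) * (Y (h e) - Y (t e)) =
        of_int (z e) * ((\<Sum>w\<in>?W. Y w * of_bool (h e = w)) - (\<Sum>w\<in>?W. Y w * of_bool (t e = w)))"
      using e by simp
  qed
  also have "\<dots> = (\<Sum>e\<in>F. \<Sum>w\<in>?W. Y w * of_int (z e * (of_bool (h e = w) - of_bool (t e = w))))"
    unfolding sum_subtractf [symmetric] sum_distrib_left by (simp add: algebra_simps)
  also have "\<dots> = (\<Sum>w\<in>?W. Y w * of_int (\<Sum>e\<in>F. z e * (of_bool (h e = w) - of_bool (t e = w))))"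
    unfolding of_int_sum sum_distrib_left by (rule sum.swap)
  also have "\<dots> = 0"
  proof (rule sum.neutral, rule ballI)
    fix w show "Y w * of_int (\<Sum>e\<in>F. z e * (of_bool (h e = w) - of_bool (t e = w))) = 0"
      using cyc[of "\<lambda>x. of_bool (x = w)"] by simp
  qed
  finally show ?thesis .
qed

text \<open>If the new edge closes an integral cycle, the potential already fits; otherwise the
  potential can be shifted on the component of one of its ends.\<close>

lemma potential_exists:
  fixes b :: "'e \<Rightarrow> 'r::comm_ring_1" and h t :: "'e \<Rightarrow> 'v"
  assumes "finite F"
    and "\<And>z :: 'e \<Rightarrow> int. (\<And>Y :: 'v \<Rightarrow> int. (\<Sum>e\<in>F. z e * (Y (h e) - Y (t e))) = 0) \<Longrightarrow>
      (\<Sum>e\<in>F. of_int (z e) * b e) = 0"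
  shows "\<exists>Y. \<forall>e\<in>F. b e = Y (h e) - Y (t e)"
  using assms
proof (induction F rule: finite_induct)
  case empty
  then show ?case by simp
next
  case (insert a F)
  have "\<exists>Y. \<forall>e\<in>F. b e = Y (h e) - Y (t e)"
  proof (rule insert.IH)
    fix z :: "'e \<Rightarrow> int" assume *: "\<And>Y :: 'v \<Rightarrow> int. (\<Sum>e\<in>F. z e * (Y (h e) - Y (t e))) = 0"
    have eq: "(\<Sum>e\<in>F. (z(a := 0)) e * (Y (h e) - Y (t e))) = (\<Sum>e\<in>F. z e * (Y (h e) - Y (t e)))" for Y
      using insert.hyps by (intro sum.cong) auto
    have "(\<Sum>e\<in>insert a F. of_int ((z(a := 0)) e) * b e) = 0"
      using insert.hyps * eq by (intro insert.prems) (simp del: fun_upd_apply, simp)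
    moreover have "(\<Sum>e\<in>F. of_int ((z(a := 0)) e) * b e) = (\<Sum>e\<in>F. of_int (z e) * b e)"
      using insert.hyps by (intro sum.cong) auto
    ultimately show "(\<Sum>e\<in>F. of_int (z e) * b e) = 0"
      using insert.hyps by (simp del: fun_upd_apply) simp
  qed
  then obtain Y where Y: "\<And>e. e \<in> F \<Longrightarrow> b e = Y (h e) - Y (t e)" by blast
  \<comment> \<open>\<open>w\<close> lies in \<open>S\<close> when some integral chain on
    \<open>F\<close> has boundary \<open>w - h a\<close>; this is the component of
    \<open>h a\<close> in the graph with edge set \<open>F\<close>.\<close>
  define S where "S = {w. \<exists>z :: 'e \<Rightarrow> int. \<forall>Y :: 'v \<Rightarrow> int.
    (\<Sum>e\<in>F. z e * (Y (h e) - Y (t e))) = Y w - Y (h a)}"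
  have step: "w' \<in> S" if "w \<in> S" "e \<in> F" "k = 1 \<and> w = h e \<and> w' = t e \<or> k = -1 \<and> w = t e \<and> w' = h e"
    for w w' e and k :: int
  proof -
    from that(1) obtain z :: "'e \<Rightarrow> int" where z: "\<forall>Y :: 'v \<Rightarrow> int. (\<Sum>e\<in>F. z e * (Y (h e) - Y (t e))) = Y w - Y (h a)"
      unfolding S_def mem_Collect_eq by (rule exE)
    have "(\<Sum>x\<in>F. (z x - (if x = e then k else 0)) * (Y (h x) - Y (t x))) = Y w' - Y (h a)"
      for Y :: "'v \<Rightarrow> int"
    proof -
      have "(\<Sum>x\<in>F. (z x - (if x = e then k else 0)) * (Y (h x) - Y (t x))) =
        (\<Sum>x\<in>F. z x * (Y (h x) - Y (t x))) - (\<Sum>x\<in>F. if x = e then k * (Y (h e) - Y (t e)) else 0)"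
        unfolding sum_subtractf [symmetric] by (intro sum.cong) (auto simp: algebra_simps)
      also have "\<dots> = Y w - Y (h a) - k * (Y (h e) - Y (t e))"
        using z that(2) insert.hyps by simp
      finally show ?thesis using that(3) by auto
    qed
    then show ?thesis
      unfolding S_def mem_Collect_eq by (intro exI[of _ "\<lambda>x. z x - (if x = e then k else 0)"] allI)
  qed
  have "h a \<in> S" unfolding S_def mem_Collect_eq by (rule exI[of _ "\<lambda>_. 0"]) simp
  show ?case
  proof (cases "t a \<in> S")
    case True
    then obtain z :: "'e \<Rightarrow> int" where z:
      "\<forall>Y :: 'v \<Rightarrow> int. (\<Sum>e\<in>F. z e * (Y (h e) - Y (t e))) = Y (t a) - Y (h a)"
      unfolding S_def mem_Collect_eq by (rule exE)
    \<comment> \<open>The chain leading from \<open>h a\<close> to \<open>t a\<close> is closed to a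
      cycle by the edge \<open>a\<close> itself. Orthogonality of \<open>b\<close> to this cycle
      determines \<open>b a\<close>.\<close>
    let ?z = "z(a := 1)"
    have eq: "(\<Sum>e\<in>F. of_int (?z e) * g e) = (\<Sum>e\<in>F. of_int (z e) * g e)" for g :: "'e \<Rightarrow> 's::comm_ring_1"
      using insert.hyps by (intro sum.cong) auto
    have cyc: "(\<Sum>e\<in>insert a F. ?z e * (Y (h e) - Y (t e))) = 0" for Y :: "'v \<Rightarrow> int"
      using insert.hyps eq[of "\<lambda>e. Y (h e) - Y (t e)"] z[rule_format, of Y] by (simp del: fun_upd_apply) simp
    have "(\<Sum>e\<in>insert a F. of_int (?z e) * b e) = 0"
      using cyc by (intro insert.prems)
    moreover have "(\<Sum>e\<in>insert a F. of_int (?z e) * (Y (h e) - Y (t e))) = 0"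
      using cyc insert.hyps by (intro int_cycle_test) auto
    moreover have "(\<Sum>e\<in>F. of_int (?z e) * b e) = (\<Sum>e\<in>F. of_int (?z e) * (Y (h e) - Y (t e)))"
      by (intro sum.cong) (auto simp: Y)
    ultimately have "b a = Y (h a) - Y (t a)"
      using insert.hyps by (simp del: fun_upd_apply) (simp add: eq_neg_iff_add_eq_0 [symmetric])
    with Y show ?thesis by blast
  next
    case False
    \<comment> \<open>Defect of the potential at \<open>a\<close>. No edge of \<open>F\<close>
      leaves \<open>S\<close>, which contains \<open>h a\<close> but not \<open>t a\<close>, so
      adding \<open>k\<close> on \<open>S\<close> changes only the difference along
      \<open>a\<close>.\<close>
    define k where "k = b a - (Y (h a) - Y (t a))"
    have "h e \<in> S \<longleftrightarrow> t e \<in> S" if "e \<in> F" for e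
      using step[of _ e 1] step[of _ e "-1"] that by blast
    then have "\<forall>e\<in>insert a F. b e = (Y (h e) + (if h e \<in> S then k else 0)) - (Y (t e) + (if t e \<in> S then k else 0))"
      using False \<open>h a \<in> S\<close> by (auto simp: Y k_def)
    then show ?thesis by (intro exI[of _ "\<lambda>w. Y w + (if w \<in> S then k else 0)"])
  qed
qed

text \<open>The test cycles are integral whatever the coefficient ring; the harder direction is
  \<open>potential_exists\<close>. This makes integral bond spaces closed under halving, and it lets
  reductions of integral cycles detect the bonds modulo 2.\<close>

lemma (in fin_digraph) mem_bond_space_iff_orthogonal:
  "b \<in> bond_space G \<longleftrightarrow> b \<in> chains (arcs G) \<and>
     (\<forall>z\<in>cycle_space G. (\<Sum>e\<in>arcs G. of_int (coef z e) * coef b e) = 0)"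
proof
  assume b: "b \<in> bond_space G"
  then obtain Y where Y: "\<forall>e\<in>arcs G. coef b e = Y (head G e) - Y (tail G e)"
    unfolding mem_bond_space_iff by blast
  have "(\<Sum>e\<in>arcs G. of_int (coef z e) * coef b e) = 0" if "z \<in> cycle_space G" for z
    using int_cycle_test[of "arcs G" "coef z" "head G" "tail G" Y] that Y
    by (simp add: mem_cycle_space_iff)
  with b show "b \<in> chains (arcs G) \<and> (\<forall>z\<in>cycle_space G. (\<Sum>e\<in>arcs G. of_int (coef z e) * coef b e) = 0)"
    unfolding mem_bond_space_iff by blast
next
  assume b: "b \<in> chains (arcs G) \<and> (\<forall>z\<in>cycle_space G. (\<Sum>e\<in>arcs G. of_int (coef z e) * coef b e) = 0)"
  have "\<exists>Y. \<forall>e\<in>arcs G. coef b e = Y (head G e) - Y (tail G e)"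
  proof (rule potential_exists)
    fix z :: "'b \<Rightarrow> int"
    assume z: "\<And>Y :: 'a \<Rightarrow> int. (\<Sum>e\<in>arcs G. z e * (Y (head G e) - Y (tail G e))) = 0"
    have "chain_of (arcs G) z \<in> cycle_space G"
      unfolding mem_cycle_space_iff using z by (simp add: coef_chain_of)
    with b have "(\<Sum>e\<in>arcs G. of_int (coef (chain_of (arcs G) z) e) * coef b e) = 0" by blast
    then show "(\<Sum>e\<in>arcs G. of_int (z e) * coef b e) = 0" by (simp add: coef_chain_of)
  qed simp
  with b show "b \<in> bond_space G" by (simp add: mem_bond_space_iff)
qed

context fin_digraph
begin

lemma cycle_space_subset: "cycle_space G \<subseteq> chains (arcs G)"
  by (auto simp: cycle_space_def)

lemma cycle_space_0 [simp]: "0 \<in> cycle_space G"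
  by (simp add: mem_cycle_space_iff)

lemma cycle_space_add: "x \<in> cycle_space G \<Longrightarrow> y \<in> cycle_space G \<Longrightarrow> x + y \<in> cycle_space G"
  by (simp add: mem_cycle_space_iff chains_add lookup_add distrib_right sum.distrib)

lemma cycle_space_diff: "x \<in> cycle_space G \<Longrightarrow> y \<in> cycle_space G \<Longrightarrow> x - y \<in> cycle_space G"
  by (simp add: mem_cycle_space_iff chains_diff lookup_minus left_diff_distrib sum_subtractf)

lemma bond_space_subset: "bond_space G \<subseteq> chains (arcs G)"
  by (auto simp: mem_bond_space_iff)

lemma bond_space_0 [simp]: "0 \<in> bond_space G"
  by (auto simp: mem_bond_space_iff)

lemma bond_space_diff: "x \<in> bond_space G \<Longrightarrow> y \<in> bond_space G \<Longrightarrow> x - y \<in> bond_space G"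
  by (auto simp: mem_bond_space_iff_orthogonal chains_diff lookup_minus right_diff_distrib sum_subtractf)

lemma bond_space_add: "x \<in> bond_space G \<Longrightarrow> y \<in> bond_space G \<Longrightarrow> x + y \<in> bond_space G"
  by (auto simp: mem_bond_space_iff_orthogonal chains_add lookup_add distrib_left sum.distrib)

lemma cycle_orthogonal_bond:
  assumes "z \<in> cycle_space G" "b \<in> bond_space G"
  shows "(\<Sum>e\<in>arcs G. coef z e * coef b e) = 0"
  using assms by (auto simp: mem_cycle_space_iff mem_bond_space_iff)

text \<open>Such a chain is orthogonal to itself, and a sum of integer squares vanishes only if
  every term does. Modulo 2 this argument breaks down, and bicycles appear.\<close>

lemma cycle_bond_Int:
  assumes "c \<in> cycle_space G" "c \<in> bond_space G"
  shows "c = (0 :: _ \<Rightarrow>\<^sub>0 int)"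
proof (rule chains_eqI)
  show "c \<in> chains (arcs G)" using assms cycle_space_subset by blast
  fix e assume "e \<in> arcs G"
  moreover have "(\<Sum>e\<in>arcs G. (coef c e)\<^sup>2) = 0"
    using cycle_orthogonal_bond[OF assms] by (simp add: power2_eq_square)
  ultimately show "coef c e = coef 0 e" by (simp add: sum_nonneg_eq_0_iff)
qed simp

lemma cycle_space_half:
  fixes x :: "_ \<Rightarrow>\<^sub>0 int"
  assumes "x + x \<in> cycle_space G" shows "x \<in> cycle_space G"
proof -
  have "x \<in> chains (arcs G)"
    using assms by (auto simp: mem_cycle_space_iff mem_chains_iff lookup_add)
  with assms show ?thesis
    by (simp add: mem_cycle_space_iff lookup_add mult.assoc flip: sum_distrib_left)
qed

text \<open>Orthogonality to cycles allows the factor 2 to be cancelled, whereas a potential of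
  \<open>x + x\<close> need not have even values.\<close>

lemma bond_space_half:
  fixes x :: "_ \<Rightarrow>\<^sub>0 int"
  assumes "x + x \<in> bond_space G" shows "x \<in> bond_space G"
proof -
  have "x \<in> chains (arcs G)"
    using assms by (auto simp: mem_bond_space_iff mem_chains_iff lookup_add)
  with assms show ?thesis
    by (simp add: mem_bond_space_iff_orthogonal lookup_add mult.left_commute[of _ 2] flip: sum_distrib_left)
qed

lemma cycles_plus_bondsI: "z \<in> cycle_space G \<Longrightarrow> b \<in> bond_space G \<Longrightarrow> z + b \<in> cycles_plus_bonds G"
  by (auto simp: cycles_plus_bonds_def)

lemma cycles_plus_bondsE:
  assumes "x \<in> cycles_plus_bonds G"
  obtains z b where "z \<in> cycle_space G" "b \<in> bond_space G" "x = z + b"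
  using assms by (auto simp: cycles_plus_bonds_def)

lemma cycle_in_cycles_plus_bonds: "z \<in> cycle_space G \<Longrightarrow> z \<in> cycles_plus_bonds G"
  using cycles_plus_bondsI[of z 0] by simp

lemma bond_in_cycles_plus_bonds: "b \<in> bond_space G \<Longrightarrow> b \<in> cycles_plus_bonds G"
  using cycles_plus_bondsI[of 0 b] by simp

lemma cycles_plus_bonds_subset: "cycles_plus_bonds G \<subseteq> chains (arcs G)"
  using cycle_space_subset bond_space_subset by (blast intro: chains_add elim: cycles_plus_bondsE)

lemma cycles_plus_bonds_0 [simp]: "0 \<in> cycles_plus_bonds G"
  by (simp add: cycle_in_cycles_plus_bonds)

lemma cycles_plus_bonds_add:
  assumes "x \<in> cycles_plus_bonds G" "y \<in> cycles_plus_bonds G"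
  shows "x + y \<in> cycles_plus_bonds G"
proof -
  obtain z b z' b' where "z \<in> cycle_space G" "b \<in> bond_space G" "x = z + b"
    "z' \<in> cycle_space G" "b' \<in> bond_space G" "y = z' + b'"
    using assms by (elim cycles_plus_bondsE)
  moreover have "(z + b) + (z' + b') = (z + z') + (b + b')" by (simp add: algebra_simps)
  ultimately show ?thesis by (metis cycles_plus_bondsI cycle_space_add bond_space_add)
qed

lemma cycles_plus_bonds_diff:
  assumes "x \<in> cycles_plus_bonds G" "y \<in> cycles_plus_bonds G"
  shows "x - y \<in> cycles_plus_bonds G"
proof -
  obtain z b z' b' where "z \<in> cycle_space G" "b \<in> bond_space G" "x = z + b"
    "z' \<in> cycle_space G" "b' \<in> bond_space G" "y = z' + b'"
    using assms by (elim cycles_plus_bondsE)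
  moreover have "(z + b) - (z' + b') = (z - z') + (b - b')" by (simp add: algebra_simps)
  ultimately show ?thesis by (metis cycles_plus_bondsI cycle_space_diff bond_space_diff)
qed

lemma cycles_plus_bonds_uminus: "x \<in> cycles_plus_bonds G \<Longrightarrow> - x \<in> cycles_plus_bonds G"
  using cycles_plus_bonds_diff[of 0 x] by simp

lemma cycles_plus_bonds_sum:
  "(\<And>i. i \<in> I \<Longrightarrow> x i \<in> cycles_plus_bonds G) \<Longrightarrow> (\<Sum>i\<in>I. x i) \<in> cycles_plus_bonds G"
  by (induction I rule: infinite_finite_induct) (auto intro: cycles_plus_bonds_add)

lemma cycles_plus_bonds_cmul:
  assumes "x \<in> cycles_plus_bonds G" shows "frag_cmul k x \<in> cycles_plus_bonds G"
proof -
  have n: "frag_cmul (int n) x \<in> cycles_plus_bonds G" for n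
    by (induction n) (use assms in \<open>auto simp: frag_cmul_distrib intro: cycles_plus_bonds_add\<close>)
  show ?thesis
  proof (cases k rule: int_cases2)
    case (nonpos m)
    then show ?thesis using cycles_plus_bonds_uminus[OF n[of m]] by simp
  qed (use n in simp)
qed

end

section \<open>The critical group\<close>

lemma group_additive_group:
  assumes "0 \<in> S" "\<And>x y. x \<in> S \<Longrightarrow> y \<in> S \<Longrightarrow> x + y \<in> S" "\<And>x. x \<in> S \<Longrightarrow> - x \<in> S"
  shows "group (additive_group S)"
  by (rule groupI) (use assms in \<open>auto simp: additive_group_def add.assoc intro!: bexI[of _ "- _"]\<close>)

lemma carrier_free_Abelian_group: "carrier (free_Abelian_group S) = chains S"
  by (auto simp: free_Abelian_group_def chains_def)

context fin_digraph
begin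

lemma normal_cycles_plus_bonds: "cycles_plus_bonds G \<lhd> free_Abelian_group (arcs G)"
proof -
  interpret F: comm_group "free_Abelian_group (arcs G)"
    by (rule abelian_free_Abelian_group)
  have "subgroup (cycles_plus_bonds G) (free_Abelian_group (arcs G))"
  proof (rule F.subgroupI)
    show "cycles_plus_bonds G \<subseteq> carrier (free_Abelian_group (arcs G))"
      using cycles_plus_bonds_subset carrier_free_Abelian_group by fast
    show "cycles_plus_bonds G \<noteq> {}" using cycles_plus_bonds_0 by blast
    fix a b assume a: "a \<in> cycles_plus_bonds G" and b: "b \<in> cycles_plus_bonds G"
    show "a \<otimes>\<^bsub>free_Abelian_group (arcs G)\<^esub> b \<in> cycles_plus_bonds G"
      using a b by (simp add: cycles_plus_bonds_add)
    have "Poly_Mapping.keys a \<subseteq> arcs G"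
      using a cycles_plus_bonds_subset by (auto simp: chains_def)
    then show "inv\<^bsub>free_Abelian_group (arcs G)\<^esub> a \<in> cycles_plus_bonds G"
      using a by (simp add: cycles_plus_bonds_uminus)
  qed
  then show ?thesis by (rule F.subgroup_imp_normal)
qed

lemma comm_group_critical_group: "comm_group (critical_group G)"
  unfolding critical_group_def
  using comm_group.abelian_FactGroup[OF abelian_free_Abelian_group]
    normal_imp_subgroup[OF normal_cycles_plus_bonds] by blast

lemma group_critical_group: "group (critical_group G)"
  using comm_group_critical_group by (rule comm_group.axioms(2))

lemma carrier_critical_group: "carrier (critical_group G) = critical_class G ` chains (arcs G)"
  unfolding critical_group_def carrier_FactGroup carrier_free_Abelian_group
  by (simp add: critical_class_def [abs_def])

lemma critical_class_mult:
  assumes "x \<in> chains (arcs G)" "y \<in> chains (arcs G)"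
  shows "critical_class G x \<otimes>\<^bsub>critical_group G\<^esub> critical_class G y = critical_class G (x + y)"
  using normal.rcos_sum[OF normal_cycles_plus_bonds, of x y] assms
  unfolding critical_group_def critical_class_def carrier_free_Abelian_group by simp

lemma critical_class_0: "critical_class G 0 = \<one>\<^bsub>critical_group G\<^esub>"
  unfolding critical_group_def critical_class_def
  by (auto simp: r_coset_def)

lemma critical_class_eq_iff:
  "critical_class G x = critical_class G y \<longleftrightarrow> x - y \<in> cycles_plus_bonds G"
proof
  assume "critical_class G x = critical_class G y"
  moreover have "x \<in> critical_class G x"
    by (auto simp: critical_class_def r_coset_def intro: bexI[of _ 0])
  ultimately show "x - y \<in> cycles_plus_bonds G"
    by (auto simp: critical_class_def r_coset_def)
next
  assume d: "x - y \<in> cycles_plus_bonds G"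
  have *: "critical_class G x \<subseteq> critical_class G y"
    if d: "x - y \<in> cycles_plus_bonds G" for x y
  proof
    fix u assume "u \<in> critical_class G x"
    then obtain c where "c \<in> cycles_plus_bonds G" "u = c + x"
      by (auto simp: critical_class_def r_coset_def)
    then have "c + (x - y) \<in> cycles_plus_bonds G" "u = (c + (x - y)) + y"
      using d by (auto intro: cycles_plus_bonds_add)
    then show "u \<in> critical_class G y"
      by (auto simp: critical_class_def r_coset_def intro!: bexI[of _ "c + (x - y)"])
  qed
  show "critical_class G x = critical_class G y"
    using *[OF d] *[of y x] cycles_plus_bonds_uminus[OF d] by simp
qed

end

text \<open>Two surjections from one set of representatives with the same fibres induce a bijection
  of their targets. \<open>R\<close> need not be a group: for products it suffices that one common
  representative exists. Kernel and cokernel are both compared with bicycles in this way, with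
  chains as representatives.\<close>

lemma iso_via_representatives:
  assumes A: "group A" and B: "group B"
    and p: "p ` R = carrier A" and q: "q ` R = carrier B"
    and eq: "\<And>x y. x \<in> R \<Longrightarrow> y \<in> R \<Longrightarrow> p x = p y \<longleftrightarrow> q x = q y"
    and mult: "\<And>x y. x \<in> R \<Longrightarrow> y \<in> R \<Longrightarrow>
      \<exists>z\<in>R. p z = p x \<otimes>\<^bsub>A\<^esub> p y \<and> q z = q x \<otimes>\<^bsub>B\<^esub> q y"
  shows "A \<cong> B"
proof -
  define h where "h a = q (inv_into R p a)" for a
  have h: "h (p x) = q x" if "x \<in> R" for x
  proof -
    have "inv_into R p (p x) \<in> R" "p (inv_into R p (p x)) = p x"
      using that by (auto intro: inv_into_into f_inv_into_f)
    then show ?thesis unfolding h_def using eq that by blast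
  qed
  have "h \<in> hom A B"
  proof (rule homI)
    fix a assume "a \<in> carrier A"
    then obtain x where "x \<in> R" "a = p x" using p by blast
    then show "h a \<in> carrier B" using q h by auto
  next
    fix a b assume "a \<in> carrier A" "b \<in> carrier A"
    then obtain x y where xy: "x \<in> R" "y \<in> R" "a = p x" "b = p y" using p by blast
    with mult obtain z where "z \<in> R" "p z = a \<otimes>\<^bsub>A\<^esub> b" "q z = q x \<otimes>\<^bsub>B\<^esub> q y" by blast
    with h[of z] h[of x] h[of y] xy
    show "h (a \<otimes>\<^bsub>A\<^esub> b) = h a \<otimes>\<^bsub>B\<^esub> h b" by simp
  qed
  moreover have "bij_betw h (carrier A) (carrier B)"
    unfolding bij_betw_def
  proof
    show "inj_on h (carrier A)"
      unfolding p [symmetric] by (auto intro!: inj_onI simp: h eq)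
    show "h ` carrier A = carrier B"
      unfolding p [symmetric] q [symmetric] using h by force
  qed
  ultimately show ?thesis unfolding is_iso_def iso_def by blast
qed

lemma two_torsion_iso:
  assumes "group A" "group B" "A \<cong> B" "two_torsion B"
  shows "two_torsion A"
proof -
  obtain h where h: "h \<in> hom A B" "bij_betw h (carrier A) (carrier B)"
    using assms(3) by (auto simp: is_iso_def iso_def)
  interpret group_hom A B h using assms h by (simp add: group_hom_def group_hom_axioms_def)
  show ?thesis unfolding two_torsion_def
  proof
    fix x assume x: "x \<in> carrier A"
    have "h (x [^]\<^bsub>A\<^esub> (2::nat)) = h \<one>\<^bsub>A\<^esub>"
      using x assms(4) by (simp add: hom_nat_pow two_torsion_def)
    then show "x [^]\<^bsub>A\<^esub> (2::nat) = \<one>\<^bsub>A\<^esub>"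
      using h(2) x by (meson bij_betw_def G.nat_pow_closed G.one_closed inj_onD)
  qed
qed

lemma two_torsion_additive_group:
  assumes "\<And>x. x \<in> S \<Longrightarrow> x + x = 0" shows "two_torsion (additive_group S)"
  using assms by (auto simp: two_torsion_def numeral_2_eq_2 nat_pow_def additive_group_def)

text \<open>Both sides are the product of the orders of kernel, image and cokernel.\<close>

lemma (in group_hom) order_kernel_cokernel:
  assumes "finite (carrier G)" "comm_group H" "finite (carrier H)"
  shows "order H * order (ker_group G H h) = order G * order (coker_group G H h)"
proof -
  let ?I = "H\<lparr>carrier := h ` carrier G\<rparr>"
  have sub: "subgroup (h ` carrier G) H" by (rule img_is_subgroup)
  interpret I: group ?I using sub by (rule H.subgroup_imp_group)
  interpret GI: group_hom G ?I h
    by unfold_locales (auto simp: hom_def)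
  have "card (rcosets\<^bsub>G\<^esub> kernel G H h) * card (kernel G H h) = order G"
    using G.lagrange[OF subgroup_kernel] .
  moreover have "kernel G ?I h = kernel G H h" by (simp add: kernel_def)
  then have "G Mod kernel G H h \<cong> ?I" using GI.FactGroup_iso by simp
  then have "card (rcosets\<^bsub>G\<^esub> kernel G H h) = card (h ` carrier G)"
    by (auto simp: is_iso_def iso_def FactGroup_def dest: bij_betw_same_card)
  moreover have "card (rcosets\<^bsub>H\<^esub> (h ` carrier G)) * card (h ` carrier G) = order H"
    using H.lagrange[OF sub] .
  ultimately show ?thesis
    by (simp add: order_def ker_group_def coker_group_def FactGroup_def) (metis mult.commute mult.left_commute)
qed

section \<open>Finiteness of the critical group\<close>

text \<open>Gram-Schmidt without division: the last conjunct says that \<open>w\<close> behaves like a linear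
  combination of \<open>I\<close>, so that later orthogonalisation steps do not destroy earlier ones.\<close>

lemma integer_orthogonal_projection:
  fixes L :: "('e \<Rightarrow> int) set" and x :: "'e \<Rightarrow> int"
  assumes "finite E" "finite I" "I \<subseteq> L"
    and L0: "(\<lambda>_. 0) \<in> L"
    and L: "\<And>v w k l. v \<in> L \<Longrightarrow> w \<in> L \<Longrightarrow> (\<lambda>e. k * v e + l * w e) \<in> L"
  shows "\<exists>N>0. \<exists>w\<in>L. (\<forall>b\<in>I. (\<Sum>e\<in>E. (N * x e - w e) * b e) = 0) \<and>
    (\<forall>u. (\<forall>b\<in>I. (\<Sum>e\<in>E. u e * b e) = 0) \<longrightarrow> (\<Sum>e\<in>E. u e * w e) = 0)"
  using assms(2,3)
proof (induction I arbitrary: x rule: finite_induct)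
  case empty
  then show ?case using L0 by (intro exI[of _ 1] conjI bexI[of _ "\<lambda>_. 0"]) auto
next
  case (insert b I)
  define ip where "ip u v = (\<Sum>e\<in>E. u e * v e)" for u v :: "'e \<Rightarrow> int"
  have ip_lin: "ip (\<lambda>e. k * u e + l * v e) w = k * ip u w + l * ip v w"
    and ip_lin': "ip w (\<lambda>e. k * u e + l * v e) = k * ip w u + l * ip w v" for k l u v w
    by (simp_all add: ip_def sum.distrib sum_distrib_left algebra_simps)
  obtain N w where N: "N > 0" "w \<in> L" "\<forall>i\<in>I. ip (\<lambda>e. N * x e - w e) i = 0"
    "\<And>u. \<forall>i\<in>I. ip u i = 0 \<Longrightarrow> ip u w = 0"
    using insert.IH[of x] insert.prems unfolding ip_def by blast
  obtain M w' where M: "M > 0" "w' \<in> L" "\<forall>i\<in>I. ip (\<lambda>e. M * b e - w' e) i = 0"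
    "\<And>u. \<forall>i\<in>I. ip u i = 0 \<Longrightarrow> ip u w' = 0"
    using insert.IH[of b] insert.prems unfolding ip_def by blast
  define u where "u e = N * x e - w e" for e
  define v where "v e = M * b e - w' e" for e
  have u: "\<forall>i\<in>I. ip u i = 0" and v: "\<forall>i\<in>I. ip v i = 0"
    using N(3) M(3) unfolding u_def [abs_def] v_def [abs_def] by auto
  \<comment> \<open>\<open>w'\<close> pairs to zero with everything orthogonal to \<open>I\<close>,
    so on such vectors \<open>v\<close> acts like \<open>M * b\<close>.\<close>
  have vb: "M * ip y b = ip y v" if "\<forall>i\<in>I. ip y i = 0" for y
  proof -
    have "v = (\<lambda>e. M * b e + (-1) * w' e)" by (auto simp: v_def)
    then show ?thesis using ip_lin'[of y M b "-1" w'] M(4)[OF that] by simp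
  qed
  show ?case
  proof (cases "ip v v = 0")
    case True
    have "v e = 0" if "e \<in> E" for e
    proof -
      have "(\<Sum>e\<in>E. (v e)\<^sup>2) = 0" using True by (simp add: ip_def power2_eq_square)
      then show ?thesis using that assms(1) by (simp add: sum_nonneg_eq_0_iff)
    qed
    then have "ip u v = 0" by (simp add: ip_def)
    then have "ip u b = 0" using vb[OF u] M(1) by simp
    then have "\<forall>i\<in>insert b I. ip u i = 0" using u by simp
    then show ?thesis
      using N unfolding u_def [abs_def] ip_def by (intro exI[of _ N] conjI bexI[of _ w]) auto
  next
    case False
    define d where "d = ip v v"
    have "d \<ge> 0" unfolding d_def ip_def by (intro sum_nonneg) simp
    with False have d: "d > 0" by (simp add: d_def)
    have "v \<in> L" using L[OF subsetD[OF insert.prems, of b] M(2), of M "-1"] by (simp add: v_def [abs_def])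
    \<comment> \<open>Gram-Schmidt would replace \<open>u\<close> by
      \<open>u - (ip u v / ip v v) * v\<close>. Multiplying by \<open>d = ip v v\<close> clears the
      denominator, and \<open>w2\<close> collects what is subtracted from
      \<open>d * N * x\<close>.\<close>
    define w2 where "w2 e = d * w e + ip u v * v e" for e
    have "w2 \<in> L" using L[OF N(2) \<open>v \<in> L\<close>] by (simp add: w2_def [abs_def])
    have r: "(\<lambda>e. d * N * x e - w2 e) = (\<lambda>e. d * u e + (- ip u v) * v e)"
      by (auto simp: u_def w2_def algebra_simps)
    have rI: "\<forall>i\<in>I. ip (\<lambda>e. d * u e + (- ip u v) * v e) i = 0"
      using u v ip_lin[of d u "- ip u v" v] by simp
    have "M * ip (\<lambda>e. d * u e + (- ip u v) * v e) b = 0"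
      using vb[OF rI] ip_lin[of d u "- ip u v" v v] by (simp add: d_def)
    then have "\<forall>i\<in>insert b I. ip (\<lambda>e. d * N * x e - w2 e) i = 0"
      using rI M(1) unfolding r by auto
    moreover have "ip y w2 = 0" if "\<forall>i\<in>insert b I. ip y i = 0" for y
      using that vb[of y] N(4)[of y] by (simp add: w2_def [abs_def] ip_lin')
    ultimately show ?thesis
      using N(1) d \<open>w2 \<in> L\<close> unfolding ip_def by (intro exI[of _ "d * N"] conjI bexI[of _ w2]) auto
  qed
qed

context fin_digraph
begin

text \<open>A suitable multiple of the orthogonal projection of \<open>x\<close> onto the bonds is
  itself an integral bond, and the remainder, being orthogonal to all vertex stars, is a
  cycle.\<close>

lemma multiple_in_cycles_plus_bonds:
  assumes "x \<in> chains (arcs G)"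
  shows "\<exists>N>0. frag_cmul N x \<in> cycles_plus_bonds G"
proof -
  define L where "L = {w :: 'b \<Rightarrow> int. \<exists>Y. \<forall>e\<in>arcs G. w e = Y (head G e) - Y (tail G e)}"
  \<comment> \<open>The vertex stars: coboundaries of single vertices, which span all
    coboundaries.\<close>
  define I where "I = (\<lambda>v e. of_bool (head G e = v) - of_bool (tail G e = v) :: int) ` verts G"
  have I: "finite I" "I \<subseteq> L"
    unfolding I_def L_def by (auto intro!: exI[of _ "\<lambda>u. of_bool (u = _)"])
  have L0: "(\<lambda>_. 0) \<in> L" by (auto simp: L_def)
  have L: "(\<lambda>e. k * v e + l * w e) \<in> L" if "v \<in> L" "w \<in> L" for v w k l
  proof -
    from that obtain Y Y' where "\<forall>e\<in>arcs G. v e = Y (head G e) - Y (tail G e)"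
      "\<forall>e\<in>arcs G. w e = Y' (head G e) - Y' (tail G e)"
      unfolding L_def by blast
    then show ?thesis unfolding L_def
      by (intro CollectI exI[of _ "\<lambda>u. k * Y u + l * Y' u"]) (simp add: right_diff_distrib)
  qed
  obtain N w where N: "N > 0" "w \<in> L"
    "\<forall>b\<in>I. (\<Sum>e\<in>arcs G. (N * coef x e - w e) * b e) = 0"
    using integer_orthogonal_projection[OF finite_arcs I L0 L, of "coef x"] by blast
  let ?w = "chain_of (arcs G) w"
  have w: "?w \<in> bond_space G"
    using N(2) by (auto simp: L_def mem_bond_space_iff coef_chain_of)
  have "frag_cmul N x - ?w \<in> cycle_space G"
  proof -
    have mem: "frag_cmul N x - ?w \<in> chains (arcs G)"
      using assms by (simp add: mem_chains_iff lookup_minus coef_chain_of)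
    have c: "coef (frag_cmul N x - ?w) e = N * coef x e - w e" if "e \<in> arcs G" for e
      using that by (simp add: lookup_minus coef_chain_of)
    have "(\<Sum>e\<in>arcs G. (N * coef x e - w e) * (Y (head G e) - Y (tail G e))) = 0" for Y
    proof -
      have Y: "Y u = (\<Sum>v\<in>verts G. Y v * of_bool (u = v))" if "u \<in> verts G" for u
      proof -
        have "(\<Sum>v\<in>verts G. Y v * of_bool (u = v)) = (\<Sum>v\<in>verts G. if u = v then Y v else 0)"
          by (intro sum.cong) auto
        then show ?thesis using that by simp
      qed
      have "(\<Sum>e\<in>arcs G. (N * coef x e - w e) * (Y (head G e) - Y (tail G e))) =
        (\<Sum>e\<in>arcs G. \<Sum>v\<in>verts G. Y v * ((N * coef x e - w e) *
          (of_bool (head G e = v) - of_bool (tail G e = v))))"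
      proof (rule sum.cong[OF refl])
        fix e assume "e \<in> arcs G"
        then have "Y (head G e) - Y (tail G e) =
            (\<Sum>v\<in>verts G. Y v * (of_bool (head G e = v) - of_bool (tail G e = v)))"
          using Y[of "head G e"] Y[of "tail G e"] by (simp add: sum_subtractf algebra_simps)
        then show "(N * coef x e - w e) * (Y (head G e) - Y (tail G e)) =
          (\<Sum>v\<in>verts G. Y v * ((N * coef x e - w e) *
            (of_bool (head G e = v) - of_bool (tail G e = v))))"
          by (simp add: sum_distrib_left mult.left_commute)
      qed
      also have "\<dots> = (\<Sum>v\<in>verts G. Y v * (\<Sum>e\<in>arcs G. (N * coef x e - w e) *
          (of_bool (head G e = v) - of_bool (tail G e = v))))"
        unfolding sum_distrib_left by (rule sum.swap)
      also have "\<dots> = 0" using N(3) unfolding I_def by (intro sum.neutral) simp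
      finally show ?thesis .
    qed
    with mem show ?thesis by (simp add: mem_cycle_space_iff c cong: sum.cong)
  qed
  from cycles_plus_bondsI[OF this w] N(1) show ?thesis by (intro exI[of _ N]) simp
qed

text \<open>Each edge class is killed by some \<open>N e > 0\<close>, so every class has a
  representative with coefficients in \<open>{0..<N e}\<close>.\<close>

lemma finite_critical_group: "finite (carrier (critical_group G))"
proof -
  have "\<forall>e\<in>arcs G. \<exists>N>0. frag_cmul N (frag_of e) \<in> cycles_plus_bonds G"
    using multiple_in_cycles_plus_bonds by (simp add: mem_chains_iff lookup_frag_of)
  from bchoice[OF this] obtain N
    where N: "\<And>e. e \<in> arcs G \<Longrightarrow> N e > 0 \<and> frag_cmul (N e) (frag_of e) \<in> cycles_plus_bonds G"
    by blast
  have "critical_class G x \<in> (\<lambda>g. critical_class G (chain_of (arcs G) g)) `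
      (PiE (arcs G) (\<lambda>e. {0..<N e}))" if x: "x \<in> chains (arcs G)" for x
  proof -
    define g where "g = restrict (\<lambda>e. coef x e mod N e) (arcs G)"
    have "x - chain_of (arcs G) g =
      (\<Sum>e\<in>arcs G. frag_cmul (coef x e div N e) (frag_cmul (N e) (frag_of e)))"
    proof (rule poly_mapping_eqI)
      fix e
      have "(\<Sum>a\<in>arcs G. coef (frag_cmul (coef x a div N a) (frag_cmul (N a) (frag_of a))) e) =
        (\<Sum>a\<in>arcs G. if a = e then coef x a div N a * N a else 0)"
        by (intro sum.cong) (auto simp: lookup_frag_of)
      then show "coef (x - chain_of (arcs G) g) e =
        coef (\<Sum>e\<in>arcs G. frag_cmul (coef x e div N e) (frag_cmul (N e) (frag_of e))) e"
        using x by (auto simp: coef_sum lookup_minus coef_chain_of g_def coef_outside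
            minus_mod_eq_div_mult)
    qed
    also have "\<dots> \<in> cycles_plus_bonds G"
      using N by (intro cycles_plus_bonds_sum) (rule cycles_plus_bonds_cmul, blast)
    finally have "critical_class G x = critical_class G (chain_of (arcs G) g)"
      by (simp add: critical_class_eq_iff)
    moreover have "g \<in> PiE (arcs G) (\<lambda>e. {0..<N e})" using N by (auto simp: g_def)
    ultimately show ?thesis by blast
  qed
  then have "carrier (critical_group G) \<subseteq> (\<lambda>g. critical_class G (chain_of (arcs G) g)) `
      (PiE (arcs G) (\<lambda>e. {0..<N e}))"
    unfolding carrier_critical_group by blast
  then show ?thesis by (rule finite_subset) (intro finite_imageI finite_PiE; simp)
qed

end

section \<open>Linear algebra over the field with two elements\<close>

definition dot :: "'a set \<Rightarrow> ('a \<Rightarrow>\<^sub>0 'r::comm_ring_1) \<Rightarrow> ('a \<Rightarrow>\<^sub>0 'r) \<Rightarrow> 'r" where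
  "dot E x y = (\<Sum>e\<in>E. coef x e * coef y e)"

text \<open>For chains over \<open>bit\<close> this says that \<open>S\<close> is a linear subspace.
  The type is general enough to cover pairs of chains.\<close>

definition add_closed :: "'a::monoid_add set \<Rightarrow> bool" where
  "add_closed S \<longleftrightarrow> 0 \<in> S \<and> (\<forall>x\<in>S. \<forall>y\<in>S. x + y \<in> S)"

definition orthogonal :: "'a set \<Rightarrow> ('a \<Rightarrow>\<^sub>0 bit) set \<Rightarrow> ('a \<Rightarrow>\<^sub>0 bit) set" where
  "orthogonal E S = {c \<in> chains E. \<forall>x\<in>S. dot E c x = 0}"

lemma dot_commute: "dot E x y = dot E y x"
  by (simp add: dot_def mult.commute)

lemma dot_add_left: "dot E (x + y) z = dot E x z + dot E y z"
  by (simp add: dot_def lookup_add distrib_right sum.distrib)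

lemma dot_add_right: "dot E z (x + y) = dot E z x + dot E z y"
  by (simp add: dot_def lookup_add distrib_left sum.distrib)

lemma dot_0 [simp]: "dot E 0 z = 0" "dot E z 0 = 0"
  by (simp_all add: dot_def)

lemma dot_base_change_frag_of:
  assumes "finite E" "e \<in> E" shows "dot E c (base_change (frag_of e)) = coef c e"
proof -
  have "dot E c (base_change (frag_of e)) = (\<Sum>a\<in>E. if a = e then coef c a else 0)"
    unfolding dot_def by (intro sum.cong) (auto simp: lookup_frag_of)
  then show ?thesis using assms by simp
qed

lemma add_closedD:
  assumes "add_closed S" shows "0 \<in> S" and "x \<in> S \<Longrightarrow> y \<in> S \<Longrightarrow> x + y \<in> S"
  using assms by (auto simp: add_closed_def)

lemma add_closed_sum:
  assumes "add_closed S" and "\<And>i. i \<in> I \<Longrightarrow> f i \<in> S" shows "(\<Sum>i\<in>I. f i) \<in> S"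
  using assms(2)
  by (induction I rule: infinite_finite_induct) (auto intro: add_closedD[OF assms(1)])

lemma add_closed_chains: "add_closed (chains S)"
  by (simp add: add_closed_def chains_add)

lemma add_closed_orthogonal: "add_closed (orthogonal E S)"
  by (auto simp: add_closed_def orthogonal_def chains_add dot_add_left)

text \<open>Gaussian elimination, one coordinate at a time. The last conjunct is the spanning
  property: subtracting from \<open>x\<close> the combination of the \<open>t p\<close> prescribed
  by its pivot coordinates leaves an element of \<open>S\<close> that vanishes on
  \<open>P\<close>.\<close>

lemma reduced_echelon_basis:
  fixes S :: "('a \<Rightarrow>\<^sub>0 bit) set"
  assumes "finite E" "S \<subseteq> chains E" "add_closed S"
  shows "\<exists>P t. P \<subseteq> E \<and> (\<forall>p\<in>P. t p \<in> S) \<and> (\<forall>p\<in>P. \<forall>q\<in>P. coef (t p) q = of_bool (p = q)) \<and>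
    (\<forall>x\<in>S. (\<forall>p\<in>P. coef x p = 0) \<longrightarrow> x = 0)"
  using assms
proof (induction E arbitrary: S rule: finite_induct)
  case empty
  have "x = 0" if "x \<in> S" for x
    using empty.prems(1) that by (intro chains_eqI[of _ "{}"]) auto
  then show ?case by (intro exI[of _ "{}"]) auto
next
  case (insert e E)
  define S' where "S' = {x \<in> S. coef x e = 0}"
  have S': "S' \<subseteq> chains E"
    using insert.prems(1) unfolding S'_def by (auto simp: mem_chains_iff subset_iff)
  have "add_closed S'"
    using insert.prems(2) by (auto simp: S'_def add_closed_def lookup_add)
  from insert.IH[OF S' this] obtain P t where P: "P \<subseteq> E" "\<forall>p\<in>P. t p \<in> S'"
    "\<forall>p\<in>P. \<forall>q\<in>P. coef (t p) q = of_bool (p = q)" "\<forall>x\<in>S'. (\<forall>p\<in>P. coef x p = 0) \<longrightarrow> x = 0"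
    by (elim exE conjE) (rule that)
  show ?case
  proof (cases "\<exists>u\<in>S. coef u e \<noteq> 0")
    case False
    then have "S' = S" unfolding S'_def by blast
    with P show ?thesis by (intro exI[of _ P] exI[of _ t] conjI) auto
  next
    case True
    then obtain u0 where u0: "u0 \<in> S" "coef u0 e = 1"
      by (metis bit_not_zero_iff)
    \<comment> \<open>\<open>u0\<close> with its coordinates at the old pivots cleared. The
      \<open>t p\<close> vanish at \<open>e\<close>, so the coordinate 1 at \<open>e\<close>
      survives, and the \<open>t p\<close> themselves need no change.\<close>
    define u where "u = u0 + (\<Sum>p\<in>P. if coef u0 p = 1 then t p else 0)"
    have finP: "finite P" using P(1) insert.hyps finite_subset by blast
    have cu: "coef u q = coef u0 q + (\<Sum>p\<in>P. coef u0 p * coef (t p) q)" for q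
      unfolding u_def lookup_add coef_sum
      by (intro arg_cong2[of _ _ _ _ "(+)"] sum.cong refl) (simp add: bit_not_one_iff)
    have "u \<in> S"
      unfolding u_def
    proof (rule add_closedD(2)[OF insert.prems(2) u0(1)], rule add_closed_sum[OF insert.prems(2)])
      fix p assume "p \<in> P"
      then show "(if coef u0 p = 1 then t p else 0) \<in> S"
        using P(2) add_closedD(1)[OF insert.prems(2)] by (simp add: S'_def)
    qed
    have ue: "coef u e = 1"
      using P(2) u0 unfolding cu by (simp add: S'_def)
    have uP: "coef u q = 0" if "q \<in> P" for q
    proof -
      have "(\<Sum>p\<in>P. coef u0 p * coef (t p) q) = (\<Sum>p\<in>P. if p = q then coef u0 p else 0)"
        using P(3) that by (intro sum.cong) auto
      then show ?thesis unfolding cu using that finP by simp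
    qed
    have "e \<notin> P" using P(1) insert.hyps by blast
    let ?t = "t(e := u)"
    have "\<forall>p\<in>insert e P. ?t p \<in> S" using \<open>u \<in> S\<close> P(2) by (auto simp: S'_def)
    moreover have "\<forall>p\<in>insert e P. \<forall>q\<in>insert e P. coef (?t p) q = of_bool (p = q)"
      using ue uP P(2,3) \<open>e \<notin> P\<close> by (auto simp: S'_def)
    moreover have "\<forall>x\<in>S. (\<forall>p\<in>insert e P. coef x p = 0) \<longrightarrow> x = 0"
      using P(4) by (auto simp: S'_def)
    moreover have "insert e P \<subseteq> insert e E" using P(1) by blast
    ultimately show ?thesis by (intro exI[of _ "insert e P"] exI[of _ ?t] conjI)
  qed
qed

text \<open>With a reduced echelon basis \<open>t\<close> of \<open>S\<close> on the pivots \<open>P\<close>, the vectors \<open>n q\<close> for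
  \<open>q \<in> E - P\<close> form the dual basis of the orthogonal space.\<close>

lemma orthogonal_basis:
  fixes S :: "('a \<Rightarrow>\<^sub>0 bit) set"
  assumes "finite E" "S \<subseteq> chains E" "add_closed S"
  obtains Q n where "Q \<subseteq> E" "\<And>q. q \<in> Q \<Longrightarrow> n q \<in> orthogonal E S"
    "\<And>q q'. q \<in> Q \<Longrightarrow> q' \<in> Q \<Longrightarrow> coef (n q) q' = of_bool (q = q')"
    "\<And>c. c \<in> orthogonal E S \<Longrightarrow> \<forall>q\<in>Q. coef c q = 0 \<Longrightarrow> c = 0"
    "\<And>x. x \<in> chains E \<Longrightarrow> \<forall>q\<in>Q. dot E x (n q) = 0 \<Longrightarrow> x \<in> S"
proof -
  from reduced_echelon_basis[OF assms]
  obtain P t where P: "P \<subseteq> E" "\<forall>p\<in>P. t p \<in> S"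
    "\<forall>p\<in>P. \<forall>q\<in>P. coef (t p) q = of_bool (p = q)" "\<forall>x\<in>S. (\<forall>p\<in>P. coef x p = 0) \<longrightarrow> x = 0"
    by (elim exE conjE) (rule that)
  have finP: "finite P" using P(1) assms(1) finite_subset by blast
  \<comment> \<open>The projection onto \<open>S\<close> that keeps the coordinates in
    \<open>P\<close>.\<close>
  define comb where "comb x = (\<Sum>p\<in>P. if coef x p = 1 then t p else 0)" for x :: "'a \<Rightarrow>\<^sub>0 bit"
  have coef_comb: "coef (comb x) e = (\<Sum>p\<in>P. coef x p * coef (t p) e)" for x e
    unfolding comb_def coef_sum by (intro sum.cong refl) (simp add: bit_not_one_iff)
  have comb_mem: "comb x \<in> S" for x
    unfolding comb_def using P(2) by (intro add_closed_sum[OF assms(3)]) (auto simp: add_closedD[OF assms(3)])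
  have comb_P: "coef (comb x) q = coef x q" if "q \<in> P" for x q
  proof -
    have "(\<Sum>p\<in>P. coef x p * coef (t p) q) = (\<Sum>p\<in>P. if p = q then coef x p else 0)"
      using P(3) that by (intro sum.cong) auto
    then show ?thesis unfolding coef_comb using that finP by simp
  qed
  have comb_S: "comb x = x" if "x \<in> S" for x
  proof -
    have "x + comb x \<in> S" using that comb_mem add_closedD[OF assms(3)] by blast
    moreover have "\<forall>p\<in>P. coef (x + comb x) p = 0" by (simp add: lookup_add comb_P)
    ultimately have "x + comb x = 0" using P(4) by blast
    then have "x + comb x + comb x = comb x" by simp
    then show ?thesis by (simp add: add.assoc)
  qed
  define n where "n q = chain_of E (\<lambda>e. if e \<in> P then coef (t e) q else of_bool (e = q))" for q
  \<comment> \<open>Pairing with \<open>n q\<close> reads off the coordinate at \<open>q\<close> of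
    \<open>x + comb x\<close>, that is, of the deviation of \<open>x\<close> from its
    projection.\<close>
  have dot_n: "dot E x (n q) = coef (comb x) q + coef x q" if "q \<in> E - P" for x q
  proof -
    have "dot E x (n q) = (\<Sum>e\<in>P. coef x e * coef (n q) e) + (\<Sum>e\<in>E - P. coef x e * coef (n q) e)"
      unfolding dot_def using sum.subset_diff[OF P(1) assms(1)] by (simp add: add.commute)
    also have "(\<Sum>e\<in>P. coef x e * coef (n q) e) = coef (comb x) q"
      unfolding coef_comb n_def using P(1) assms(1) by (intro sum.cong) (auto simp: coef_chain_of)
    also have "(\<Sum>e\<in>E - P. coef x e * coef (n q) e) = (\<Sum>e\<in>E - P. if e = q then coef x e else 0)"
      unfolding n_def using assms(1) by (intro sum.cong) (auto simp: coef_chain_of)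
    also have "\<dots> = coef x q" using that assms(1) by simp
    finally show ?thesis .
  qed
  show thesis
  proof (rule that[of "E - P" n])
    show "n q \<in> orthogonal E S" if "q \<in> E - P" for q
    proof -
      have "dot E (n q) x = 0" if "x \<in> S" for x
        unfolding dot_commute[of E "n q"] using dot_n[OF \<open>q \<in> E - P\<close>] comb_S[OF that] by simp
      then show ?thesis using assms(1) by (simp add: orthogonal_def n_def)
    qed
    show "coef (n q) q' = of_bool (q = q')" if "q \<in> E - P" "q' \<in> E - P" for q q'
      using that assms(1) by (auto simp: n_def coef_chain_of)
    show "c = 0" if c: "c \<in> orthogonal E S" "\<forall>q\<in>E - P. coef c q = 0" for c
    proof (rule chains_eqI)
      show "c \<in> chains E" using c(1) by (simp add: orthogonal_def)
      have "coef c p = 0" if "p \<in> P" for p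
      proof -
        have "dot E c (t p) = (\<Sum>e\<in>E. if e = p then coef c p else 0)"
          unfolding dot_def using c(2) P(3) that by (intro sum.cong) auto
        moreover have "dot E c (t p) = 0" using c(1) P(2) that by (simp add: orthogonal_def)
        ultimately show ?thesis using P(1) that assms(1) by auto
      qed
      then show "coef c e = coef 0 e" if "e \<in> E" for e using c(2) that by auto
    qed simp
    show "x \<in> S" if x: "x \<in> chains E" "\<forall>q\<in>E - P. dot E x (n q) = 0" for x
    proof -
      have "comb x = x"
      proof (rule chains_eqI)
        show "comb x \<in> chains E" using comb_mem assms(2) by blast
        show "coef (comb x) e = coef x e" if "e \<in> E" for e
          using x(2) dot_n[of e x] comb_P[of e x] that by (cases "e \<in> P") (auto simp: bit_add_eq_0_iff)
      qed (rule x(1))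
      then show ?thesis using comb_mem by metis
    qed
  qed auto
qed

lemma double_orthogonal:
  assumes "finite E" "S \<subseteq> chains E" "add_closed S" "x \<in> chains E"
    and "\<And>c. c \<in> orthogonal E S \<Longrightarrow> dot E x c = 0"
  shows "x \<in> S"
  using orthogonal_basis[OF assms(1-3)] assms(4,5) by metis

text \<open>The quotient of \<open>chains E\<close> by \<open>S\<close> is dual to the orthogonal
  space, and the basis \<open>n q\<close> identifies that space with its dual. The choice of basis
  turns the quotient that occurs as cokernel into the subspace formed by the bicycles.\<close>

lemma quotient_map_onto_orthogonal:
  fixes S :: "('a \<Rightarrow>\<^sub>0 bit) set"
  assumes "finite E" "S \<subseteq> chains E" "add_closed S"
  obtains \<pi> where "\<pi> ` chains E = orthogonal E S" "\<And>x y. \<pi> (x + y) = \<pi> x + \<pi> y"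
    "\<And>x. x \<in> chains E \<Longrightarrow> \<pi> x = 0 \<longleftrightarrow> x \<in> S"
proof -
  obtain Q n where Q: "Q \<subseteq> E" "\<And>q. q \<in> Q \<Longrightarrow> n q \<in> orthogonal E S"
    "\<And>q q'. q \<in> Q \<Longrightarrow> q' \<in> Q \<Longrightarrow> coef (n q) q' = of_bool (q = q')"
    "\<And>c. c \<in> orthogonal E S \<Longrightarrow> \<forall>q\<in>Q. coef c q = 0 \<Longrightarrow> c = 0"
    "\<And>x. x \<in> chains E \<Longrightarrow> \<forall>q\<in>Q. dot E x (n q) = 0 \<Longrightarrow> x \<in> S"
    using orthogonal_basis[OF assms] by blast
  have finQ: "finite Q" using Q(1) assms(1) finite_subset by blast
  define \<pi> where "\<pi> x = (\<Sum>q\<in>Q. if dot E x (n q) = 1 then n q else 0)" for x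
  have coef_\<pi>: "coef (\<pi> x) e = (\<Sum>q\<in>Q. dot E x (n q) * coef (n q) e)" for x e
    unfolding \<pi>_def coef_sum by (intro sum.cong refl) (simp add: bit_not_one_iff)
  have \<pi>_Q: "coef (\<pi> x) q = dot E x (n q)" if "q \<in> Q" for x q
  proof -
    have "coef (\<pi> x) q = (\<Sum>q'\<in>Q. if q' = q then dot E x (n q') else 0)"
      unfolding coef_\<pi> using Q(3) that by (intro sum.cong) auto
    then show ?thesis using that finQ by simp
  qed
  have \<pi>_mem: "\<pi> x \<in> orthogonal E S" for x
    unfolding \<pi>_def using Q(2) add_closedD[OF add_closed_orthogonal]
    by (intro add_closed_sum[OF add_closed_orthogonal]) auto
  show thesis
  proof (rule that[of \<pi>])
    show "\<pi> (x + y) = \<pi> x + \<pi> y" for x y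
      by (rule poly_mapping_eqI) (simp add: coef_\<pi> lookup_add dot_add_left distrib_right sum.distrib)
    show "\<pi> x = 0 \<longleftrightarrow> x \<in> S" if x: "x \<in> chains E" for x
    proof
      assume "\<pi> x = 0"
      then have "\<forall>q\<in>Q. dot E x (n q) = 0" using \<pi>_Q by (metis lookup_zero)
      with x show "x \<in> S" by (rule Q(5))
    next
      assume "x \<in> S"
      then have "\<forall>q\<in>Q. dot E x (n q) = 0"
        using Q(2) by (auto simp: orthogonal_def dot_commute[of E x])
      then show "\<pi> x = 0" unfolding \<pi>_def by (intro sum.neutral) simp
    qed
    show "\<pi> ` chains E = orthogonal E S"
    proof
      show "\<pi> ` chains E \<subseteq> orthogonal E S" using \<pi>_mem by blast
      show "orthogonal E S \<subseteq> \<pi> ` chains E"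
      proof
        fix c assume c: "c \<in> orthogonal E S"
        obtain x where x: "x \<in> chains E" "\<forall>q\<in>Q. dot E x (n q) = coef c q"
        \<comment> \<open>On the coordinates in \<open>Q\<close> the vectors \<open>n q\<close> are
          the standard basis, so a chain supported on \<open>Q\<close> has its own coefficients as
          pairings.\<close>
        proof (rule that[of "chain_of Q (coef c)"])
          show "chain_of Q (coef c) \<in> chains E"
            using Q(1) finQ by (auto simp: mem_chains_iff coef_chain_of)
          show "\<forall>q\<in>Q. dot E (chain_of Q (coef c)) (n q) = coef c q"
          proof
            fix q assume q: "q \<in> Q"
            have "dot E (chain_of Q (coef c)) (n q) = (\<Sum>e\<in>E. if e = q then coef c q else 0)"
              unfolding dot_def using q finQ Q(3) by (intro sum.cong) (auto simp: coef_chain_of)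
            then show "dot E (chain_of Q (coef c)) (n q) = coef c q"
              using q Q(1) assms(1) by auto
          qed
        qed
        have "c + \<pi> x = 0"
        proof (rule Q(4))
          show "c + \<pi> x \<in> orthogonal E S" using c \<pi>_mem add_closedD[OF add_closed_orthogonal] by blast
          show "\<forall>q\<in>Q. coef (c + \<pi> x) q = 0" using x(2) by (simp add: lookup_add \<pi>_Q)
        qed
        then have "c + \<pi> x + \<pi> x = \<pi> x" by simp
        then have "c = \<pi> x" by (simp add: add.assoc)
        with x(1) show "c \<in> \<pi> ` chains E" by blast
      qed
    qed
  qed
qed

section \<open>Counting over the field with two elements\<close>

lemma card_chains_bit:
  assumes "finite S" shows "card (chains S :: ('a \<Rightarrow>\<^sub>0 bit) set) = 2 ^ card S"
    and "finite (chains S :: ('a \<Rightarrow>\<^sub>0 bit) set)"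
proof -
  have "bij_betw Poly_Mapping.keys (chains S :: ('a \<Rightarrow>\<^sub>0 bit) set) (Pow S)"
  proof (rule bij_betw_byWitness[of _ "\<lambda>T. chain_of T (\<lambda>_. 1)"])
    show "\<forall>c\<in>chains S. chain_of (Poly_Mapping.keys c) (\<lambda>_. 1) = (c :: 'a \<Rightarrow>\<^sub>0 bit)"
    proof (intro ballI poly_mapping_eqI)
      fix c :: "'a \<Rightarrow>\<^sub>0 bit" and e
      show "coef (chain_of (Poly_Mapping.keys c) (\<lambda>_. 1)) e = coef c e"
        by (cases "coef c e") (simp_all add: coef_chain_of in_keys_iff)
    qed
    show "\<forall>T\<in>Pow S. Poly_Mapping.keys (chain_of T (\<lambda>_. 1) :: 'a \<Rightarrow>\<^sub>0 bit) = T"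
      using assms by (auto simp: in_keys_iff coef_chain_of finite_subset split: if_splits)
    show "Poly_Mapping.keys ` (chains S :: ('a \<Rightarrow>\<^sub>0 bit) set) \<subseteq> Pow S"
      by (auto simp: chains_def)
    show "(\<lambda>T. chain_of T (\<lambda>_. 1 :: bit)) ` Pow S \<subseteq> chains S"
      using assms by (auto simp: mem_chains_iff coef_chain_of finite_subset subset_iff)
  qed
  then show "card (chains S :: ('a \<Rightarrow>\<^sub>0 bit) set) = 2 ^ card S"
    "finite (chains S :: ('a \<Rightarrow>\<^sub>0 bit) set)"
    using assms by (auto simp: bij_betw_same_card card_Pow dest: bij_betw_finite)
qed

text \<open>If \<open>h a = 1\<close>, translation by \<open>a\<close> permutes \<open>A\<close> and
  flips every sign, so the sum equals its negative.\<close>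

lemma character_sum:
  fixes A :: "('a \<Rightarrow>\<^sub>0 bit) set" and h :: "('a \<Rightarrow>\<^sub>0 bit) \<Rightarrow> bit"
  assumes "add_closed A" "\<And>x y. x \<in> A \<Longrightarrow> y \<in> A \<Longrightarrow> h (x + y) = h x + h y"
  shows "(\<Sum>x\<in>A. if h x = 0 then 1 else -1 :: int) = (if \<forall>x\<in>A. h x = 0 then int (card A) else 0)"
proof (cases "\<forall>x\<in>A. h x = 0")
  case False
  then obtain a where a: "a \<in> A" "h a = 1" by (metis bit_not_zero_iff)
  have "(\<Sum>x\<in>A. if h x = 0 then 1 else -1 :: int) = (\<Sum>x\<in>A. if h (x + a) = 0 then 1 else -1)"
    by (rule sum.reindex_bij_witness[of _ "\<lambda>x. x + a" "\<lambda>x. x + a"])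
      (use a add_closedD[OF assms(1)] in \<open>auto simp: add.assoc\<close>)
  also have "\<dots> = (\<Sum>x\<in>A. - (if h x = 0 then 1 else -1 :: int))"
    using a assms(2) by (intro sum.cong) (auto simp: bit_add_eq_0_iff bit_not_zero_iff)
  finally have "(\<Sum>x\<in>A. if h x = 0 then 1 else -1 :: int) = 0"
    by (simp add: sum_negf)
  with False show ?thesis by auto
qed simp

text \<open>Double counting of the signs, 1 or -1 according to \<open>\<beta> a b\<close>, over all
  pairs: by \<open>character_sum\<close> the inner sum over \<open>b\<close> vanishes unless
  \<open>a\<close> pairs to zero with all of \<open>B\<close>, and likewise with the roles
  exchanged.\<close>

lemma card_kernels_of_pairing:
  fixes A :: "('a \<Rightarrow>\<^sub>0 bit) set" and B :: "('b \<Rightarrow>\<^sub>0 bit) set"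
  assumes A: "finite A" "add_closed A" and B: "finite B" "add_closed B"
    and "\<And>x y z. x \<in> A \<Longrightarrow> y \<in> A \<Longrightarrow> z \<in> B \<Longrightarrow> \<beta> (x + y) z = \<beta> x z + (\<beta> y z :: bit)"
    and "\<And>x y z. x \<in> B \<Longrightarrow> y \<in> B \<Longrightarrow> z \<in> A \<Longrightarrow> \<beta> z (x + y) = \<beta> z x + \<beta> z y"
  shows "card {a \<in> A. \<forall>b\<in>B. \<beta> a b = 0} * card B = card {b \<in> B. \<forall>a\<in>A. \<beta> a b = 0} * card A"
proof -
  have "int (card {a \<in> A. \<forall>b\<in>B. \<beta> a b = 0} * card B) =
      (\<Sum>a\<in>A. if \<forall>b\<in>B. \<beta> a b = 0 then int (card B) else 0)"
    using A(1) by (simp add: sum.If_cases Int_def)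
  also have "\<dots> = (\<Sum>a\<in>A. \<Sum>b\<in>B. if \<beta> a b = 0 then 1 else -1)"
    using character_sum[OF B(2)] assms(6) by (intro sum.cong refl) simp
  also have "\<dots> = (\<Sum>b\<in>B. \<Sum>a\<in>A. if \<beta> a b = 0 then 1 else -1)"
    by (rule sum.swap)
  also have "\<dots> = (\<Sum>b\<in>B. if \<forall>a\<in>A. \<beta> a b = 0 then int (card A) else 0)"
    using character_sum[OF A(2), of "\<lambda>a. \<beta> a _"] assms(5) by (intro sum.cong refl) simp
  also have "\<dots> = int (card {b \<in> B. \<forall>a\<in>A. \<beta> a b = 0} * card A)"
    using B(1) by (simp add: sum.If_cases Int_def)
  finally show ?thesis by linarith
qed

text \<open>All nonempty fibres are translates of the kernel.\<close>

lemma card_additive_image: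
  fixes A :: "('a \<Rightarrow>\<^sub>0 bit) set" and h :: "('a \<Rightarrow>\<^sub>0 bit) \<Rightarrow> ('b \<Rightarrow>\<^sub>0 bit)"
  assumes "finite A" "add_closed A" "\<And>x y. x \<in> A \<Longrightarrow> y \<in> A \<Longrightarrow> h (x + y) = h x + h y"
  shows "card A = card {a \<in> A. h a = 0} * card (h ` A)"
proof -
  have fib: "card {a \<in> A. h a = b} = card {a \<in> A. h a = 0}" if "b \<in> h ` A" for b
  proof -
    from that obtain a where a: "a \<in> A" "h a = b" by blast
    have "bij_betw (\<lambda>x. x + a) {a \<in> A. h a = b} {a \<in> A. h a = 0}"
      by (rule bij_betw_byWitness[of _ "\<lambda>x. x + a"])
        (use a assms(3) add_closedD[OF assms(2)] in \<open>auto simp: add.assoc\<close>)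
    then show ?thesis by (rule bij_betw_same_card)
  qed
  have "card A = (\<Sum>b\<in>h ` A. card {a \<in> A. h a = b})"
    using sum.group[of A "h ` A" h "\<lambda>_. 1 :: nat"] assms(1) by simp
  also have "\<dots> = card {a \<in> A. h a = 0} * card (h ` A)" using fib by simp
  finally show ?thesis .
qed

section \<open>Reduction modulo 2\<close>

context fin_digraph
begin

lemma base_change_cycle:
  assumes "z \<in> cycle_space G" shows "base_change z \<in> cycle_space G"
  using assms int_cycle_test[of "arcs G" "coef z" "head G" "tail G"]
  by (auto simp: mem_cycle_space_iff base_change_mem)

lemma base_change_bond:
  assumes "b \<in> bond_space G" shows "base_change b \<in> bond_space G"
proof -
  obtain Y where "\<forall>e\<in>arcs G. coef b e = Y (head G e) - Y (tail G e)"
    using assms by (auto simp: mem_bond_space_iff)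
  then show ?thesis using assms
    by (auto simp: mem_bond_space_iff base_change_mem intro!: exI[of _ "\<lambda>v. of_int (Y v)"])
qed

text \<open>The values of a potential can be lifted independently of each other; the coefficients of
  a cycle cannot.\<close>

lemma lift_bond:
  fixes b :: "'b \<Rightarrow>\<^sub>0 bit"
  assumes "b \<in> bond_space G" obtains b' where "b' \<in> bond_space G" "base_change b' = b"
proof -
  obtain Y where b: "b \<in> chains (arcs G)" "\<forall>e\<in>arcs G. coef b e = Y (head G e) - Y (tail G e)"
    using assms by (auto simp: mem_bond_space_iff)
  have "\<forall>v. \<exists>n :: int. of_int n = Y v" by (metis of_int_bit_cases)
  then obtain Z :: "'a \<Rightarrow> int" where Z: "\<And>v. of_int (Z v) = Y v" by metis
  let ?b = "chain_of (arcs G) (\<lambda>e. Z (head G e) - Z (tail G e))"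
  show thesis
  proof (rule that[of ?b])
    show "?b \<in> bond_space G" by (auto simp: mem_bond_space_iff coef_chain_of)
    show "base_change ?b = b" using b Z
      by (intro chains_eqI[of _ "arcs G"]) (auto simp: base_change_mem coef_chain_of)
  qed
qed

text \<open>Both the reductions of integral cycles and the cycles modulo 2 have the bonds modulo 2 as
  orthogonal space.\<close>

lemma lift_cycle:
  fixes c :: "'b \<Rightarrow>\<^sub>0 bit"
  assumes "c \<in> cycle_space G" obtains z where "z \<in> cycle_space G" "base_change z = c"
proof -
  let ?S = "base_change ` cycle_space G :: ('b \<Rightarrow>\<^sub>0 bit) set"
  have "c \<in> ?S"
  proof (rule double_orthogonal[of "arcs G"])
    show "?S \<subseteq> chains (arcs G)" using cycle_space_subset base_change_mem by fast
    show "add_closed ?S" unfolding add_closed_def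
    proof (intro conjI ballI)
      show "0 \<in> ?S" by (rule image_eqI[of _ _ 0]) auto
      fix x y assume "x \<in> ?S" "y \<in> ?S"
      then show "x + y \<in> ?S"
        by (auto simp: base_change_add [symmetric] cycle_space_add)
    qed
    show "c \<in> chains (arcs G)" using assms cycle_space_subset by blast
    fix y assume "y \<in> orthogonal (arcs G) ?S"
    then have "y \<in> bond_space G"
      by (auto simp: orthogonal_def dot_def mem_bond_space_iff_orthogonal mult.commute)
    then show "dot (arcs G) c y = 0"
      using cycle_orthogonal_bond[OF assms] by (simp add: dot_def)
  qed simp
  then show thesis using that by blast
qed

end

section \<open>Simple paths on a vertical line\<close>

text \<open>By the intermediate value theorem, a height strictly between those at the parameters 0
  and 1/2 is attained on both halves of the loop, so some point is passed twice.\<close>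

lemma closed_simple_path_not_on_line:
  fixes g :: "real \<Rightarrow> real \<times> real"
  assumes g: "simple_path g" and line: "\<And>p. p \<in> path_image g \<Longrightarrow> fst p = a"
  shows "pathstart g \<noteq> pathfinish g"
proof
  assume closed: "pathstart g = pathfinish g"
  define h where "h t = snd (g t)" for t
  have gh: "g t = (a, h t)" if "t \<in> {0..1}" for t
    using line[of "g t"] that by (auto simp: path_image_def h_def prod_eq_iff)
  have cont: "continuous_on {0..1} h"
    using simple_path_imp_path[OF g] unfolding path_def h_def by (intro continuous_on_snd)
  have inj: "x = y \<or> x = 0 \<and> y = 1 \<or> x = 1 \<and> y = 0" if "x \<in> {0..1}" "y \<in> {0..1}" "h x = h y" for x y
    using g that gh[OF that(1)] gh[OF that(2)] unfolding simple_path_def loop_free_def by auto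
  have h01: "h 0 = h 1" using closed by (simp add: h_def pathstart_def pathfinish_def)
  have ne: "h 0 \<noteq> h (1/2)" using inj[of 0 "1/2"] by auto
  \<comment> \<open>This height is attained at none of 0, 1/2 and 1, so the two parameters found
    below are distinct and are not the pair of ends that a simple path may identify.\<close>
  define m where "m = (h 0 + h (1/2)) / 2"
  have c1: "continuous_on {0..1/2} h" and c2: "continuous_on {1/2..1} h"
    using continuous_on_subset[OF cont] by auto
  obtain s where s: "0 \<le> s" "s \<le> 1/2" "h s = m"
  proof (cases "h 0 \<le> h (1/2)")
    case True
    then show thesis using IVT'[of h 0 m "1/2"] c1 that by (auto simp: m_def)
  next
    case False
    then show thesis using IVT2'[of h "1/2" m 0] c1 that by (auto simp: m_def)
  qed
  obtain t where t: "1/2 \<le> t" "t \<le> 1" "h t = m"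
  proof (cases "h 0 \<le> h (1/2)")
    case True
    then show thesis using IVT2'[of h 1 m "1/2"] c2 that h01 by (auto simp: m_def)
  next
    case False
    then show thesis using IVT'[of h "1/2" m 1] c2 that h01 by (auto simp: m_def)
  qed
  have "m \<noteq> h 0" "m \<noteq> h (1/2)" using ne by (auto simp: m_def field_simps)
  then have "s \<noteq> 0" "s \<noteq> 1/2" using s(3) by blast+
  with inj[of s t] s t show False by auto
qed

text \<open>The path cannot be closed, so its height is continuous and injective and maps the
  parameter interval onto the segment between the end heights.\<close>

lemma path_image_simple_path_on_line:
  fixes g :: "real \<Rightarrow> real \<times> real"
  assumes g: "simple_path g" and line: "\<And>p. p \<in> path_image g \<Longrightarrow> fst p = a"
  shows "path_image g = {a} \<times> closed_segment (snd (pathstart g)) (snd (pathfinish g))"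
proof -
  have arc: "arc g"
    using simple_path_cases[OF g] closed_simple_path_not_on_line[OF g line] by metis
  define h where "h t = snd (g t)" for t
  have gh: "g t = (a, h t)" if "t \<in> {0..1}" for t
    using line[of "g t"] that by (auto simp: path_image_def h_def prod_eq_iff)
  have "h ` closed_segment 0 1 = closed_segment (h 0) (h 1)"
  proof (rule continuous_injective_image_segment_1)
    show "continuous_on (closed_segment 0 1) h"
      using simple_path_imp_path[OF g] unfolding path_def h_def closed_segment_eq_real_ivl
      by (auto intro: continuous_on_snd)
    show "inj_on h (closed_segment 0 1)"
    proof (rule inj_onI)
      fix x y assume *: "x \<in> closed_segment 0 1" "y \<in> closed_segment 0 1" "h x = h y"
      then have xy: "x \<in> {0..1}" "y \<in> {0..1}" by (simp_all add: closed_segment_eq_real_ivl)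
      then have "g x = g y" using gh *(3) by simp
      with arc xy show "x = y" unfolding arc_def by (auto dest: inj_onD)
    qed
  qed
  then have "h ` {0..1} = closed_segment (h 0) (h 1)" by (simp add: closed_segment_eq_real_ivl)
  moreover have "path_image g = {a} \<times> h ` {0..1}"
    unfolding path_image_def using gh by force
  ultimately show ?thesis by (simp add: h_def pathstart_def pathfinish_def)
qed

lemma reflect_reflect [simp]: "reflect a (reflect a p) = p"
  by (simp add: reflect_def)

section \<open>Reflective symmetry\<close>

locale reflective_graph =
  fixes G :: "('v, 'e) pre_digraph" and D :: "('v, 'e) drawing"
  assumes symm: "reflective_symmetry G D"
    and orient: "phi_preserves_orientation G D"
begin

sublocale fin_digraph G
  using symm by (simp add: reflective_symmetry_def)

abbreviation "\<phi>V \<equiv> phi_vert G D"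
abbreviation "\<phi>E \<equiv> phi_edge G D"
abbreviation "VF \<equiv> V_fix G D"
abbreviation "EF \<equiv> E_fix G D"
abbreviation "EL \<equiv> E_left G D"
abbreviation "ER \<equiv> E_right G D"
abbreviation "hG \<equiv> head G"
abbreviation "tG \<equiv> tail G"

lemma point_inj: "v \<in> verts G \<Longrightarrow> w \<in> verts G \<Longrightarrow> point D v = point D w \<Longrightarrow> v = w"
  using symm by (auto simp: reflective_symmetry_def nondegenerate_drawing_def dest: inj_onD)

lemma curve_inj: "e \<in> arcs G \<Longrightarrow> e' \<in> arcs G \<Longrightarrow>
    path_image (curve D e) = path_image (curve D e') \<Longrightarrow> e = e'"
  using symm unfolding reflective_symmetry_def nondegenerate_drawing_def by (auto dest: inj_onD)

lemma phi_vert: assumes "v \<in> verts G"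
  shows "\<phi>V v \<in> verts G" "point D (\<phi>V v) = reflect (axis D) (point D v)"
proof -
  obtain w where w: "w \<in> verts G" "point D w = reflect (axis D) (point D v)"
    using symm assms by (auto simp: reflective_symmetry_def reflection_invariant_def)
  then have "\<phi>V v = w"
    unfolding phi_vert_def by (intro the_equality) (auto intro: point_inj)
  with w show "\<phi>V v \<in> verts G" "point D (\<phi>V v) = reflect (axis D) (point D v)" by auto
qed

lemma phi_vert_eqI: "v \<in> verts G \<Longrightarrow> w \<in> verts G \<Longrightarrow>
    point D w = reflect (axis D) (point D v) \<Longrightarrow> \<phi>V v = w"
  using phi_vert[of v] by (auto intro: point_inj)

lemma phi_vert_involution [simp]: "v \<in> verts G \<Longrightarrow> \<phi>V (\<phi>V v) = v"
  by (intro phi_vert_eqI) (auto simp: phi_vert)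

lemma phi_edge: assumes "e \<in> arcs G"
  shows "\<phi>E e \<in> arcs G" "path_image (curve D (\<phi>E e)) = reflect (axis D) ` path_image (curve D e)"
proof -
  obtain e' where e': "e' \<in> arcs G" "path_image (curve D e') = reflect (axis D) ` path_image (curve D e)"
    using symm assms by (auto simp: reflective_symmetry_def reflection_invariant_def)
  then have "\<phi>E e = e'"
    unfolding phi_edge_def by (intro the_equality) (auto intro: curve_inj)
  with e' show "\<phi>E e \<in> arcs G"
    "path_image (curve D (\<phi>E e)) = reflect (axis D) ` path_image (curve D e)" by auto
qed

lemma phi_edge_involution [simp]: "e \<in> arcs G \<Longrightarrow> \<phi>E (\<phi>E e) = e"
  by (intro curve_inj) (auto simp: phi_edge image_image)

lemma tail_phi_edge [simp]: "e \<in> arcs G \<Longrightarrow> tG (\<phi>E e) = \<phi>V (tG e)"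
  and head_phi_edge [simp]: "e \<in> arcs G \<Longrightarrow> hG (\<phi>E e) = \<phi>V (hG e)"
  using orient by (auto simp: phi_preserves_orientation_def)

lemma EL_arcs: "e \<in> EL \<Longrightarrow> e \<in> arcs G" and ER_arcs: "e \<in> ER \<Longrightarrow> e \<in> arcs G"
  and EF_arcs: "e \<in> EF \<Longrightarrow> e \<in> arcs G"
  by (auto simp: E_left_def E_right_def E_fix_def)

lemma finite_edge_classes [simp]: "finite EL" "finite ER" "finite EF"
  using finite_arcs by (simp_all add: E_left_def E_right_def E_fix_def)

lemma phi_edge_fix: "e \<in> EF \<Longrightarrow> \<phi>E e = e"
  by (simp add: E_fix_def)

text \<open>This gives the disjointness of \<open>EL\<close> and \<open>ER\<close>: a curve on both
  sides of the axis lies on it, and reflection maps it to itself.\<close>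

lemma on_axis_imp_EF:
  assumes "e \<in> arcs G" "left_side D e" "right_side D e" shows "e \<in> EF"
proof -
  have "reflect (axis D) p = p" if "p \<in> path_image (curve D e)" for p
    using assms(2,3) that unfolding left_side_def right_side_def
    by (auto simp: reflect_def prod_eq_iff intro: antisym)
  then have "path_image (curve D (\<phi>E e)) = path_image (curve D e)"
    using phi_edge(2)[OF assms(1)] by simp
  with assms(1) show ?thesis by (auto simp: E_fix_def phi_edge intro: curve_inj)
qed

lemma arcs_partition: "arcs G = EL \<union> EF \<union> ER"
  using symm by (auto simp: reflective_symmetry_def E_left_def E_right_def E_fix_def)

lemma edge_classes_disjoint: "EL \<inter> EF = {}" "EL \<inter> ER = {}" "EF \<inter> ER = {}"
  using on_axis_imp_EF by (auto simp: E_left_def E_right_def E_fix_def)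

lemma phi_edge_EL: "e \<in> EL \<Longrightarrow> \<phi>E e \<in> ER"
  by (auto simp: E_left_def E_right_def phi_edge left_side_def right_side_def reflect_def)

lemma phi_edge_ER: "e \<in> ER \<Longrightarrow> \<phi>E e \<in> EL"
  by (auto simp: E_left_def E_right_def phi_edge left_side_def right_side_def reflect_def)

lemma phi_edge_EL_involution [simp]: "e \<in> EL \<Longrightarrow> \<phi>E (\<phi>E e) = e"
  and phi_edge_ER_involution [simp]: "e \<in> ER \<Longrightarrow> \<phi>E (\<phi>E e) = e"
  by (simp_all add: EL_arcs ER_arcs)

lemma sum_ER: "(\<Sum>e\<in>ER. g e) = (\<Sum>e\<in>EL. g (\<phi>E e))"
  by (rule sum.reindex_bij_witness[of _ \<phi>E \<phi>E]) (auto simp: phi_edge_EL phi_edge_ER)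

lemma sum_arcs: "(\<Sum>e\<in>arcs G. g e) = (\<Sum>e\<in>EL. g e + g (\<phi>E e)) + (\<Sum>e\<in>EF. g e)"
proof -
  have "(\<Sum>e\<in>arcs G. g e) = (\<Sum>e\<in>EL \<union> EF. g e) + (\<Sum>e\<in>ER. g e)"
    unfolding arcs_partition using edge_classes_disjoint
    by (intro sum.union_disjoint) auto
  also have "(\<Sum>e\<in>EL \<union> EF. g e) = (\<Sum>e\<in>EL. g e) + (\<Sum>e\<in>EF. g e)"
    using edge_classes_disjoint by (intro sum.union_disjoint) auto
  finally show ?thesis by (simp add: sum_ER sum.distrib add_ac)
qed

lemma curve_ends:
  assumes "e \<in> arcs G"
  shows "point D (tG e) \<in> path_image (curve D e)" "point D (hG e) \<in> path_image (curve D e)"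
proof -
  have "pathstart (curve D e) = point D (tG e)" "pathfinish (curve D e) = point D (hG e)"
    using symm assms unfolding reflective_symmetry_def nondegenerate_drawing_def by blast+
  then show "point D (tG e) \<in> path_image (curve D e)" "point D (hG e) \<in> path_image (curve D e)"
    using pathstart_in_path_image[of "curve D e"] pathfinish_in_path_image[of "curve D e"] by simp_all
qed

section \<open>Position of vertices and edges relative to the axis\<close>

lemma VF_iff: "v \<in> verts G \<Longrightarrow> v \<in> VF \<longleftrightarrow> fst (point D v) = axis D"
proof
  assume "v \<in> verts G" "v \<in> VF"
  then have "point D v = reflect (axis D) (point D v)"
    using phi_vert(2)[of v] by (simp add: V_fix_def)
  then show "fst (point D v) = axis D" unfolding reflect_def prod_eq_iff by simp
next
  assume "v \<in> verts G" "fst (point D v) = axis D"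
  then show "v \<in> VF"
    by (auto simp: V_fix_def reflect_def prod_eq_iff intro!: phi_vert_eqI)
qed

lemma VF_verts: "v \<in> VF \<Longrightarrow> v \<in> verts G" and phi_vert_fix [simp]: "v \<in> VF \<Longrightarrow> \<phi>V v = v"
  by (simp_all add: V_fix_def)

lemma finite_VF [simp]: "finite VF"
  by (rule finite_subset[OF _ finite_verts]) (auto simp: VF_verts)

definition left_vert :: "'v \<Rightarrow> bool" where "left_vert v \<longleftrightarrow> fst (point D v) < axis D"

definition right_vert :: "'v \<Rightarrow> bool" where "right_vert v \<longleftrightarrow> fst (point D v) > axis D"

lemma left_vert_phi [simp]: "v \<in> verts G \<Longrightarrow> left_vert (\<phi>V v) \<longleftrightarrow> right_vert v"
  and right_vert_phi [simp]: "v \<in> verts G \<Longrightarrow> right_vert (\<phi>V v) \<longleftrightarrow> left_vert v"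
  by (auto simp: left_vert_def right_vert_def phi_vert reflect_def)

lemma vert_cases:
  assumes "v \<in> verts G"
  obtains "left_vert v" "\<not> right_vert v" "v \<notin> VF"
  | "\<not> left_vert v" "right_vert v" "v \<notin> VF" | "\<not> left_vert v" "\<not> right_vert v" "v \<in> VF"
  using VF_iff[OF assms] unfolding left_vert_def right_vert_def
  by (cases "fst (point D v)" "axis D" rule: linorder_cases) auto

lemma VF_not_left [simp]: "v \<in> VF \<Longrightarrow> \<not> left_vert v" and VF_not_right [simp]: "v \<in> VF \<Longrightarrow> \<not> right_vert v"
  using VF_iff[of v] VF_verts by (auto simp: left_vert_def right_vert_def)

lemma EL_ends: "e \<in> EL \<Longrightarrow> \<not> right_vert (tG e) \<and> \<not> right_vert (hG e)"
  using curve_ends[of e] by (auto simp: E_left_def left_side_def right_vert_def not_less)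

lemma ER_ends: "e \<in> ER \<Longrightarrow> \<not> left_vert (tG e) \<and> \<not> left_vert (hG e)"
  using curve_ends[of e] by (auto simp: E_right_def right_side_def left_vert_def not_less)

lemma EF_ends: "e \<in> EF \<Longrightarrow> tG e \<in> VF" "e \<in> EF \<Longrightarrow> hG e \<in> VF"
proof -
  show "tG e \<in> VF" if "e \<in> EF"
    using tail_phi_edge[OF EF_arcs[OF that], symmetric] EF_arcs[OF that]
    unfolding phi_edge_fix[OF that] V_fix_def by (intro CollectI conjI tail_in_verts)
  show "hG e \<in> VF" if "e \<in> EF"
    using head_phi_edge[OF EF_arcs[OF that], symmetric] EF_arcs[OF that]
    unfolding phi_edge_fix[OF that] V_fix_def by (intro CollectI conjI head_in_verts)
qed

lemma EF_segment:
  assumes "e \<in> EF"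
  shows "path_image (curve D e) = {axis D} \<times> closed_segment (snd (point D (tG e))) (snd (point D (hG e)))"
    and "tG e \<noteq> hG e"
proof -
  have e: "e \<in> arcs G" using assms EF_arcs by blast
  have line: "fst p = axis D" if "p \<in> path_image (curve D e)" for p
  proof -
    have "reflect (axis D) p = p"
      using symm assms that unfolding reflective_symmetry_def E_fix_def by blast
    then show ?thesis by (auto simp: reflect_def prod_eq_iff)
  qed
  have simple: "simple_path (curve D e)"
    and ends: "pathstart (curve D e) = point D (tG e)" "pathfinish (curve D e) = point D (hG e)"
    using symm e unfolding reflective_symmetry_def nondegenerate_drawing_def by blast+
  show "path_image (curve D e) = {axis D} \<times> closed_segment (snd (point D (tG e))) (snd (point D (hG e)))"
    using path_image_simple_path_on_line[OF simple line] by (simp add: ends)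
  show "tG e \<noteq> hG e"
    using closed_simple_path_not_on_line[OF simple line] ends by auto
qed

lemma vertex_on_curve:
  assumes "e \<in> arcs G" "v \<in> verts G" "point D v \<in> path_image (curve D e)"
  shows "v = tG e \<or> v = hG e"
proof -
  obtain t where t: "t \<in> {0..1}" "curve D e t = point D v"
    using assms(3) by (auto simp: path_image_def)
  have "t \<notin> {0<..<1}"
    using symm assms(1,2) t(2) unfolding reflective_symmetry_def nondegenerate_drawing_def by blast
  with t(1) consider "t = 0" | "t = 1" by fastforce
  then have "point D v = point D (tG e) \<or> point D v = point D (hG e)"
    using symm assms(1) t(2) unfolding reflective_symmetry_def nondegenerate_drawing_def pathstart_def pathfinish_def
    by cases auto
  then show ?thesis using assms(1,2) point_inj tail_in_verts head_in_verts by blast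
qed

text \<open>The edges on the axis are segments without vertices in their interior, so they form a
  forest: at its topmost vertex, a set of such edges has only one edge.\<close>

lemma EF_forest:
  fixes c :: "'e \<Rightarrow> 'r::comm_ring_1"
  assumes bd: "\<And>v. v \<in> VF \<Longrightarrow> (\<Sum>e\<in>EF. c e * (of_bool (hG e = v) - of_bool (tG e = v))) = 0"
    and "e \<in> EF"
  shows "c e = 0"
proof (rule ccontr)
  assume "c e \<noteq> 0"
  define F where "F = {e \<in> EF. c e \<noteq> 0}"
  define W where "W = hG ` F \<union> tG ` F"
  define y where "y v = snd (point D v)" for v
  have "finite W" "W \<noteq> {}"
    using assms(2) \<open>c e \<noteq> 0\<close> by (auto simp: W_def F_def)
  then have "Max (y ` W) \<in> y ` W" by (intro Max_in) auto
  then obtain v where v: "v \<in> W" "y v = Max (y ` W)" by auto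
  have v_max: "y w \<le> y v" if "w \<in> W" for w
    using that \<open>finite W\<close> by (simp add: v(2))
  have W: "W \<subseteq> VF" using EF_ends by (auto simp: W_def F_def)
  have y_inj: "u = w" if "u \<in> VF" "w \<in> VF" "y u = y w" for u w
    using that VF_iff[of u] VF_iff[of w] VF_verts by (intro point_inj) (auto simp: y_def prod_eq_iff)
  \<comment> \<open>The end different from \<open>v\<close> of an edge at the topmost vertex
    \<open>v\<close>; the edge is the vertical segment from there up to \<open>v\<close>.\<close>
  define oth where "oth e = (if hG e = v then tG e else hG e)" for e
  have oth: "oth e \<in> W \<and> y (oth e) < y v \<and>
      path_image (curve D e) = {axis D} \<times> {y (oth e)..y v}"
    if "e \<in> F" "hG e = v \<or> tG e = v" for e
  proof -
    have "e \<in> EF" using that(1) by (simp add: F_def)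
    have "oth e \<in> W" using that by (auto simp: oth_def W_def)
    moreover have "oth e \<noteq> v" using EF_segment(2)[OF \<open>e \<in> EF\<close>] that(2) by (auto simp: oth_def)
    ultimately have "y (oth e) < y v" using v(1) v_max[of "oth e"] W y_inj[of "oth e" v] by (auto simp: order_le_less)
    moreover have "closed_segment (snd (point D (tG e))) (snd (point D (hG e))) = closed_segment (y (oth e)) (y v)"
      using that(2) by (auto simp: oth_def y_def closed_segment_commute)
    ultimately show ?thesis
      using EF_segment(1)[OF \<open>e \<in> EF\<close>] \<open>oth e \<in> W\<close> by (simp add: closed_segment_eq_real_ivl)
  qed
  \<comment> \<open>Both segments end at \<open>v\<close>, so the shorter one, \<open>e1\<close>, is
    contained in \<open>e2\<close>. Its lower end is then a vertex on \<open>e2\<close> and hence an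
    end of \<open>e2\<close>.\<close>
  have below: "oth e1 = oth e2"
    if e: "e1 \<in> F" "hG e1 = v \<or> tG e1 = v" "e2 \<in> F" "hG e2 = v \<or> tG e2 = v" "y (oth e2) \<le> y (oth e1)" for e1 e2
  proof -
    have "oth e1 \<in> VF" using oth[OF e(1,2)] W by blast
    then have "point D (oth e1) = (axis D, y (oth e1))"
      using VF_iff[of "oth e1"] VF_verts by (simp add: y_def prod_eq_iff)
    then have "point D (oth e1) \<in> path_image (curve D e2)"
      using oth[OF e(1,2)] oth[OF e(3,4)] e(5) by simp
    then have "oth e1 = tG e2 \<or> oth e1 = hG e2"
      using \<open>oth e1 \<in> VF\<close> VF_verts e(3) EF_arcs by (intro vertex_on_curve) (auto simp: F_def)
    then show ?thesis using oth[OF e(1,2)] e(4) by (auto simp: oth_def split: if_splits)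
  qed
  have unique: "e1 = e2"
    if e: "e1 \<in> F" "hG e1 = v \<or> tG e1 = v" "e2 \<in> F" "hG e2 = v \<or> tG e2 = v" for e1 e2
  proof -
    have "oth e1 = oth e2"
      using below[OF e] below[OF e(3,4,1,2)] by (cases "y (oth e2) \<le> y (oth e1)") auto
    then have "path_image (curve D e1) = path_image (curve D e2)"
      using oth[OF e(1,2)] oth[OF e(3,4)] by simp
    then show ?thesis using e EF_arcs by (intro curve_inj) (auto simp: F_def)
  qed
  obtain e0 where e0: "e0 \<in> F" "hG e0 = v \<or> tG e0 = v" using v(1) by (auto simp: W_def)
  \<comment> \<open>Only \<open>e0\<close> contributes to the boundary at \<open>v\<close>, and its
    contribution is plus or minus \<open>c e0\<close> because \<open>e0\<close> is not a
    loop.\<close>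
  have "(\<Sum>e\<in>EF. c e * (of_bool (hG e = v) - of_bool (tG e = v))) =
      (\<Sum>e\<in>EF. if e = e0 then c e0 * (of_bool (hG e0 = v) - of_bool (tG e0 = v)) else 0)"
  proof (rule sum.cong[OF refl])
    fix e assume "e \<in> EF"
    then show "c e * (of_bool (hG e = v) - of_bool (tG e = v)) =
        (if e = e0 then c e0 * (of_bool (hG e0 = v) - of_bool (tG e0 = v)) else 0)"
    proof (cases "e = e0")
      case False
      then have "c e = 0 \<or> hG e \<noteq> v \<and> tG e \<noteq> v"
        using unique[OF _ _ e0, of e] \<open>e \<in> EF\<close> unfolding F_def by blast
      with False show ?thesis by auto
    qed simp
  qed
  also have "\<dots> = c e0 * (of_bool (hG e0 = v) - of_bool (tG e0 = v))"
    using e0(1) by (simp add: F_def)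
  finally have "c e0 * (of_bool (hG e0 = v) - of_bool (tG e0 = v)) = 0"
    using bd[of v] v(1) W by auto
  moreover have "c e0 \<noteq> 0" "hG e0 \<noteq> tG e0"
    using e0(1) EF_segment(2)[of e0] by (auto simp: F_def)
  ultimately show False using e0(2) by auto
qed

end

lemma (in fin_digraph) mem_cycle_space_iff_orthogonal:
  "c \<in> cycle_space G \<longleftrightarrow> c \<in> chains (arcs G) \<and> (\<forall>b\<in>bond_space G. dot (arcs G) c b = 0)"
proof
  assume "c \<in> cycle_space G"
  then show "c \<in> chains (arcs G) \<and> (\<forall>b\<in>bond_space G. dot (arcs G) c b = 0)"
    using cycle_space_subset cycle_orthogonal_bond by (auto simp: dot_def)
next
  assume c: "c \<in> chains (arcs G) \<and> (\<forall>b\<in>bond_space G. dot (arcs G) c b = 0)"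
  have "(\<Sum>e\<in>arcs G. coef c e * (Y (head G e) - Y (tail G e))) = 0" for Y
  proof -
    have "chain_of (arcs G) (\<lambda>e. Y (head G e) - Y (tail G e)) \<in> bond_space G"
      by (auto simp: mem_bond_space_iff coef_chain_of)
    with c have "dot (arcs G) c (chain_of (arcs G) (\<lambda>e. Y (head G e) - Y (tail G e))) = 0" by blast
    then show ?thesis by (simp add: dot_def coef_chain_of)
  qed
  with c show "c \<in> cycle_space G" by (simp add: mem_cycle_space_iff)
qed

lemma coef_frag_extend:
  assumes "finite S" "x \<in> chains S"
  shows "coef (frag_extend b x) e = (\<Sum>i\<in>S. coef x i * coef (b i) e)"
proof -
  have "coef (frag_extend b x) e = (\<Sum>i\<in>Poly_Mapping.keys x. coef x i * coef (b i) e)"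
    by (simp add: frag_extend_def coef_sum)
  also have "\<dots> = (\<Sum>i\<in>S. coef x i * coef (b i) e)"
    using assms by (intro sum.mono_neutral_left) (auto simp: chains_def in_keys_iff)
  finally show ?thesis .
qed

lemma coef_sum_single:
  assumes "finite S" "x \<in> chains S"
  shows "coef (\<Sum>i\<in>Poly_Mapping.keys x. Poly_Mapping.single (g i) (coef x i)) e =
    (\<Sum>i\<in>S. if g i = e then coef x i else 0)"
proof -
  have "coef (\<Sum>i\<in>Poly_Mapping.keys x. Poly_Mapping.single (g i) (coef x i)) e =
      (\<Sum>i\<in>Poly_Mapping.keys x. if g i = e then coef x i else 0)"
    by (auto simp: coef_sum lookup_single when_def intro!: sum.cong)
  also have "\<dots> = (\<Sum>i\<in>S. if g i = e then coef x i else 0)"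
    using assms by (intro sum.mono_neutral_left) (auto simp: chains_def in_keys_iff)
  finally show ?thesis .
qed

section \<open>The graphs \<open>G_plus\<close> and \<open>G_minus\<close>, and the coefficients of
  \<open>f_map\<close>\<close>

context reflective_graph
begin

abbreviation "Gp \<equiv> G_plus G D"
abbreviation "Gm \<equiv> G_minus G D"
abbreviation "mv \<equiv> minus_vert G D"

lemma arcs_Gp: "arcs Gp = Whole ` EL \<union> First_half ` EF \<union> Second_half ` EF"
  and arcs_Gm [simp]: "arcs Gm = ER"
  and head_Gp [simp]: "head Gp = plus_head G" and tail_Gp [simp]: "tail Gp = plus_tail G"
  and head_Gm [simp]: "head Gm = (\<lambda>e. mv (hG e))" and tail_Gm [simp]: "tail Gm = (\<lambda>e. mv (tG e))"
  by (simp_all add: G_plus_def G_minus_def)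

sublocale plus: fin_digraph Gp
proof
  show "finite (arcs Gp)" by (simp add: arcs_Gp)
  show "finite (verts Gp)" by (simp add: G_plus_def endpoints_def)
  fix e assume "e \<in> arcs Gp"
  then show "tail Gp e \<in> verts Gp" "head Gp e \<in> verts Gp"
    by (auto simp: G_plus_def endpoints_def)
qed

sublocale minus: fin_digraph Gm
  by unfold_locales (auto simp: G_minus_def endpoints_def)

lemma sum_arcs_Gp:
  "(\<Sum>a\<in>arcs Gp. g a) = (\<Sum>e\<in>EL. g (Whole e)) + (\<Sum>e\<in>EF. g (First_half e) + g (Second_half e))"
proof -
  have "(\<Sum>a\<in>arcs Gp. g a) = (\<Sum>a\<in>Whole ` EL \<union> First_half ` EF. g a) + (\<Sum>a\<in>Second_half ` EF. g a)"
    unfolding arcs_Gp by (intro sum.union_disjoint) auto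
  also have "(\<Sum>a\<in>Whole ` EL \<union> First_half ` EF. g a) = (\<Sum>a\<in>Whole ` EL. g a) + (\<Sum>a\<in>First_half ` EF. g a)"
    by (intro sum.union_disjoint) auto
  finally show ?thesis by (simp add: sum.reindex inj_on_def sum.distrib add_ac)
qed

lemma arcs_Gp_cases:
  assumes "a \<in> arcs Gp"
  obtains e where "a = Whole e" "e \<in> EL" | e where "a = First_half e" "e \<in> EF"
    | e where "a = Second_half e" "e \<in> EF"
  using assms by (auto simp: arcs_Gp)

lemma arcs_cases:
  assumes "e \<in> arcs G"
  obtains "e \<in> EL" "e \<notin> EF" "e \<notin> ER" | "e \<in> EF" "e \<notin> EL" "e \<notin> ER" | "e \<in> ER" "e \<notin> EL" "e \<notin> EF"
  using assms arcs_partition edge_classes_disjoint by blast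

text \<open>Under reflection, \<open>x\<close> contributes a symmetric chain and \<open>y\<close> an
  antisymmetric one, with the minus sign on the left.\<close>

lemma coef_f_map:
  assumes x: "x \<in> chains (arcs Gp)" and y: "y \<in> chains ER"
  shows "e \<in> EL \<Longrightarrow> coef (f_map G D (x, y)) e = coef x (Whole e) - coef y (\<phi>E e)"
    and "e \<in> ER \<Longrightarrow> coef (f_map G D (x, y)) e = coef x (Whole (\<phi>E e)) + coef y e"
    and "e \<in> EF \<Longrightarrow> coef (f_map G D (x, y)) e = coef x (First_half e) + coef x (Second_half e)"
    and "e \<notin> arcs G \<Longrightarrow> coef (f_map G D (x, y)) e = 0"
proof -
  have eq: "coef (f_map G D (x, y)) e =
    (\<Sum>a\<in>EL. (if a = e then coef x (Whole a) else 0) + (if \<phi>E a = e then coef x (Whole a) else 0)) +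
    (\<Sum>a\<in>EF. if a = e then coef x (First_half a) + coef x (Second_half a) else 0) +
    (\<Sum>a\<in>ER. (if a = e then coef y a else 0) - (if \<phi>E a = e then coef y a else 0))"
  proof -
    have "coef (f_map G D (x, y)) e = (\<Sum>a\<in>arcs Gp. coef x a * coef (f_plus G D a) e) +
        (\<Sum>a\<in>ER. coef y a * coef (f_minus G D a) e)"
      unfolding f_map_def prod.case lookup_add coef_frag_extend[OF plus.finite_arcs x]
        coef_frag_extend[OF finite_edge_classes(2) y] ..
    moreover have "(\<Sum>a\<in>ER. coef y a * coef (f_minus G D a) e) =
        (\<Sum>a\<in>ER. (if a = e then coef y a else 0) - (if \<phi>E a = e then coef y a else 0))"
      by (intro sum.cong) (auto simp: f_minus_def lookup_minus lookup_frag_of)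
    moreover have "(\<Sum>a\<in>arcs Gp. coef x a * coef (f_plus G D a) e) =
        (\<Sum>a\<in>EL. (if a = e then coef x (Whole a) else 0) + (if \<phi>E a = e then coef x (Whole a) else 0)) +
        (\<Sum>a\<in>EF. if a = e then coef x (First_half a) + coef x (Second_half a) else 0)"
      unfolding sum_arcs_Gp
      by (intro arg_cong2[of _ _ _ _ "(+)"] sum.cong refl) (auto simp: lookup_add lookup_frag_of)
    ultimately show ?thesis by (simp only:)
  qed
  have ER_image: "(\<phi>E a = e) = (a = \<phi>E e)" if "a \<in> EL" "e \<in> ER" for a
    using that by auto
  have EL_image: "(\<phi>E a = e) = (a = \<phi>E e)" if "a \<in> ER" "e \<in> EL" for a
    using that by auto
  note zero = sum.neutral[OF ballI]
  show "coef (f_map G D (x, y)) e = coef x (Whole e) - coef y (\<phi>E e)" if e: "e \<in> EL"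
  proof -
    have "(\<Sum>a\<in>EL. (if a = e then coef x (Whole a) else 0) + (if \<phi>E a = e then coef x (Whole a) else 0)) =
        (\<Sum>a\<in>EL. if a = e then coef x (Whole a) else 0)"
      using phi_edge_EL edge_classes_disjoint e by (intro sum.cong) auto
    moreover have "(\<Sum>a\<in>EF. if a = e then coef x (First_half a) + coef x (Second_half a) else 0) = 0"
      using edge_classes_disjoint e by (intro zero) auto
    moreover have "(\<Sum>a\<in>ER. (if a = e then coef y a else 0) - (if \<phi>E a = e then coef y a else 0)) =
        (\<Sum>a\<in>ER. if a = \<phi>E e then - coef y a else 0)"
      using edge_classes_disjoint e EL_image by (intro sum.cong) auto
    ultimately show ?thesis unfolding eq using e by (simp add: phi_edge_EL)
  qed
  show "coef (f_map G D (x, y)) e = coef x (Whole (\<phi>E e)) + coef y e" if e: "e \<in> ER"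
  proof -
    have "(\<Sum>a\<in>EL. (if a = e then coef x (Whole a) else 0) + (if \<phi>E a = e then coef x (Whole a) else 0)) =
        (\<Sum>a\<in>EL. if a = \<phi>E e then coef x (Whole a) else 0)"
      using edge_classes_disjoint e ER_image by (intro sum.cong) auto
    moreover have "(\<Sum>a\<in>EF. if a = e then coef x (First_half a) + coef x (Second_half a) else 0) = 0"
      using edge_classes_disjoint e by (intro zero) auto
    moreover have "(\<Sum>a\<in>ER. (if a = e then coef y a else 0) - (if \<phi>E a = e then coef y a else 0)) =
        (\<Sum>a\<in>ER. if a = e then coef y a else 0)"
      using edge_classes_disjoint e phi_edge_ER by (intro sum.cong) auto
    ultimately show ?thesis unfolding eq using e by (simp add: phi_edge_ER)
  qed
  show "coef (f_map G D (x, y)) e = coef x (First_half e) + coef x (Second_half e)" if e: "e \<in> EF"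
  proof -
    have "(\<Sum>a\<in>EL. (if a = e then coef x (Whole a) else 0) + (if \<phi>E a = e then coef x (Whole a) else 0)) = 0"
      using edge_classes_disjoint e phi_edge_EL by (intro zero) auto
    moreover have "(\<Sum>a\<in>ER. (if a = e then coef y a else 0) - (if \<phi>E a = e then coef y a else 0)) = 0"
      using edge_classes_disjoint e phi_edge_ER by (intro zero) auto
    ultimately show ?thesis unfolding eq using e by simp
  qed
  show "coef (f_map G D (x, y)) e = 0" if e: "e \<notin> arcs G"
  proof -
    have "(\<Sum>a\<in>EL. (if a = e then coef x (Whole a) else 0) + (if \<phi>E a = e then coef x (Whole a) else 0)) = 0"
      using e phi_edge_EL arcs_partition by (intro zero) auto
    moreover have "(\<Sum>a\<in>ER. (if a = e then coef y a else 0) - (if \<phi>E a = e then coef y a else 0)) = 0"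
      using e phi_edge_ER arcs_partition by (intro zero) auto
    moreover have "(\<Sum>a\<in>EF. if a = e then coef x (First_half a) + coef x (Second_half a) else 0) = 0"
      using e arcs_partition by (intro zero) auto
    ultimately show ?thesis unfolding eq by simp
  qed
qed

lemma f_map_mem:
  assumes "x \<in> chains (arcs Gp)" "y \<in> chains ER"
  shows "f_map G D (x, y) \<in> chains (arcs G)"
  using coef_f_map(4)[OF assms] by (simp add: mem_chains_iff)

lemma f_map_add: "f_map G D (x + x', y + y') = f_map G D (x, y) + f_map G D (x', y')"
  by (simp add: f_map_def frag_extend_add)

lemma f_map_diff: "f_map G D (x - x', y - y') = f_map G D (x, y) - f_map G D (x', y')"
  by (simp add: f_map_def frag_extend_diff)

lemma f_map_0 [simp]: "f_map G D (0, 0) = 0"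
  by (simp add: f_map_def)

subsection \<open>The transpose of \<open>f\<close>\<close>

definition ft_plus :: "('e \<Rightarrow>\<^sub>0 int) \<Rightarrow> 'e plus_edge \<Rightarrow>\<^sub>0 int" where
  "ft_plus z = chain_of (arcs Gp) (\<lambda>a. case a of Whole e \<Rightarrow> coef z e + coef z (\<phi>E e)
     | First_half e \<Rightarrow> coef z e | Second_half e \<Rightarrow> coef z e)"

definition ft_minus :: "('e \<Rightarrow>\<^sub>0 int) \<Rightarrow> 'e \<Rightarrow>\<^sub>0 int" where
  "ft_minus z = chain_of ER (\<lambda>e. coef z e - coef z (\<phi>E e))"

lemma coef_ft_plus [simp]:
  "e \<in> EL \<Longrightarrow> coef (ft_plus z) (Whole e) = coef z e + coef z (\<phi>E e)"
  "e \<in> EF \<Longrightarrow> coef (ft_plus z) (First_half e) = coef z e"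
  "e \<in> EF \<Longrightarrow> coef (ft_plus z) (Second_half e) = coef z e"
  by (auto simp: ft_plus_def coef_chain_of arcs_Gp)

lemma coef_ft_minus [simp]: "e \<in> ER \<Longrightarrow> coef (ft_minus z) e = coef z e - coef z (\<phi>E e)"
  by (simp add: ft_minus_def coef_chain_of)

lemma ft_plus_mem [simp]: "ft_plus z \<in> chains (arcs Gp)"
  and ft_minus_mem [simp]: "ft_minus z \<in> chains ER"
  by (simp_all add: ft_plus_def ft_minus_def)

lemma f_map_adjoint:
  assumes x: "x \<in> chains (arcs Gp)" and y: "y \<in> chains ER"
  shows "dot (arcs G) (f_map G D (x, y)) z = dot (arcs Gp) x (ft_plus z) + dot ER y (ft_minus z)"
proof -
  have "dot (arcs G) (f_map G D (x, y)) z =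
      (\<Sum>e\<in>EL. (coef x (Whole e) - coef y (\<phi>E e)) * coef z e +
        (coef x (Whole e) + coef y (\<phi>E e)) * coef z (\<phi>E e)) +
      (\<Sum>e\<in>EF. (coef x (First_half e) + coef x (Second_half e)) * coef z e)"
    unfolding dot_def sum_arcs
    by (intro arg_cong2[of _ _ _ _ "(+)"] sum.cong refl) (simp_all add: coef_f_map[OF x y] phi_edge_EL)
  also have "\<dots> = dot (arcs Gp) x (ft_plus z) + dot ER y (ft_minus z)"
    unfolding dot_def sum_arcs_Gp sum_ER
    by (simp add: phi_edge_EL algebra_simps sum.distrib sum_subtractf)
  finally show ?thesis .
qed

lemma ft_plus_bond:
  assumes "b \<in> bond_space G" shows "ft_plus b \<in> bond_space Gp"
proof -
  obtain Y where Y: "\<forall>e\<in>arcs G. coef b e = Y (hG e) - Y (tG e)"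
    using assms by (auto simp: mem_bond_space_iff)
  \<comment> \<open>On the axis \<open>Y v + Y (\<phi>V v)\<close> is \<open>2 * Y v\<close>, so the
    midpoint must get the mean \<open>Y (hG e) + Y (tG e)\<close> for both halves to carry the
    coefficient of the edge.\<close>
  define Z where "Z v = (case v of Old v \<Rightarrow> Y v + Y (\<phi>V v) | Mid e \<Rightarrow> Y (hG e) + Y (tG e))" for v
  have "coef (ft_plus b) a = Z (plus_head G a) - Z (plus_tail G a)" if "a \<in> arcs Gp" for a
    using that
  proof (cases rule: arcs_Gp_cases)
    case (1 e)
    then have "coef b (\<phi>E e) = Y (\<phi>V (hG e)) - Y (\<phi>V (tG e))"
      using Y EL_arcs[of e] by (simp add: phi_edge)
    with 1 Y EL_arcs[of e] show ?thesis by (simp add: Z_def)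
  qed (use Y EF_arcs EF_ends in \<open>simp_all add: Z_def\<close>)
  then show ?thesis by (auto simp: plus.mem_bond_space_iff)
qed

lemma ft_minus_bond:
  assumes "b \<in> bond_space G" shows "ft_minus b \<in> bond_space Gm"
proof -
  obtain Y where Y: "\<forall>e\<in>arcs G. coef b e = Y (hG e) - Y (tG e)"
    using assms by (auto simp: mem_bond_space_iff)
  \<comment> \<open>The antisymmetrised potential vanishes on the axis, so 0 is the right value at
    the merged vertex.\<close>
  define Z where "Z v = (case v of None \<Rightarrow> 0 | Some v \<Rightarrow> Y v - Y (\<phi>V v))" for v
  have "coef (ft_minus b) e = Z (mv (hG e)) - Z (mv (tG e))" if "e \<in> ER" for e
  proof -
    have "coef b (\<phi>E e) = Y (\<phi>V (hG e)) - Y (\<phi>V (tG e))"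
      using that Y ER_arcs[of e] by (simp add: phi_edge)
    with that Y ER_arcs[of e] show ?thesis by (simp add: Z_def minus_vert_def)
  qed
  then show ?thesis by (auto simp: minus.mem_bond_space_iff)
qed

text \<open>The potential on \<open>G\<^sub>-\<close> is normalised at \<open>None\<close>, so that its antisymmetric extension
  to \<open>G\<close> vanishes on the axis.\<close>

lemma f_map_bond:
  assumes x: "x \<in> bond_space Gp" and y: "y \<in> bond_space Gm"
  shows "f_map G D (x, y) \<in> bond_space G"
proof -
  obtain Y where Y: "\<forall>a\<in>arcs Gp. coef x a = Y (plus_head G a) - Y (plus_tail G a)"
    using x by (auto simp: plus.mem_bond_space_iff)
  obtain Z where Z: "\<forall>e\<in>ER. coef y e = Z (mv (hG e)) - Z (mv (tG e))"
    using y by (auto simp: minus.mem_bond_space_iff)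
  define Q where "Q v = Z (mv v) - Z None" for v
  have Q0: "Q v = 0" if "v \<in> VF" for v using that by (simp add: Q_def minus_vert_def)
  \<comment> \<open>The symmetric extension of the potential of \<open>x\<close> plus the
    antisymmetric extension of the potential of \<open>y\<close>.\<close>
  define W where "W v = (if right_vert v then Y (Old (\<phi>V v)) + Q v
    else Y (Old v) - Q (\<phi>V v))" for v
  have xm: "x \<in> chains (arcs Gp)" and ym: "y \<in> chains ER"
    using x y plus.bond_space_subset minus.bond_space_subset by auto
  \<comment> \<open>On the axis \<open>Q\<close> vanishes and \<open>\<phi>V\<close> is the
    identity, so both branches of \<open>W\<close> agree there, and edges touching the axis need no
    separate treatment.\<close>
  have W_right: "W v = Y (Old (\<phi>V v)) + Q v" if "v \<in> verts G" "\<not> left_vert v" for v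
    using vert_cases[OF that(1)]
    by cases (use that in \<open>simp_all add: W_def Q0\<close>)
  have "coef (f_map G D (x, y)) e = W (hG e) - W (tG e)" if "e \<in> arcs G" for e
    using that
  proof (cases rule: arcs_cases)
    case 1
    then have "coef y (\<phi>E e) = Q (\<phi>V (hG e)) - Q (\<phi>V (tG e))"
      using Z that by (simp add: phi_edge_EL Q_def)
    moreover have "coef x (Whole e) = Y (Old (hG e)) - Y (Old (tG e))"
      using Y 1 by (simp add: arcs_Gp)
    ultimately show ?thesis
      using 1 EL_ends[of e] by (simp add: coef_f_map[OF xm ym] W_def)
  next
    case 2
    then have "coef x (First_half e) + coef x (Second_half e) = Y (Old (hG e)) - Y (Old (tG e))"
      using Y by (simp add: arcs_Gp)
    with 2 EF_ends[of e] show ?thesis by (simp add: coef_f_map[OF xm ym] W_def Q0)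
  next
    case 3
    then have "coef y e = Q (hG e) - Q (tG e)" using Z by (simp add: Q_def)
    moreover have "coef x (Whole (\<phi>E e)) = Y (Old (\<phi>V (hG e))) - Y (Old (\<phi>V (tG e)))"
      using Y 3 that by (simp add: arcs_Gp phi_edge_ER)
    ultimately show ?thesis
      using 3 ER_ends[of e] that by (simp add: coef_f_map[OF xm ym] W_right)
  qed
  with f_map_mem[OF xm ym] show ?thesis by (auto simp: mem_bond_space_iff)
qed

lemma ft_plus_cycle:
  assumes "z \<in> cycle_space G" shows "ft_plus z \<in> cycle_space Gp"
  unfolding plus.mem_cycle_space_iff_orthogonal
proof (intro conjI ballI)
  fix b :: "'e plus_edge \<Rightarrow>\<^sub>0 int" assume b: "b \<in> bond_space Gp"
  have "dot (arcs Gp) b (ft_plus z) = dot (arcs G) (f_map G D (b, 0)) z"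
    using f_map_adjoint[of b 0 z] b plus.bond_space_subset by auto
  also have "\<dots> = 0"
    using assms f_map_bond[OF b, of 0] by (auto simp: mem_cycle_space_iff_orthogonal dot_commute)
  finally show "dot (arcs Gp) (ft_plus z) b = 0" by (simp add: dot_commute)
qed simp

lemma ft_minus_cycle:
  assumes "z \<in> cycle_space G" shows "ft_minus z \<in> cycle_space Gm"
  unfolding minus.mem_cycle_space_iff_orthogonal
proof (intro conjI ballI)
  fix b :: "'e \<Rightarrow>\<^sub>0 int" assume b: "b \<in> bond_space Gm"
  have "dot ER b (ft_minus z) = dot (arcs G) (f_map G D (0, b)) z"
    using f_map_adjoint[of 0 b z] b minus.bond_space_subset by auto
  also have "\<dots> = 0"
    using assms f_map_bond[OF _ b, of 0] by (auto simp: mem_cycle_space_iff_orthogonal dot_commute)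
  finally show "dot (arcs Gm) (ft_minus z) b = 0" by (simp add: dot_commute)
qed simp

lemma f_map_cycle:
  assumes x: "x \<in> cycle_space Gp" and y: "y \<in> cycle_space Gm"
  shows "f_map G D (x, y) \<in> cycle_space G"
  unfolding mem_cycle_space_iff_orthogonal
proof (intro conjI ballI)
  have xm: "x \<in> chains (arcs Gp)" and ym: "y \<in> chains ER"
    using x y plus.cycle_space_subset minus.cycle_space_subset by auto
  show "f_map G D (x, y) \<in> chains (arcs G)" by (rule f_map_mem[OF xm ym])
  fix b :: "'e \<Rightarrow>\<^sub>0 int" assume "b \<in> bond_space G"
  then have "dot (arcs Gp) x (ft_plus b) = 0" "dot ER y (ft_minus b) = 0"
    using x y ft_plus_bond ft_minus_bond
    by (auto simp: plus.mem_cycle_space_iff_orthogonal minus.mem_cycle_space_iff_orthogonal)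
  then show "dot (arcs G) (f_map G D (x, y)) b = 0"
    by (simp add: f_map_adjoint[OF xm ym])
qed

lemma f_map_cycles_plus_bonds:
  assumes "x \<in> cycles_plus_bonds Gp" "y \<in> cycles_plus_bonds Gm"
  shows "f_map G D (x, y) \<in> cycles_plus_bonds G"
proof -
  obtain z b z' b' where "z \<in> cycle_space Gp" "b \<in> bond_space Gp" "x = z + b"
    "z' \<in> cycle_space Gm" "b' \<in> bond_space Gm" "y = z' + b'"
    using assms by (elim plus.cycles_plus_bondsE minus.cycles_plus_bondsE)
  then show ?thesis
    by (simp add: f_map_add cycles_plus_bondsI f_map_cycle f_map_bond)
qed

lemma ft_minus_f_map:
  assumes "x \<in> chains (arcs Gp)" "y \<in> chains ER"
  shows "ft_minus (f_map G D (x, y)) = y + y"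
  using assms
  by (intro chains_eqI[of _ ER]) (auto simp: coef_f_map phi_edge_ER lookup_add intro: chains_add)

lemma ft_plus_f_map:
  assumes "x \<in> chains (arcs Gp)" "y \<in> chains ER"
  shows "ft_plus (f_map G D (x, y)) - (x + x) \<in> bond_space Gp"
proof -
  \<comment> \<open>\<open>ft_plus\<close> of the image carries the sum of the two half coefficients
    on both halves. Subtracting \<open>x + x\<close> leaves their difference with opposite signs,
    which is the coboundary of this multiple of the midpoint.\<close>
  define Y where "Y v = (case v of Old _ \<Rightarrow> 0 |
    Mid e \<Rightarrow> coef x (Second_half e) - coef x (First_half e))" for v :: "('v, 'e) plus_vert"
  have "coef (ft_plus (f_map G D (x, y)) - (x + x)) a = Y (plus_head G a) - Y (plus_tail G a)"
    if "a \<in> arcs Gp" for a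
    using that by (cases rule: arcs_Gp_cases)
      (simp_all add: coef_f_map[OF assms] phi_edge_EL lookup_add lookup_minus Y_def)
  moreover have "ft_plus (f_map G D (x, y)) - (x + x) \<in> chains (arcs Gp)"
    using assms by (intro chains_diff chains_add) auto
  ultimately show ?thesis by (auto simp: plus.mem_bond_space_iff)
qed

subsection \<open>Fixed chains modulo 2\<close>

lemma phi_fixed_iff:
  assumes c: "c \<in> chains (arcs G)"
  shows "phi_act G D c = c \<longleftrightarrow> (\<forall>e\<in>EL. coef c (\<phi>E e) = coef c e)"
proof -
  have act: "coef (phi_act G D c) e = (if e \<in> arcs G then coef c (\<phi>E e) else 0)" for e
  proof -
    have "coef (phi_act G D c) e = (\<Sum>i\<in>arcs G. if \<phi>E i = e then coef c i else 0)"
      unfolding phi_act_def using c by (intro coef_sum_single) simp_all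
    also have "\<dots> = (\<Sum>i\<in>arcs G. if i = \<phi>E e \<and> e \<in> arcs G then coef c i else 0)"
      by (intro sum.cong) (auto simp: phi_edge)
    finally show ?thesis by (cases "e \<in> arcs G") (simp_all add: phi_edge)
  qed
  show ?thesis
  proof
    assume "phi_act G D c = c"
    then show "\<forall>e\<in>EL. coef c (\<phi>E e) = coef c e" using act EL_arcs by metis
  next
    assume *: "\<forall>e\<in>EL. coef c (\<phi>E e) = coef c e"
    have "coef c (\<phi>E e) = coef c e" if "e \<in> arcs G" for e
      using that by (cases rule: arcs_cases)
        (use * bspec[OF *, of "\<phi>E e"] in \<open>simp_all add: phi_edge_fix phi_edge_ER\<close>)
    then show "phi_act G D c = c"
      using c by (intro poly_mapping_eqI) (simp add: act mem_chains_iff)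
  qed
qed

text \<open>\<open>psi_act\<close> is defined on arbitrary chains, so besides matching coefficients
  the proof has to show that the supports are preserved (\<open>fst_out\<close>,
  \<open>snd_out\<close>).\<close>

lemma psi_fixed_iff:
  assumes x: "x \<in> chains (arcs Gp)" and y: "y \<in> chains ER"
  shows "psi_act G D (x, y) = (x, y) \<longleftrightarrow>
    (\<forall>e\<in>EL. coef x (Whole e) = coef y (\<phi>E e)) \<and>
    (\<forall>e\<in>EF. coef x (First_half e) = coef x (Second_half e))"
proof -
  have fst_psi: "coef (fst (psi_act G D (x, y))) a =
      (\<Sum>b\<in>arcs Gp. if (\<exists>e. b = First_half e \<and> a = Second_half e \<or> b = Second_half e \<and> a = First_half e)
         then coef x b else 0) + (\<Sum>e\<in>ER. if Whole (\<phi>E e) = a then coef y e else 0)" for a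
  proof -
    have "coef (\<Sum>b\<in>Poly_Mapping.keys x. fst (psi_plus G D b (coef x b))) a =
        (\<Sum>b\<in>Poly_Mapping.keys x. if (\<exists>e. b = First_half e \<and> a = Second_half e \<or> b = Second_half e \<and> a = First_half e)
         then coef x b else 0)"
      unfolding coef_sum
    proof (rule sum.cong[OF refl])
      fix b show "coef (fst (psi_plus G D b (coef x b))) a =
        (if (\<exists>e. b = First_half e \<and> a = Second_half e \<or> b = Second_half e \<and> a = First_half e)
         then coef x b else 0)"
        by (cases b) (auto simp: lookup_single when_def)
    qed
    also have "\<dots> = (\<Sum>b\<in>arcs Gp. if (\<exists>e. b = First_half e \<and> a = Second_half e \<or> b = Second_half e \<and> a = First_half e)
         then coef x b else 0)"
      using x by (intro sum.mono_neutral_left) (auto simp: chains_def in_keys_iff)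
    finally show ?thesis
      using coef_sum_single[OF _ y, of "\<lambda>e. Whole (\<phi>E e)" a]
      by (simp add: psi_act_def fst_sum lookup_add psi_minus_def)
  qed
  have snd_psi: "coef (snd (psi_act G D (x, y))) e' =
      (\<Sum>e\<in>EL. if \<phi>E e = e' then coef x (Whole e) else 0)" for e'
  proof -
    have "coef (snd (psi_act G D (x, y))) e' =
        (\<Sum>b\<in>Poly_Mapping.keys x. if (\<exists>e. b = Whole e \<and> \<phi>E e = e') then coef x b else 0)"
    proof -
      have "coef (snd (psi_plus G D b (coef x b))) e' =
          (if (\<exists>e. b = Whole e \<and> \<phi>E e = e') then coef x b else 0)" for b
        by (cases b) (auto simp: lookup_single when_def)
      then show ?thesis by (simp add: psi_act_def snd_sum lookup_add psi_minus_def coef_sum)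
    qed
    also have "\<dots> = (\<Sum>b\<in>arcs Gp. if (\<exists>e. b = Whole e \<and> \<phi>E e = e') then coef x b else 0)"
      using x by (intro sum.mono_neutral_left) (auto simp: chains_def in_keys_iff)
    finally show ?thesis unfolding sum_arcs_Gp by simp
  qed
  have W: "coef (fst (psi_act G D (x, y))) (Whole e) = coef y (\<phi>E e)" if "e \<in> EL" for e
  proof -
    have "(\<Sum>e'\<in>ER. if \<phi>E e' = e then coef y e' else 0) = (\<Sum>e'\<in>ER. if e' = \<phi>E e then coef y e' else 0)"
      using that by (intro sum.cong) auto
    then show ?thesis using that by (simp add: fst_psi phi_edge_EL)
  qed
  have R: "coef (snd (psi_act G D (x, y))) (\<phi>E e) = coef x (Whole e)" if "e \<in> EL" for e
  proof -
    have "(\<Sum>e'\<in>EL. if \<phi>E e' = \<phi>E e then coef x (Whole e') else 0) = (\<Sum>e'\<in>EL. if e' = e then coef x (Whole e') else 0)"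
      using that by (intro sum.cong) (auto, metis phi_edge_EL_involution)
    then show ?thesis using that by (simp add: snd_psi)
  qed
  have F: "coef (fst (psi_act G D (x, y))) (First_half e) = coef x (Second_half e)"
    and S: "coef (fst (psi_act G D (x, y))) (Second_half e) = coef x (First_half e)" if "e \<in> EF" for e
    using that unfolding fst_psi sum_arcs_Gp by simp_all
  have fst_out: "coef (fst (psi_act G D (x, y))) a = 0" if "a \<notin> arcs Gp" for a
  proof -
    have "(\<Sum>b\<in>arcs Gp. if (\<exists>e. b = First_half e \<and> a = Second_half e \<or> b = Second_half e \<and> a = First_half e)
         then coef x b else 0) = 0"
      using that by (intro sum.neutral) (auto simp: arcs_Gp)
    moreover have "(\<Sum>e\<in>ER. if Whole (\<phi>E e) = a then coef y e else 0) = 0"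
      using that phi_edge_ER by (intro sum.neutral) (auto simp: arcs_Gp)
    ultimately show ?thesis by (simp add: fst_psi)
  qed
  have snd_out: "coef (snd (psi_act G D (x, y))) e = 0" if "e \<notin> ER" for e
    unfolding snd_psi using that phi_edge_EL by (intro sum.neutral) auto
  show ?thesis
  proof
    assume "psi_act G D (x, y) = (x, y)"
    then show "(\<forall>e\<in>EL. coef x (Whole e) = coef y (\<phi>E e)) \<and>
      (\<forall>e\<in>EF. coef x (First_half e) = coef x (Second_half e))"
      using W F by simp
  next
    assume *: "(\<forall>e\<in>EL. coef x (Whole e) = coef y (\<phi>E e)) \<and>
      (\<forall>e\<in>EF. coef x (First_half e) = coef x (Second_half e))"
    have "fst (psi_act G D (x, y)) = x"
    proof (rule chains_eqI[OF _ x])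
      show "fst (psi_act G D (x, y)) \<in> chains (arcs Gp)" using fst_out by (simp add: mem_chains_iff)
      show "coef (fst (psi_act G D (x, y))) a = coef x a" if "a \<in> arcs Gp" for a
        using that by (cases rule: arcs_Gp_cases) (use * in \<open>simp_all add: W F S\<close>)
    qed
    moreover have "snd (psi_act G D (x, y)) = y"
    proof (rule chains_eqI[OF _ y])
      show "snd (psi_act G D (x, y)) \<in> chains ER" using snd_out by (simp add: mem_chains_iff)
      show "coef (snd (psi_act G D (x, y))) e = coef y e" if "e \<in> ER" for e
        using R[of "\<phi>E e"] * that by (simp add: phi_edge_ER)
    qed
    ultimately show "psi_act G D (x, y) = (x, y)" by (simp add: prod_eq_iff)
  qed
qed

end

section \<open>The elements of order two of the critical group\<close>

lemma chain_halves:
  assumes "c + c = d + (d :: 'a \<Rightarrow>\<^sub>0 int)" shows "c = d"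
proof (rule poly_mapping_eqI)
  fix e show "coef c e = coef d e" using arg_cong[OF assms, of "\<lambda>x. coef x e"] by (simp add: lookup_add)
qed

lemma base_change_double [simp]: "base_change (d + d) = (0 :: 'a \<Rightarrow>\<^sub>0 bit)"
  by (simp add: base_change_add)

lemma base_change_diff: "base_change (x - y) = base_change x - base_change y"
  by (rule poly_mapping_eqI) (simp add: lookup_minus)

lemma even_chain_halvable:
  assumes "finite S" "c \<in> chains S" "base_change c = (0 :: 'a \<Rightarrow>\<^sub>0 bit)"
  obtains d where "d \<in> chains S" "c = d + d"
proof
  let ?d = "chain_of S (\<lambda>e. coef c e div 2)"
  show "?d \<in> chains S" using assms(1) by simp
  have "even (coef c e)" for e
    using arg_cong[OF assms(3), of "\<lambda>x. coef x e"] by (simp add: of_int_bit_eq_0_iff)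
  then show "c = ?d + ?d"
    using assms(1,2) by (intro chains_eqI[of _ S] chains_add) (auto simp: lookup_add coef_chain_of)
qed

text \<open>If \<open>2x = z + b\<close> with a cycle \<open>z\<close> and a bond \<open>b\<close>, then \<open>z\<close> and \<open>b\<close> are unique, and their
  common reduction modulo 2 is a bicycle, which depends only on the class of \<open>x\<close>.\<close>

definition half_cycle :: "('v, 'e) pre_digraph \<Rightarrow> ('e \<Rightarrow>\<^sub>0 int) \<Rightarrow> ('e \<Rightarrow>\<^sub>0 int)" where
  "half_cycle H x = (THE z. z \<in> cycle_space H \<and> x + x - z \<in> bond_space H)"

context fin_digraph
begin

text \<open>Two candidates differ by a chain that is both a cycle and a bond, hence by 0.\<close>

lemma half_cycle_eqI:
  assumes "z \<in> cycle_space G" "x + x - z \<in> bond_space G" shows "half_cycle G x = z"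
  unfolding half_cycle_def
proof (rule the_equality)
  show "z \<in> cycle_space G \<and> x + x - z \<in> bond_space G" using assms by simp
  fix w assume w: "w \<in> cycle_space G \<and> x + x - w \<in> bond_space G"
  then have "(x + x - z) - (x + x - w) \<in> bond_space G"
    using assms bond_space_diff[of "x + x - z" "x + x - w"] by blast
  then have "w - z \<in> bond_space G" by simp
  moreover have "w - z \<in> cycle_space G" using w assms by (intro cycle_space_diff) auto
  ultimately show "w = z" using cycle_bond_Int[of "w - z"] by simp
qed

lemma half_cycle:
  assumes "x + x \<in> cycles_plus_bonds G"
  shows "half_cycle G x \<in> cycle_space G" "x + x - half_cycle G x \<in> bond_space G"
proof -
  obtain z b where "z \<in> cycle_space G" "b \<in> bond_space G" "x + x = z + b"
    using assms by (elim cycles_plus_bondsE)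
  then show "half_cycle G x \<in> cycle_space G" "x + x - half_cycle G x \<in> bond_space G"
    using half_cycle_eqI[of z x] by simp_all
qed

lemma half_cycle_add:
  assumes "x + x \<in> cycles_plus_bonds G" "y + y \<in> cycles_plus_bonds G"
  shows "half_cycle G (x + y) = half_cycle G x + half_cycle G y"
proof (rule half_cycle_eqI)
  show "half_cycle G x + half_cycle G y \<in> cycle_space G"
    using half_cycle assms by (intro cycle_space_add)
  have "(x + x - half_cycle G x) + (y + y - half_cycle G y) \<in> bond_space G"
    using half_cycle assms by (intro bond_space_add)
  then show "x + y + (x + y) - (half_cycle G x + half_cycle G y) \<in> bond_space G"
    by (simp add: algebra_simps)
qed

text \<open>Modulo 2 the left side of \<open>x + x = z + b\<close> vanishes, so \<open>z\<close> and
  \<open>b\<close> have the same reduction.\<close>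

lemma half_cycle_bicycle:
  assumes "x + x \<in> cycles_plus_bonds G"
  shows "base_change (half_cycle G x) \<in> bicycle_space G"
proof -
  let ?z = "half_cycle G x"
  have "base_change (x + x - ?z) \<in> (bond_space G :: ('b \<Rightarrow>\<^sub>0 bit) set)"
    using half_cycle(2)[OF assms] by (rule base_change_bond)
  then have "base_change ?z \<in> (bond_space G :: ('b \<Rightarrow>\<^sub>0 bit) set)"
    by (simp add: base_change_diff bit_chain_diff)
  then show ?thesis
    using base_change_cycle[OF half_cycle(1)[OF assms]] by (simp add: bicycle_space_def)
qed

text \<open>If the reductions agree, the two cycles differ by \<open>c + c\<close>, and halving the
  difference of the bonds shows that \<open>x - y - c\<close> is a bond. Conversely, changing
  \<open>x\<close> by a cycle \<open>c\<close> plus a bond changes the half cycle by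
  \<open>c + c\<close>. So the reduction is well defined and injective on classes.\<close>

lemma half_cycle_eq_iff:
  assumes x: "x + x \<in> cycles_plus_bonds G" "x \<in> chains (arcs G)"
    and y: "y + y \<in> cycles_plus_bonds G" "y \<in> chains (arcs G)"
  shows "base_change (half_cycle G x) = (base_change (half_cycle G y) :: 'b \<Rightarrow>\<^sub>0 bit) \<longleftrightarrow>
    x - y \<in> cycles_plus_bonds G"
proof
  let ?z = "half_cycle G x - half_cycle G y"
  assume "base_change (half_cycle G x) = (base_change (half_cycle G y) :: 'b \<Rightarrow>\<^sub>0 bit)"
  then have "base_change ?z = (0 :: 'b \<Rightarrow>\<^sub>0 bit)" by (simp add: base_change_diff)
  moreover have z: "?z \<in> cycle_space G" using half_cycle x y by (intro cycle_space_diff)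
  ultimately obtain c where c: "?z = c + c"
    using even_chain_halvable[OF finite_arcs, of ?z] cycle_space_subset by blast
  have "(x + x - half_cycle G x) - (y + y - half_cycle G y) \<in> bond_space G"
    by (rule bond_space_diff[OF half_cycle(2)[OF x(1)] half_cycle(2)[OF y(1)]])
  moreover have "(x + x - half_cycle G x) - (y + y - half_cycle G y) = (x - y - c) + (x - y - c)"
    using c by (simp add: algebra_simps)
  ultimately have "(x - y - c) + (x - y - c) \<in> bond_space G" by (simp only:)
  then have "x - y - c \<in> bond_space G" by (rule bond_space_half)
  moreover have "c \<in> cycle_space G" using z unfolding c by (rule cycle_space_half)
  ultimately show "x - y \<in> cycles_plus_bonds G" using cycles_plus_bondsI[of c "x - y - c"] by simp
next
  assume "x - y \<in> cycles_plus_bonds G"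
  then obtain c d where c: "c \<in> cycle_space G" "d \<in> bond_space G" "x - y = c + d"
    by (elim cycles_plus_bondsE)
  have "half_cycle G x = half_cycle G y + (c + c)"
  proof (rule half_cycle_eqI)
    show "half_cycle G y + (c + c) \<in> cycle_space G" using half_cycle y c by (intro cycle_space_add)
    have "(y + y - half_cycle G y) + (d + d) \<in> bond_space G" using half_cycle y c by (intro bond_space_add)
    moreover have "x = y + (c + d)" using c(3) by (simp add: algebra_simps)
    ultimately show "x + x - (half_cycle G y + (c + c)) \<in> bond_space G" by (simp add: algebra_simps)
  qed
  then show "base_change (half_cycle G x) = (base_change (half_cycle G y) :: 'b \<Rightarrow>\<^sub>0 bit)"
    by (simp add: base_change_add)
qed

end

section \<open>The homomorphism induced by \<open>f\<close>\<close>

context reflective_graph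
begin

abbreviation "Kp \<equiv> critical_group Gp"
abbreviation "Km \<equiv> critical_group Gm"
abbreviation "K \<equiv> critical_group G"

text \<open>Elements of the critical groups are cosets, so the value is described through any
  representatives; \<open>f_star_class\<close> shows that it does not depend on them.\<close>

definition f_star :: "('e plus_edge \<Rightarrow>\<^sub>0 int) set \<times> ('e \<Rightarrow>\<^sub>0 int) set \<Rightarrow> ('e \<Rightarrow>\<^sub>0 int) set" where
  "f_star A = (THE Z. \<exists>x\<in>chains (arcs Gp). \<exists>y\<in>chains ER.
     A = (critical_class Gp x, critical_class Gm y) \<and> Z = critical_class G (f_map G D (x, y)))"

lemma f_star_class:
  assumes "x \<in> chains (arcs Gp)" "y \<in> chains ER"
  shows "f_star (critical_class Gp x, critical_class Gm y) = critical_class G (f_map G D (x, y))"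
  unfolding f_star_def
proof (rule the_equality)
  fix Z assume "\<exists>x'\<in>chains (arcs Gp). \<exists>y'\<in>chains ER.
    (critical_class Gp x, critical_class Gm y) = (critical_class Gp x', critical_class Gm y') \<and>
    Z = critical_class G (f_map G D (x', y'))"
  then obtain x' y' where "critical_class Gp x = critical_class Gp x'"
    "critical_class Gm y = critical_class Gm y'" and Z: "Z = critical_class G (f_map G D (x', y'))"
    by blast
  then have "x' - x \<in> cycles_plus_bonds Gp" "y' - y \<in> cycles_plus_bonds Gm"
    by (metis plus.critical_class_eq_iff, metis minus.critical_class_eq_iff)
  then have "f_map G D (x', y') - f_map G D (x, y) \<in> cycles_plus_bonds G"
    using f_map_cycles_plus_bonds by (simp flip: f_map_diff)
  then show "Z = critical_class G (f_map G D (x, y))" by (simp add: Z critical_class_eq_iff)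
qed (use assms in blast)

lemma carrier_product:
  "carrier (Kp \<times>\<times> Km) = (\<lambda>(x, y). (critical_class Gp x, critical_class Gm y)) ` (chains (arcs Gp) \<times> chains ER)"
  by (auto simp: DirProd_def plus.carrier_critical_group minus.carrier_critical_group)

lemma product_mult:
  assumes "x \<in> chains (arcs Gp)" "y \<in> chains ER" "x' \<in> chains (arcs Gp)" "y' \<in> chains ER"
  shows "(critical_class Gp x, critical_class Gm y) \<otimes>\<^bsub>Kp \<times>\<times> Km\<^esub> (critical_class Gp x', critical_class Gm y') =
    (critical_class Gp (x + x'), critical_class Gm (y + y'))"
  using assms by (simp add: DirProd_def plus.critical_class_mult minus.critical_class_mult)

lemma f_star_hom: "f_star \<in> hom (Kp \<times>\<times> Km) K"
proof (rule homI)
  fix A assume "A \<in> carrier (Kp \<times>\<times> Km)"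
  then obtain x y where "x \<in> chains (arcs Gp)" "y \<in> chains ER"
    "A = (critical_class Gp x, critical_class Gm y)" unfolding carrier_product by auto
  then show "f_star A \<in> carrier K" by (simp add: f_star_class carrier_critical_group f_map_mem)
next
  fix A B assume "A \<in> carrier (Kp \<times>\<times> Km)" "B \<in> carrier (Kp \<times>\<times> Km)"
  then obtain x y x' y' where xy: "x \<in> chains (arcs Gp)" "y \<in> chains ER"
    "x' \<in> chains (arcs Gp)" "y' \<in> chains ER" and AB:
    "A = (critical_class Gp x, critical_class Gm y)" "B = (critical_class Gp x', critical_class Gm y')"
    unfolding carrier_product by auto
  show "f_star (A \<otimes>\<^bsub>Kp \<times>\<times> Km\<^esub> B) = f_star A \<otimes>\<^bsub>K\<^esub> f_star B"
    unfolding AB product_mult[OF xy]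
    using xy by (simp add: f_star_class chains_add f_map_add critical_class_mult f_map_mem)
qed

lemma group_hom_f_star: "group_hom (Kp \<times>\<times> Km) K f_star"
  by (intro group_hom.intro group_hom_axioms.intro DirProd_group f_star_hom
      plus.group_critical_group minus.group_critical_group group_critical_group)

lemma kernel_f_star:
  "kernel (Kp \<times>\<times> Km) K f_star = (\<lambda>(x, y). (critical_class Gp x, critical_class Gm y)) `
    {(x, y). x \<in> chains (arcs Gp) \<and> y \<in> chains ER \<and> f_map G D (x, y) \<in> cycles_plus_bonds G}"
proof -
  have "f_star (critical_class Gp x, critical_class Gm y) = \<one>\<^bsub>K\<^esub> \<longleftrightarrow> f_map G D (x, y) \<in> cycles_plus_bonds G"
    if "x \<in> chains (arcs Gp)" "y \<in> chains ER" for x y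
    unfolding critical_class_0 [symmetric] f_star_class[OF that] critical_class_eq_iff by simp
  then show ?thesis unfolding kernel_def carrier_product by auto
qed

lemma group_ker_group: "group (ker_group (Kp \<times>\<times> Km) K f_star)"
  unfolding ker_group_def
  using group_hom.subgroup_kernel[OF group_hom_f_star] group_hom_f_star
  by (auto intro: group.subgroup_imp_group simp: group_hom_def)

section \<open>The kernel of \<open>f_star\<close>\<close>

lemma ft_plus_add: "ft_plus (x + y) = ft_plus x + ft_plus y"
proof (rule chains_eqI)
  show "ft_plus (x + y) \<in> chains (arcs Gp)" by simp
  show "ft_plus x + ft_plus y \<in> chains (arcs Gp)" by (intro chains_add) simp_all
  fix a assume "a \<in> arcs Gp"
  then show "coef (ft_plus (x + y)) a = coef (ft_plus x + ft_plus y) a"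
    by (cases rule: arcs_Gp_cases) (simp_all add: lookup_add)
qed

lemma ft_minus_add: "ft_minus (x + y) = ft_minus x + ft_minus y"
  by (rule chains_eqI[of _ ER]) (auto simp: lookup_add intro: chains_add)

text \<open>The transpose is applied to \<open>f_map G D (x, y) = z + b\<close>, and the bond at the
  midpoints is absorbed into the bond part. Both half cycles come from the same \<open>z\<close>,
  which is what makes their reductions a \<psi>-fixed pair.\<close>

lemma kernel_half_cycle:
  assumes x: "x \<in> chains (arcs Gp)" and y: "y \<in> chains ER"
    and "f_map G D (x, y) \<in> cycles_plus_bonds G"
  obtains z where "z \<in> cycle_space G" "x + x \<in> cycles_plus_bonds Gp" "half_cycle Gp x = ft_plus z"
    "y + y \<in> cycles_plus_bonds Gm" "half_cycle Gm y = ft_minus z"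
proof -
  obtain z b where zb: "z \<in> cycle_space G" "b \<in> bond_space G" "f_map G D (x, y) = z + b"
    using assms(3) by (elim cycles_plus_bondsE)
  have "ft_plus b - (ft_plus (f_map G D (x, y)) - (x + x)) \<in> bond_space Gp"
    by (rule plus.bond_space_diff[OF ft_plus_bond[OF zb(2)] ft_plus_f_map[OF x y]])
  then have p: "x + x - ft_plus z \<in> bond_space Gp" by (simp add: zb(3) ft_plus_add algebra_simps)
  have "y + y = ft_minus z + ft_minus b"
    using ft_minus_f_map[OF x y] by (simp add: zb(3) ft_minus_add)
  then have m: "y + y - ft_minus z \<in> bond_space Gm" using ft_minus_bond[OF zb(2)] by simp
  show thesis
    using plus.cycles_plus_bondsI[OF ft_plus_cycle[OF zb(1)] p]
      minus.cycles_plus_bondsI[OF ft_minus_cycle[OF zb(1)] m] that[OF zb(1)] plus.half_cycle_eqI[OF ft_plus_cycle[OF zb(1)] p]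
      minus.half_cycle_eqI[OF ft_minus_cycle[OF zb(1)] m] by simp
qed

text \<open>By the matching conditions, each coefficient of the image is a sum or difference of two
  integers of equal parity.\<close>

lemma psi_fixed_imp_f_map_even:
  assumes x: "x \<in> chains (arcs Gp)" and y: "y \<in> chains ER"
    and "psi_act G D (base_change x, base_change y) = (base_change x, base_change y)"
  shows "base_change (f_map G D (x, y)) = (0 :: 'e \<Rightarrow>\<^sub>0 bit)"
proof (rule chains_eqI[of _ "arcs G"])
  note bx = base_change_mem[OF x] and by_ = base_change_mem[OF y]
  show "base_change (f_map G D (x, y)) \<in> chains (arcs G)" using f_map_mem[OF x y] by (rule base_change_mem)
  fix e assume "e \<in> arcs G"
  then show "coef (base_change (f_map G D (x, y))) e = coef (0 :: 'e \<Rightarrow>\<^sub>0 bit) e"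
  proof (cases rule: arcs_cases)
    case 1
    with assms(3) show ?thesis
      unfolding psi_fixed_iff[OF bx by_] by (simp add: coef_f_map[OF x y])
  next
    case 2
    with assms(3) show ?thesis
      unfolding psi_fixed_iff[OF bx by_] by (simp add: coef_f_map[OF x y])
  next
    case 3
    with assms(3) phi_edge_ER[of e] show ?thesis
      unfolding psi_fixed_iff[OF bx by_] by (simp add: coef_f_map[OF x y])
  qed
qed simp

lemma mem_psi_fixed_bicycles_iff:
  "(u, v) \<in> psi_fixed_bicycles G D \<longleftrightarrow>
    u \<in> bicycle_space Gp \<and> v \<in> bicycle_space Gm \<and> psi_act G D (u, v) = (u, v)"
  by (auto simp: psi_fixed_bicycles_def bicycle_space_def)

text \<open>If \<open>z\<close> and \<open>b\<close> lift the same bicycle, \<open>z + b\<close> is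
  even, and its half \<open>x\<close> has half cycle \<open>z\<close>. The images under
  \<open>f\<close> of the lifted cycles and of the lifted bonds are even as well, and their halves
  split \<open>f_map G D (x, y)\<close> into a cycle plus a bond.\<close>

lemma psi_fixed_bicycle_from_kernel:
  assumes "(u, v) \<in> psi_fixed_bicycles G D"
  obtains x y where "x \<in> chains (arcs Gp)" "y \<in> chains ER" "f_map G D (x, y) \<in> cycles_plus_bonds G"
    "base_change (half_cycle Gp x) = u" "base_change (half_cycle Gm y) = v"
proof -
  have psi: "psi_act G D (u, v) = (u, v)" and "u \<in> bicycle_space Gp" "v \<in> bicycle_space Gm"
    using assms by (auto simp: mem_psi_fixed_bicycles_iff)
  then obtain z b z' b' where zb: "z \<in> cycle_space Gp" "base_change z = u" "b \<in> bond_space Gp" "base_change b = u"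
    "z' \<in> cycle_space Gm" "base_change z' = v" "b' \<in> bond_space Gm" "base_change b' = v"
    unfolding bicycle_space_def
    by (metis IntE plus.lift_cycle plus.lift_bond minus.lift_cycle minus.lift_bond)
  have mem: "z \<in> chains (arcs Gp)" "b \<in> chains (arcs Gp)" "z' \<in> chains ER" "b' \<in> chains ER"
    using zb plus.cycle_space_subset plus.bond_space_subset minus.cycle_space_subset minus.bond_space_subset
    by auto
  obtain x where x: "x \<in> chains (arcs Gp)" "z + b = x + x"
    using even_chain_halvable[OF plus.finite_arcs chains_add[OF mem(1,2)]] zb by (auto simp: base_change_add)
  obtain y where y: "y \<in> chains ER" "z' + b' = y + y"
    using even_chain_halvable[OF finite_edge_classes(2) chains_add[OF mem(3,4)]] zb by (auto simp: base_change_add)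
  have "x + x - z = b" "y + y - z' = b'" using x(2) y(2) by (simp_all flip: x(2) y(2))
  then have half: "half_cycle Gp x = z" "half_cycle Gm y = z'"
    using zb by (auto intro!: plus.half_cycle_eqI minus.half_cycle_eqI)
  have "base_change (f_map G D (z, z')) = (0 :: 'e \<Rightarrow>\<^sub>0 bit)" "base_change (f_map G D (b, b')) = (0 :: 'e \<Rightarrow>\<^sub>0 bit)"
    using psi zb mem by (auto intro!: psi_fixed_imp_f_map_even)
  then obtain c d where cd: "f_map G D (z, z') = c + c" "f_map G D (b, b') = d + d"
    using even_chain_halvable[OF finite_arcs f_map_mem[OF mem(1,3)]]
      even_chain_halvable[OF finite_arcs f_map_mem[OF mem(2,4)]] by metis
  have "c \<in> cycle_space G" "d \<in> bond_space G"
    using f_map_cycle[OF zb(1,5)] f_map_bond[OF zb(3,7)] unfolding cd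
    by (auto intro: cycle_space_half bond_space_half)
  moreover have "f_map G D (x, y) + f_map G D (x, y) = (c + d) + (c + d)"
    using cd by (simp flip: f_map_add x(2) y(2)) (simp add: f_map_add algebra_simps)
  then have "f_map G D (x, y) = c + d" by (rule chain_halves)
  ultimately have "f_map G D (x, y) \<in> cycles_plus_bonds G" by (simp add: cycles_plus_bondsI)
  then show thesis using that[of x y] x(1) y(1) half zb by simp
qed

lemma add_closed_psi_fixed_bicycles: "add_closed (psi_fixed_bicycles G D)"
proof -
  have "(0, 0) \<in> psi_fixed_bicycles G D"
    by (simp add: mem_psi_fixed_bicycles_iff bicycle_space_def psi_fixed_iff)
  moreover have "(u + u', v + v') \<in> psi_fixed_bicycles G D"
    if "(u, v) \<in> psi_fixed_bicycles G D" "(u', v') \<in> psi_fixed_bicycles G D" for u v u' v'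
  proof -
    have c: "u \<in> chains (arcs Gp)" "u' \<in> chains (arcs Gp)" "v \<in> chains ER" "v' \<in> chains ER"
      using that plus.cycle_space_subset minus.cycle_space_subset
      by (auto simp: mem_psi_fixed_bicycles_iff bicycle_space_def)
    show ?thesis
      using that unfolding mem_psi_fixed_bicycles_iff psi_fixed_iff[OF c(1,3)] psi_fixed_iff[OF c(2,4)]
        psi_fixed_iff[OF chains_add[OF c(1,2)] chains_add[OF c(3,4)]]
      by (auto simp: bicycle_space_def lookup_add plus.cycle_space_add plus.bond_space_add
          minus.cycle_space_add minus.bond_space_add)
  qed
  ultimately show ?thesis by (auto simp: add_closed_def zero_prod_def)
qed

lemma group_psi_fixed_bicycles: "group (additive_group (psi_fixed_bicycles G D))"
  using add_closedD[OF add_closed_psi_fixed_bicycles]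
  by (intro group_additive_group) (auto simp: bit_chain_uminus)

lemma ker_f_star_iso:
  "ker_group (Kp \<times>\<times> Km) K f_star \<cong> additive_group (psi_fixed_bicycles G D)"
proof -
  define R where "R = {(x, y). x \<in> chains (arcs Gp) \<and> y \<in> chains ER \<and> f_map G D (x, y) \<in> cycles_plus_bonds G}"
  define p where "p = (\<lambda>(x, y). (critical_class Gp x, critical_class Gm y))"
  define q where "q = (\<lambda>(x, y). (base_change (half_cycle Gp x) :: 'e plus_edge \<Rightarrow>\<^sub>0 bit,
    base_change (half_cycle Gm y) :: 'e \<Rightarrow>\<^sub>0 bit))"
  have half: "x + x \<in> cycles_plus_bonds Gp" "y + y \<in> cycles_plus_bonds Gm" if "(x, y) \<in> R" for x y
    using that kernel_half_cycle[of x y] unfolding R_def by blast+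
  show ?thesis
  proof (rule iso_via_representatives[of _ _ p R q])
    show "p ` R = carrier (ker_group (Kp \<times>\<times> Km) K f_star)"
      unfolding ker_group_def R_def p_def using kernel_f_star by simp
    show "q ` R = carrier (additive_group (psi_fixed_bicycles G D))"
    proof
      show "q ` R \<subseteq> carrier (additive_group (psi_fixed_bicycles G D))"
      proof (clarsimp simp: additive_group_def)
        fix x y assume xy: "(x, y) \<in> R"
        then obtain z where z: "half_cycle Gp x = ft_plus z" "half_cycle Gm y = ft_minus z"
          using kernel_half_cycle[of x y] unfolding R_def by blast
        \<comment> \<open>On a left edge and on its mirror image the entries are a sum and a
          difference of the same two integers, which agree modulo 2.\<close>
        have "psi_act G D (base_change (ft_plus z), base_change (ft_minus z)) =
            (base_change (ft_plus z), base_change (ft_minus z))"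
          by (subst psi_fixed_iff) (auto simp: base_change_mem phi_edge_EL add.commute)
        then show "q (x, y) \<in> psi_fixed_bicycles G D"
          using plus.half_cycle_bicycle[OF half(1)[OF xy]] minus.half_cycle_bicycle[OF half(2)[OF xy]]
          unfolding q_def by (simp add: mem_psi_fixed_bicycles_iff z)
      qed
      show "carrier (additive_group (psi_fixed_bicycles G D)) \<subseteq> q ` R"
      proof (clarsimp simp: additive_group_def)
        fix u v assume "(u, v) \<in> psi_fixed_bicycles G D"
        then obtain x y where "(x, y) \<in> R" "q (x, y) = (u, v)"
          unfolding R_def q_def by (elim psi_fixed_bicycle_from_kernel) auto
        then show "(u, v) \<in> q ` R" by force
      qed
    qed
    fix r s assume "r \<in> R" "s \<in> R"
    moreover obtain x y x' y' where rs: "r = (x, y)" "s = (x', y')" by fastforce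
    ultimately have mem: "(x, y) \<in> R" "(x', y') \<in> R" by auto
    then have c: "x \<in> chains (arcs Gp)" "y \<in> chains ER" "x' \<in> chains (arcs Gp)" "y' \<in> chains ER"
      by (auto simp: R_def)
    show "p r = p s \<longleftrightarrow> q r = q s"
      unfolding rs p_def q_def
      using half[OF mem(1)] half[OF mem(2)] c
      by (simp add: plus.critical_class_eq_iff minus.critical_class_eq_iff
          plus.half_cycle_eq_iff minus.half_cycle_eq_iff)
    show "\<exists>z\<in>R. p z = p r \<otimes>\<^bsub>ker_group (Kp \<times>\<times> Km) K f_star\<^esub> p s \<and>
        q z = q r \<otimes>\<^bsub>additive_group (psi_fixed_bicycles G D)\<^esub> q s"
    proof (intro bexI conjI)
      show "p (x + x', y + y') = p r \<otimes>\<^bsub>ker_group (Kp \<times>\<times> Km) K f_star\<^esub> p s"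
        unfolding rs p_def ker_group_def using product_mult[OF c] by simp
      show "q (x + x', y + y') = q r \<otimes>\<^bsub>additive_group (psi_fixed_bicycles G D)\<^esub> q s"
        unfolding rs q_def additive_group_def
        using half[OF mem(1)] half[OF mem(2)]
        by (simp add: plus.half_cycle_add minus.half_cycle_add base_change_add)
      show "(x + x', y + y') \<in> R"
        using mem by (auto simp: R_def chains_add f_map_add cycles_plus_bonds_add)
    qed
  qed (rule group_ker_group group_psi_fixed_bicycles)+
qed

subsection \<open>The cokernel\<close>

text \<open>At an axis vertex a left edge and its mirror image contribute equally and cancel modulo
  2. The restriction to the axis is therefore a cycle in a forest.\<close>

lemma phi_fixed_cycle_vanishes_on_axis:
  fixes c :: "'e \<Rightarrow>\<^sub>0 bit"
  assumes c: "c \<in> cycle_space G" and fixed: "\<forall>e\<in>EL. coef c (\<phi>E e) = coef c e" and "e \<in> EF"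
  shows "coef c e = 0"
proof (rule EF_forest[OF _ assms(3)])
  fix v assume v: "v \<in> VF"
  define g where "g e = (of_bool (hG e = v) - of_bool (tG e = v) :: bit)" for e
  have "(\<phi>V w = v) = (w = v)" if "w \<in> verts G" for w
    using phi_vert_fix[OF v] phi_vert_involution[OF that] by metis
  then have "g (\<phi>E e) = g e" if "e \<in> EL" for e
    using EL_arcs[OF that] by (simp add: g_def)
  then have "(\<Sum>e\<in>EL. coef c e * g e + coef c (\<phi>E e) * g (\<phi>E e)) = 0"
    using fixed by (intro sum.neutral) simp
  moreover have "(\<Sum>e\<in>arcs G. coef c e * g e) = 0"
    using c unfolding mem_cycle_space_iff g_def by (elim conjE allE[of _ "\<lambda>w. of_bool (w = v)"])
  ultimately show "(\<Sum>e\<in>EF. coef c e * (of_bool (hG e = v) - of_bool (tG e = v))) = 0"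
    unfolding sum_arcs g_def by simp
qed

lemma mem_phi_fixed_bicycles_iff:
  "c \<in> phi_fixed_bicycles G D \<longleftrightarrow> c \<in> bicycle_space G \<and> (\<forall>e\<in>EL. coef c (\<phi>E e) = coef c e)"
  unfolding phi_fixed_bicycles_def bicycle_space_def
  using phi_fixed_iff[of c] cycle_space_subset by auto

text \<open>The lattice spanned by cycles, bonds and the image of \<open>f\<close>, reduced modulo
  2. By \<open>f_map_ft\<close> the lattice contains all doubled chains, so it is determined by its
  reduction.\<close>

definition image_mod_2 :: "('e \<Rightarrow>\<^sub>0 bit) set" where
  "image_mod_2 = {base_change (c + f_map G D (x, y)) | c x y.
     c \<in> cycles_plus_bonds G \<and> x \<in> chains (arcs Gp) \<and> y \<in> chains ER}"

lemma image_mod_2I: "c \<in> cycles_plus_bonds G \<Longrightarrow> x \<in> chains (arcs Gp) \<Longrightarrow> y \<in> chains ER \<Longrightarrow>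
    base_change (c + f_map G D (x, y)) \<in> image_mod_2"
  unfolding image_mod_2_def by blast

lemma image_mod_2_subset: "image_mod_2 \<subseteq> chains (arcs G)"
  unfolding image_mod_2_def using cycles_plus_bonds_subset
  by (auto intro!: base_change_mem chains_add f_map_mem)

lemma add_closed_image_mod_2: "add_closed image_mod_2"
  unfolding add_closed_def
proof (intro conjI ballI)
  show "0 \<in> image_mod_2" using image_mod_2I[of 0 0 0] by simp
  fix u v assume "u \<in> image_mod_2" "v \<in> image_mod_2"
  then obtain c x y c' x' y' where
    uv: "u = base_change (c + f_map G D (x, y))" "v = base_change (c' + f_map G D (x', y'))" and
    m: "c \<in> cycles_plus_bonds G" "x \<in> chains (arcs Gp)" "y \<in> chains ER"
      "c' \<in> cycles_plus_bonds G" "x' \<in> chains (arcs Gp)" "y' \<in> chains ER"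
    unfolding image_mod_2_def by blast
  have "u + v = base_change ((c + c') + f_map G D (x + x', y + y'))"
    by (simp add: uv f_map_add base_change_add [symmetric] add_ac)
  also have "\<dots> \<in> image_mod_2" using m by (intro image_mod_2I cycles_plus_bonds_add chains_add)
  finally show "u + v \<in> image_mod_2" .
qed

text \<open>Orthogonality to integral bonds and cycles gives a bicycle, and orthogonality to the
  images of the \<open>Whole e\<close> gives equality on mirror edges. The images of the half edges
  require vanishing on the axis, which \<open>phi_fixed_cycle_vanishes_on_axis\<close>
  supplies.\<close>

lemma orthogonal_image_mod_2: "orthogonal (arcs G) image_mod_2 = phi_fixed_bicycles G D"
proof
  show "orthogonal (arcs G) image_mod_2 \<subseteq> phi_fixed_bicycles G D"
  proof
    fix c assume "c \<in> orthogonal (arcs G) image_mod_2"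
    then have c: "c \<in> chains (arcs G)" "\<And>x. x \<in> image_mod_2 \<Longrightarrow> dot (arcs G) c x = 0"
      by (auto simp: orthogonal_def)
    have zb: "dot (arcs G) c (base_change x) = 0" if "x \<in> cycles_plus_bonds G" for x
      using c(2)[OF image_mod_2I[OF that, of 0 0]] by simp
    have im: "dot (arcs G) c (base_change (f_map G D (x, y))) = 0"
      if "x \<in> chains (arcs Gp)" "y \<in> chains ER" for x y
      using c(2)[OF image_mod_2I[of 0 x y]] that by simp
    have "c \<in> cycle_space G" unfolding mem_cycle_space_iff_orthogonal
    proof (intro conjI ballI c(1))
      fix b :: "'e \<Rightarrow>\<^sub>0 bit" assume "b \<in> bond_space G"
      then obtain b' where "b' \<in> bond_space G" "base_change b' = b" by (rule lift_bond)
      then show "dot (arcs G) c b = 0" using zb[OF bond_in_cycles_plus_bonds, of b'] by simp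
    qed
    moreover have "c \<in> bond_space G" unfolding mem_bond_space_iff_orthogonal
      using c(1) zb[OF cycle_in_cycles_plus_bonds] by (simp add: dot_def mult.commute)
    moreover have "coef c (\<phi>E e) = coef c e" if e: "e \<in> EL" for e
    proof -
      have "dot (arcs G) c (base_change (f_map G D (frag_of (Whole e), 0))) = 0"
        using e by (intro im) (auto simp: mem_chains_iff lookup_frag_of arcs_Gp)
      then have "coef c e + coef c (\<phi>E e) = 0"
        using e EL_arcs[OF e] phi_edge(1)[OF EL_arcs[OF e]]
        by (simp add: f_map_def base_change_add dot_add_right dot_base_change_frag_of)
      then show ?thesis by (simp add: bit_add_eq_0_iff)
    qed
    ultimately show "c \<in> phi_fixed_bicycles G D"
      by (simp add: mem_phi_fixed_bicycles_iff bicycle_space_def)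
  qed
  show "phi_fixed_bicycles G D \<subseteq> orthogonal (arcs G) image_mod_2"
  proof
    fix c assume "c \<in> phi_fixed_bicycles G D"
    then have c: "c \<in> cycle_space G" "c \<in> bond_space G" and fixed: "\<forall>e\<in>EL. coef c (\<phi>E e) = coef c e"
      by (auto simp: mem_phi_fixed_bicycles_iff bicycle_space_def)
    have "dot (arcs G) c (base_change (a + f_map G D (x, y))) = 0"
      if "a \<in> cycles_plus_bonds G" and x: "x \<in> chains (arcs Gp)" and y: "y \<in> chains ER" for a x y
    proof -
      from that(1) obtain z b where zb: "z \<in> cycle_space G" "b \<in> bond_space G" "a = z + b"
        by (elim cycles_plus_bondsE)
      have "dot (arcs G) c (base_change z) = 0"
        using cycle_orthogonal_bond[OF base_change_cycle[OF zb(1)] c(2)] by (simp add: dot_def mult.commute)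
      moreover have "dot (arcs G) c (base_change b) = 0"
        using cycle_orthogonal_bond[OF c(1) base_change_bond[OF zb(2)]] by (simp add: dot_def)
      moreover have "dot (arcs G) c (base_change (f_map G D (x, y))) = 0"
      proof -
        have "(\<Sum>e\<in>EL. coef c e * coef (base_change (f_map G D (x, y))) e +
            coef c (\<phi>E e) * coef (base_change (f_map G D (x, y))) (\<phi>E e)) = 0"
        proof (rule sum.neutral, rule ballI)
          fix e assume e: "e \<in> EL"
          then have "coef (base_change (f_map G D (x, y))) e =
              (coef (base_change (f_map G D (x, y))) (\<phi>E e) :: bit)"
            by (simp add: coef_f_map[OF x y] phi_edge_EL)
          with fixed e show "coef c e * coef (base_change (f_map G D (x, y))) e +
            coef c (\<phi>E e) * coef (base_change (f_map G D (x, y))) (\<phi>E e) = 0" by simp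
        qed
        then show ?thesis
          unfolding dot_def sum_arcs using phi_fixed_cycle_vanishes_on_axis[OF c(1) fixed] by simp
      qed
      ultimately show ?thesis by (simp add: zb(3) base_change_add dot_add_right)
    qed
    then show "c \<in> orthogonal (arcs G) image_mod_2"
      unfolding orthogonal_def image_mod_2_def using c(1) cycle_space_subset by blast
  qed
qed

lemma f_map_ft:
  assumes "d \<in> chains (arcs G)" shows "f_map G D (ft_plus d, ft_minus d) = d + d"
proof (rule chains_eqI)
  show "f_map G D (ft_plus d, ft_minus d) \<in> chains (arcs G)" by (rule f_map_mem) simp_all
  show "d + d \<in> chains (arcs G)" using assms by (intro chains_add)
  fix e assume "e \<in> arcs G"
  then show "coef (f_map G D (ft_plus d, ft_minus d)) e = coef (d + d) e"
    by (cases rule: arcs_cases)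
      (simp_all add: coef_f_map lookup_add phi_edge_EL phi_edge_ER)
qed

text \<open>If \<open>x\<close> agrees modulo 2 with an element of the lattice, the difference
  \<open>d + d\<close> is itself an image under \<open>f\<close> by \<open>f_map_ft\<close> and is
  absorbed into \<open>u\<close> and \<open>v\<close>.\<close>

lemma image_mod_2_iff:
  assumes "x \<in> chains (arcs G)"
  shows "base_change x \<in> image_mod_2 \<longleftrightarrow>
    (\<exists>u\<in>chains (arcs Gp). \<exists>v\<in>chains ER. x - f_map G D (u, v) \<in> cycles_plus_bonds G)"
proof
  assume "base_change x \<in> image_mod_2"
  then obtain c u v where m: "c \<in> cycles_plus_bonds G" "u \<in> chains (arcs Gp)" "v \<in> chains ER"
    "base_change x = (base_change (c + f_map G D (u, v)) :: 'e \<Rightarrow>\<^sub>0 bit)"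
    unfolding image_mod_2_def by blast
  have "x - (c + f_map G D (u, v)) \<in> chains (arcs G)"
    using assms m cycles_plus_bonds_subset by (intro chains_diff chains_add f_map_mem) auto
  moreover have "base_change (x - (c + f_map G D (u, v))) = (0 :: 'e \<Rightarrow>\<^sub>0 bit)"
    using m(4) by (simp add: base_change_diff)
  ultimately obtain d where d: "d \<in> chains (arcs G)" "x - (c + f_map G D (u, v)) = d + d"
    by (rule even_chain_halvable[OF finite_arcs])
  have "x - (c + f_map G D (u, v)) = f_map G D (ft_plus d, ft_minus d)"
    by (simp add: d f_map_ft)
  then have "x - f_map G D (u + ft_plus d, v + ft_minus d) = c"
    by (simp add: f_map_add algebra_simps)
  moreover have "u + ft_plus d \<in> chains (arcs Gp)" "v + ft_minus d \<in> chains ER"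
    using m by (auto intro: chains_add)
  ultimately show "\<exists>u\<in>chains (arcs Gp). \<exists>v\<in>chains ER. x - f_map G D (u, v) \<in> cycles_plus_bonds G"
    using m(1) by metis
next
  assume "\<exists>u\<in>chains (arcs Gp). \<exists>v\<in>chains ER. x - f_map G D (u, v) \<in> cycles_plus_bonds G"
  then obtain u v where "u \<in> chains (arcs Gp)" "v \<in> chains ER" "x - f_map G D (u, v) \<in> cycles_plus_bonds G"
    by blast
  from image_mod_2I[OF this(3,1,2)] show "base_change x \<in> image_mod_2" by simp
qed

lemma group_phi_fixed_bicycles: "group (additive_group (phi_fixed_bicycles G D))"
  unfolding orthogonal_image_mod_2 [symmetric]
  using add_closedD[OF add_closed_orthogonal]
  by (intro group_additive_group) (auto simp: bit_chain_uminus)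

lemma subgroup_f_star_image: "subgroup (f_star ` carrier (Kp \<times>\<times> Km)) K"
  by (rule group_hom.img_is_subgroup[OF group_hom_f_star])

lemma group_coker_group: "group (coker_group (Kp \<times>\<times> Km) K f_star)"
  unfolding coker_group_def
  using comm_group.subgroup_imp_normal[OF comm_group_critical_group subgroup_f_star_image]
  by (rule normal.factorgroup_is_group)

lemma coker_f_star_iso:
  "coker_group (Kp \<times>\<times> Km) K f_star \<cong> additive_group (phi_fixed_bicycles G D)"
proof -
  interpret K: comm_group K by (rule comm_group_critical_group)
  let ?I = "f_star ` carrier (Kp \<times>\<times> Km)"
  have normal: "?I \<lhd> K" using subgroup_f_star_image by (rule K.subgroup_imp_normal)
  obtain \<pi> where \<pi>: "\<pi> ` chains (arcs G) = phi_fixed_bicycles G D" "\<And>x y. \<pi> (x + y) = \<pi> x + \<pi> y"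
    "\<And>x. x \<in> chains (arcs G) \<Longrightarrow> \<pi> x = 0 \<longleftrightarrow> x \<in> image_mod_2"
    using quotient_map_onto_orthogonal[OF finite_arcs image_mod_2_subset add_closed_image_mod_2]
    unfolding orthogonal_image_mod_2 by blast
  define p where "p x = ?I #>\<^bsub>K\<^esub> critical_class G x" for x
  define q where "q x = \<pi> (base_change x)" for x
  have cl: "critical_class G x \<in> carrier K" if "x \<in> chains (arcs G)" for x
    using that by (simp add: carrier_critical_group)
  show ?thesis
  proof (rule iso_via_representatives[of _ _ p "chains (arcs G)" q])
    show "p ` chains (arcs G) = carrier (coker_group (Kp \<times>\<times> Km) K f_star)"
      unfolding coker_group_def carrier_FactGroup carrier_critical_group p_def [abs_def] image_image ..
    have "base_change ` chains (arcs G) = (chains (arcs G) :: ('e \<Rightarrow>\<^sub>0 bit) set)"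
      using base_change_bit_cases[OF finite_arcs] base_change_mem by (auto 4 3)
    then show "q ` chains (arcs G) = carrier (additive_group (phi_fixed_bicycles G D))"
      unfolding q_def [abs_def] \<pi>(1) [symmetric] additive_group_def by (simp flip: image_image)
    fix x y :: "'e \<Rightarrow>\<^sub>0 int" assume x: "x \<in> chains (arcs G)" and y: "y \<in> chains (arcs G)"
    \<comment> \<open>Equality of cosets of the image is translated into membership of
      \<open>x - y\<close>, reduced modulo 2, in \<open>image_mod_2\<close>, the kernel of
      \<open>\<pi>\<close>.\<close>
    have "p x = p y \<longleftrightarrow> critical_class G x \<in> ?I #>\<^bsub>K\<^esub> critical_class G y"
      unfolding p_def using K.repr_independence[OF _ cl[OF y] subgroup_f_star_image]
        K.rcos_self[OF cl[OF x] subgroup_f_star_image] by metis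
    also have "\<dots> \<longleftrightarrow> (\<exists>u\<in>chains (arcs Gp). \<exists>v\<in>chains ER.
        critical_class G x = critical_class G (f_map G D (u, v)) \<otimes>\<^bsub>K\<^esub> critical_class G y)"
      unfolding carrier_product r_coset_def by (auto simp: f_star_class)
    also have "\<dots> \<longleftrightarrow> (\<exists>u\<in>chains (arcs Gp). \<exists>v\<in>chains ER. x - y - f_map G D (u, v) \<in> cycles_plus_bonds G)"
      using y by (simp add: critical_class_mult f_map_mem critical_class_eq_iff algebra_simps)
    also have "\<dots> \<longleftrightarrow> base_change (x - y) \<in> image_mod_2"
      using image_mod_2_iff[OF chains_diff[OF x y]] ..
    also have "\<dots> \<longleftrightarrow> \<pi> (base_change x + base_change y) = 0"
      using \<pi>(3)[OF base_change_mem[OF chains_diff[OF x y]]] by (simp add: base_change_diff bit_chain_diff)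
    also have "\<dots> \<longleftrightarrow> q x = q y"
    proof -
      have "\<pi> (base_change x + base_change y) = q x - q y"
        by (simp add: \<pi>(2) q_def bit_chain_diff)
      then show ?thesis by simp
    qed
    finally show "p x = p y \<longleftrightarrow> q x = q y" .
    show "\<exists>z\<in>chains (arcs G). p z = p x \<otimes>\<^bsub>coker_group (Kp \<times>\<times> Km) K f_star\<^esub> p y \<and>
        q z = q x \<otimes>\<^bsub>additive_group (phi_fixed_bicycles G D)\<^esub> q y"
    proof (intro bexI conjI)
      show "p (x + y) = p x \<otimes>\<^bsub>coker_group (Kp \<times>\<times> Km) K f_star\<^esub> p y"
        unfolding p_def coker_group_def
        using normal.rcos_sum[OF normal cl[OF x] cl[OF y]] by (simp add: critical_class_mult[OF x y])
      show "q (x + y) = q x \<otimes>\<^bsub>additive_group (phi_fixed_bicycles G D)\<^esub> q y"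
        by (simp add: q_def base_change_add \<pi>(2) additive_group_def)
    qed (rule chains_add[OF x y])
  qed (rule group_coker_group group_phi_fixed_bicycles)+
qed

text \<open>Inherited from the bicycles, since chains over \<open>bit\<close> satisfy
  \<open>x + x = 0\<close>.\<close>

lemma two_torsion_ker: "two_torsion (ker_group (Kp \<times>\<times> Km) K f_star)"
  by (rule two_torsion_iso[OF group_ker_group group_psi_fixed_bicycles ker_f_star_iso])
    (rule two_torsion_additive_group, auto simp: zero_prod_def)

lemma two_torsion_coker: "two_torsion (coker_group (Kp \<times>\<times> Km) K f_star)"
  by (rule two_torsion_iso[OF group_coker_group group_phi_fixed_bicycles coker_f_star_iso])
    (rule two_torsion_additive_group, simp)

end

section \<open>Counting fixed bicycles\<close>

lemma connected_potential_constant: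
  assumes conn: "Digraph_Component.connected H"
    and Z: "\<And>a. a \<in> arcs H \<Longrightarrow> Z (head H a) = Z (tail H a)"
    and "u \<in> verts H" "v \<in> verts H"
  shows "Z u = Z v"
proof -
  have "(u, v) \<in> rtrancl_on (verts H) (parcs (mk_symmetric H))"
    using conn assms(3,4) unfolding connected_def strongly_connected_def reachable_def
    by (auto simp: arcs_ends_conv)
  then show ?thesis
    by (induction rule: rtrancl_on_induct) (auto simp: parcs_mk_symmetric Z)
qed

context reflective_graph
begin

text \<open>\<open>G_plus\<close> before the subdivision of the axis edges.\<close>

definition left_graph :: "('v, 'e) pre_digraph" where
  "left_graph = \<lparr>verts = endpoints G (EL \<union> EF), arcs = EL \<union> EF, tail = tail G, head = head G\<rparr>"

lemma left_graph_simps [simp]: "arcs left_graph = EL \<union> EF" "head left_graph = hG" "tail left_graph = tG"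
  "verts left_graph = endpoints G (EL \<union> EF)"
  by (simp_all add: left_graph_def)

sublocale left: fin_digraph left_graph
  by unfold_locales (auto simp: endpoints_def)

lemma sum_left: "(\<Sum>e\<in>EL \<union> EF. g e) = (\<Sum>e\<in>EL. g e) + (\<Sum>e\<in>EF. g e)"
  using edge_classes_disjoint by (intro sum.union_disjoint) auto

text \<open>Restricted to \<open>EL \<union> EF\<close>, the \<open>\<psi>\<close>-fixed bicycles are the elements of \<open>half_bonds\<close>
  orthogonal to \<open>bond_space left_graph\<close>, and the \<open>\<phi>\<close>-fixed bicycles are the elements of
  \<open>bond_space left_graph\<close> orthogonal to \<open>half_bonds\<close>.\<close>

definition half_bonds :: "('e \<Rightarrow>\<^sub>0 bit) set" where
  "half_bonds = {a \<in> chains (EL \<union> EF). \<exists>u. (\<forall>v\<in>VF. u v = 0) \<and> (\<forall>e\<in>EL. coef a e = u (hG e) - u (tG e))}"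

lemma add_closed_half_bonds: "add_closed half_bonds"
  unfolding add_closed_def
proof (intro conjI ballI)
  show "0 \<in> half_bonds" by (auto simp: half_bonds_def intro: exI[of _ "\<lambda>_. 0"])
  fix a b assume "a \<in> half_bonds" "b \<in> half_bonds"
  then obtain u w where ab: "a \<in> chains (EL \<union> EF)" "b \<in> chains (EL \<union> EF)"
    and u: "\<forall>v\<in>VF. u v = 0" "\<forall>e\<in>EL. coef a e = u (hG e) - u (tG e)"
    and w: "\<forall>v\<in>VF. w v = 0" "\<forall>e\<in>EL. coef b e = w (hG e) - w (tG e)"
    unfolding half_bonds_def by blast
  have "\<forall>e\<in>EL. coef (a + b) e = (u (hG e) + w (hG e)) - (u (tG e) + w (tG e))"
    using u w by (simp add: lookup_add add_ac)
  then show "a + b \<in> half_bonds"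
    using ab u w unfolding half_bonds_def
    by (intro CollectI conjI chains_add exI[of _ "\<lambda>v. u v + w v"]) auto
qed

text \<open>A potential on \<open>G_minus\<close> becomes one on the left half that vanishes on the
  axis. The bond condition leaves the axis edges free, because the midpoints absorb any value, and
  the cycle condition is not affected by subdivision.\<close>

lemma psi_fixed_correspondence:
  assumes u: "u \<in> chains (arcs Gp)" and v: "v \<in> chains ER" and a: "a \<in> chains (EL \<union> EF)"
    and uL: "\<And>e. e \<in> EL \<Longrightarrow> coef u (Whole e) = coef a e"
    and vL: "\<And>e. e \<in> EL \<Longrightarrow> coef v (\<phi>E e) = coef a e"
    and uF: "\<And>e. e \<in> EF \<Longrightarrow> coef u (First_half e) = coef a e"
    and uS: "\<And>e. e \<in> EF \<Longrightarrow> coef u (Second_half e) = coef a e"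
  shows "(u, v) \<in> psi_fixed_bicycles G D \<longleftrightarrow> a \<in> half_bonds \<and> a \<in> cycle_space left_graph"
proof
  assume "(u, v) \<in> psi_fixed_bicycles G D"
  then have uz: "u \<in> cycle_space Gp" and vb: "v \<in> bond_space Gm"
    by (auto simp: mem_psi_fixed_bicycles_iff bicycle_space_def)
  obtain Y where Y: "\<forall>e\<in>ER. coef v e = Y (mv (hG e)) - Y (mv (tG e))"
    using vb by (auto simp: minus.mem_bond_space_iff)
  \<comment> \<open>The potential of \<open>v\<close> reflected to the left and normalised at
    \<open>None\<close>, so that it is 0 on the axis.\<close>
  define w where "w x = Y (mv (\<phi>V x)) - Y None" for x
  have "w x = 0" if "x \<in> VF" for x using that by (simp add: w_def minus_vert_def)
  moreover have "coef a e = w (hG e) - w (tG e)" if "e \<in> EL" for e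
  proof -
    have "coef v (\<phi>E e) = Y (mv (\<phi>V (hG e))) - Y (mv (\<phi>V (tG e)))"
      using Y phi_edge_EL[OF that] EL_arcs[OF that] by simp
    then show ?thesis using vL[OF that] by (simp add: w_def add_ac)
  qed
  ultimately have "a \<in> half_bonds" using a unfolding half_bonds_def by blast
  moreover have "a \<in> cycle_space left_graph"
    unfolding left.mem_cycle_space_iff
  proof (intro conjI allI)
    show "a \<in> chains (arcs left_graph)" using a by simp
    fix Z :: "'v \<Rightarrow> bit"
    \<comment> \<open>With the tail's value at the midpoint, the first half contributes 0 and the
      second half the full difference along the edge.\<close>
    define Q where "Q x = (case x of Old v \<Rightarrow> Z v | Mid e \<Rightarrow> Z (tG e))" for x
    have "(\<Sum>e\<in>arcs Gp. coef u e * (Q (head Gp e) - Q (tail Gp e))) = 0"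
      using uz unfolding plus.mem_cycle_space_iff by blast
    then show "(\<Sum>e\<in>arcs left_graph. coef a e * (Z (head left_graph e) - Z (tail left_graph e))) = 0"
      unfolding sum_arcs_Gp by (simp add: sum_left Q_def uL uF uS)
  qed
  ultimately show "a \<in> half_bonds \<and> a \<in> cycle_space left_graph" by blast
next
  assume "a \<in> half_bonds \<and> a \<in> cycle_space left_graph"
  then obtain w where w0: "\<And>x. x \<in> VF \<Longrightarrow> w x = 0" and w: "\<And>e. e \<in> EL \<Longrightarrow> coef a e = w (hG e) - w (tG e)"
    and az: "a \<in> cycle_space left_graph" unfolding half_bonds_def by blast
  have az': "(\<Sum>e\<in>EL. coef a e * (Z (hG e) - Z (tG e))) + (\<Sum>e\<in>EF. coef a e * (Z (hG e) - Z (tG e))) = 0" for Z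
    using az unfolding left.mem_cycle_space_iff by (simp add: sum_left)
  have "u \<in> cycle_space Gp" unfolding plus.mem_cycle_space_iff
  proof (intro conjI allI u)
    fix Z :: "('v, 'e) plus_vert \<Rightarrow> bit"
    have "coef a e * (Z (Mid e) - Z (Old (tG e))) + coef a e * (Z (Old (hG e)) - Z (Mid e)) =
        coef a e * (Z (Old (hG e)) - Z (Old (tG e)))" for e
      by (simp add: algebra_simps del: bit_diff)
    then show "(\<Sum>e\<in>arcs Gp. coef u e * (Z (head Gp e) - Z (tail Gp e))) = 0"
      using az'[of "\<lambda>x. Z (Old x)"] by (simp add: sum_arcs_Gp uL uF uS del: bit_diff)
  qed
  moreover have "u \<in> bond_space Gp"
  proof -
    \<comment> \<open>Both ends of an axis edge have potential 0, so the value
      \<open>coef a e\<close> at the midpoint gives this coefficient to both halves; signs are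
      invisible modulo 2.\<close>
    define Q where "Q x = (case x of Old v \<Rightarrow> w v | Mid e \<Rightarrow> coef a e)" for x
    have "coef u e = Q (head Gp e) - Q (tail Gp e)" if "e \<in> arcs Gp" for e
      using that by (cases rule: arcs_Gp_cases) (simp_all add: Q_def uL uF uS w w0 EF_ends)
    then show ?thesis using u by (auto simp: plus.mem_bond_space_iff)
  qed
  moreover have "v \<in> cycle_space Gm" unfolding minus.mem_cycle_space_iff
  proof (intro conjI allI)
    show "v \<in> chains (arcs Gm)" using v by simp
    fix Z :: "'v option \<Rightarrow> bit"
    \<comment> \<open>Both ends of an axis edge become \<open>None\<close>, so the axis terms drop
      out of the cycle identity for the left half.\<close>
    have "(\<Sum>e\<in>EF. coef a e * (Z (mv (\<phi>V (hG e))) - Z (mv (\<phi>V (tG e))))) = 0"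
      by (intro sum.neutral) (simp add: EF_ends minus_vert_def)
    then show "(\<Sum>e\<in>arcs Gm. coef v e * (Z (head Gm e) - Z (tail Gm e))) = 0"
      using az'[of "\<lambda>x. Z (mv (\<phi>V x))"] by (simp add: sum_ER vL EL_arcs del: bit_diff)
  qed
  moreover have "v \<in> bond_space Gm"
  proof -
    define Q where "Q x = (case x of None \<Rightarrow> 0 | Some y \<Rightarrow> w (\<phi>V y))" for x
    have Q: "Q (mv x) = w (\<phi>V x)" for x by (simp add: Q_def minus_vert_def w0)
    have "coef v e = Q (mv (hG e)) - Q (mv (tG e))" if "e \<in> ER" for e
      using vL[OF phi_edge_ER[OF that]] w[OF phi_edge_ER[OF that]] that by (simp add: Q ER_arcs)
    then show ?thesis using v by (auto simp: minus.mem_bond_space_iff)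
  qed
  ultimately show "(u, v) \<in> psi_fixed_bicycles G D"
    unfolding mem_psi_fixed_bicycles_iff bicycle_space_def psi_fixed_iff[OF u v]
    by (simp add: uL vL uF uS)
qed

text \<open>The cycle condition on \<open>c\<close> tests \<open>a\<close> against symmetrised
  potentials, which vanish on the axis modulo 2. Orthogonality to the free axis values in
  \<open>half_bonds\<close> says that \<open>a\<close> is 0 on the axis, as
  \<open>phi_fixed_cycle_vanishes_on_axis\<close> demands.\<close>

lemma phi_fixed_correspondence:
  assumes c: "c \<in> chains (arcs G)" and a: "a \<in> chains (EL \<union> EF)"
    and ca: "\<And>e. e \<in> EL \<union> EF \<Longrightarrow> coef c e = coef a e"
    and cR: "\<And>e. e \<in> EL \<Longrightarrow> coef c (\<phi>E e) = coef a e"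
  shows "c \<in> phi_fixed_bicycles G D \<longleftrightarrow>
    a \<in> bond_space left_graph \<and> (\<forall>m\<in>half_bonds. dot (EL \<union> EF) m a = 0)"
proof
  assume "c \<in> phi_fixed_bicycles G D"
  then have cz: "c \<in> cycle_space G" and cb: "c \<in> bond_space G" and fixed: "\<forall>e\<in>EL. coef c (\<phi>E e) = coef c e"
    by (auto simp: mem_phi_fixed_bicycles_iff bicycle_space_def)
  obtain Y where Y: "\<forall>e\<in>arcs G. coef c e = Y (hG e) - Y (tG e)"
    using cb by (auto simp: mem_bond_space_iff)
  have "\<forall>e\<in>EL \<union> EF. coef a e = Y (hG e) - Y (tG e)"
    using Y ca arcs_partition by (metis UnI1)
  then have "a \<in> bond_space left_graph" using a by (auto simp: left.mem_bond_space_iff)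
  moreover have aF: "coef a e = 0" if "e \<in> EF" for e
    using phi_fixed_cycle_vanishes_on_axis[OF cz fixed that] ca that by simp
  moreover have "dot (EL \<union> EF) m a = 0" if "m \<in> half_bonds" for m
  proof -
    from that obtain u where u0: "\<And>x. x \<in> VF \<Longrightarrow> u x = 0"
      and u: "\<And>e. e \<in> EL \<Longrightarrow> coef m e = u (hG e) - u (tG e)" unfolding half_bonds_def by blast
    \<comment> \<open>The potential \<open>u\<close> cut off at the axis: it is 0 at the ends of
      right edges, so testing \<open>c\<close> against it leaves only the left half.\<close>
    define W where "W x = (if left_vert x then u x else 0)" for x
    have W: "W x = u x" "W (\<phi>V x) = 0" if "x \<in> verts G" "\<not> right_vert x" for x
      using vert_cases[OF that(1)] by (cases; use that in \<open>simp add: W_def u0\<close>)+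
    have "0 = (\<Sum>e\<in>arcs G. coef c e * (W (hG e) - W (tG e)))"
      using cz unfolding mem_cycle_space_iff by metis
    also have "\<dots> = (\<Sum>e\<in>EL. coef m e * coef a e)"
    proof -
      have "coef c e * (W (hG e) - W (tG e)) + coef c (\<phi>E e) * (W (hG (\<phi>E e)) - W (tG (\<phi>E e))) =
          coef m e * coef a e" if "e \<in> EL" for e
        using EL_ends[OF that] EL_arcs[OF that] that by (simp add: W u ca mult.commute)
      moreover have "(\<Sum>e\<in>EF. coef c e * (W (hG e) - W (tG e))) = 0"
        using aF ca by (intro sum.neutral) simp
      ultimately show ?thesis unfolding sum_arcs by simp
    qed
    finally show ?thesis unfolding dot_def sum_left using aF by simp
  qed
  ultimately show "a \<in> bond_space left_graph \<and> (\<forall>m\<in>half_bonds. dot (EL \<union> EF) m a = 0)" by blast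
next
  assume *: "a \<in> bond_space left_graph \<and> (\<forall>m\<in>half_bonds. dot (EL \<union> EF) m a = 0)"
  then obtain Y where Y: "\<And>e. e \<in> EL \<union> EF \<Longrightarrow> coef a e = Y (hG e) - Y (tG e)"
    unfolding left.mem_bond_space_iff by auto
  have aF: "coef a e = 0" if e: "e \<in> EF" for e
  proof -
    \<comment> \<open>Elements of \<open>half_bonds\<close> are arbitrary on the axis, so the single
      edge \<open>e\<close> is one of them.\<close>
    let ?m = "chain_of {e} (\<lambda>_. 1)"
    have "?m \<in> half_bonds"
      using e edge_classes_disjoint
      by (auto simp: half_bonds_def mem_chains_iff coef_chain_of intro!: exI[of _ "\<lambda>_. 0"])
    then have "dot (EL \<union> EF) ?m a = 0" using * by blast
    moreover have "dot (EL \<union> EF) ?m a = (\<Sum>x\<in>EL \<union> EF. if x = e then coef a x else 0)"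
      unfolding dot_def by (intro sum.cong) (auto simp: coef_chain_of)
    ultimately show ?thesis using e by simp
  qed
  have "c \<in> cycle_space G" unfolding mem_cycle_space_iff
  proof (intro conjI allI c)
    fix Z :: "'v \<Rightarrow> bit"
    define u where "u x = Z x + Z (\<phi>V x)" for x
    let ?m = "chain_of EL (\<lambda>e. u (hG e) - u (tG e))"
    have "?m \<in> half_bonds"
      by (auto simp: half_bonds_def mem_chains_iff coef_chain_of u_def intro!: exI[of _ u])
    then have "dot (EL \<union> EF) ?m a = 0" using * by blast
    moreover have "coef c e * (Z (hG e) - Z (tG e)) + coef c (\<phi>E e) * (Z (hG (\<phi>E e)) - Z (tG (\<phi>E e))) =
        coef ?m e * coef a e" if "e \<in> EL" for e
      using that EL_arcs[OF that] by (simp add: coef_chain_of ca cR u_def algebra_simps)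
    ultimately show "(\<Sum>e\<in>arcs G. coef c e * (Z (hG e) - Z (tG e))) = 0"
      unfolding dot_def sum_left sum_arcs by (simp add: aF ca)
  qed
  moreover have "c \<in> bond_space G"
  proof -
    define W where "W v = (if right_vert v then Y (\<phi>V v) else Y v)" for v
    have W_right: "W v = Y (\<phi>V v)" if "v \<in> verts G" "\<not> left_vert v" for v
      using vert_cases[OF that(1)] by cases (use that in \<open>simp_all add: W_def\<close>)
    have "coef c e = W (hG e) - W (tG e)" if "e \<in> arcs G" for e
      using that
    proof (cases rule: arcs_cases)
      case 3
      then have "coef c e = Y (\<phi>V (hG e)) - Y (\<phi>V (tG e))"
        using cR[OF phi_edge_ER[OF 3(1)]] Y[of "\<phi>E e"] phi_edge_ER[OF 3(1)] that by simp
      then show ?thesis using ER_ends[OF 3(1)] that by (simp add: W_right)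
    qed (use EL_ends[of e] EF_ends[of e] Y[of e] ca[of e] in \<open>simp_all add: W_def\<close>)
    then show ?thesis using c by (auto simp: mem_bond_space_iff)
  qed
  ultimately show "c \<in> phi_fixed_bicycles G D"
    by (simp add: mem_phi_fixed_bicycles_iff bicycle_space_def ca cR)
qed

lemma card_psi_fixed_bicycles:
  "card (psi_fixed_bicycles G D) = card {a \<in> half_bonds. \<forall>b\<in>bond_space left_graph. dot (EL \<union> EF) a b = 0}"
proof -
  define ext where "ext a = (chain_of (arcs Gp) (\<lambda>x. case x of Whole e \<Rightarrow> coef a e | First_half e \<Rightarrow> coef a e
    | Second_half e \<Rightarrow> coef a e), chain_of ER (\<lambda>e. coef a (\<phi>E e)))" for a :: "'e \<Rightarrow>\<^sub>0 bit"
  define res where "res = (\<lambda>(u :: 'e plus_edge \<Rightarrow>\<^sub>0 bit, v :: 'e \<Rightarrow>\<^sub>0 bit). chain_of (EL \<union> EF)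
    (\<lambda>e. if e \<in> EL then coef u (Whole e) else coef u (First_half e)))"
  have S: "{a \<in> half_bonds. \<forall>b\<in>bond_space left_graph. dot (EL \<union> EF) a b = 0} =
      {a \<in> half_bonds. a \<in> cycle_space left_graph}"
    unfolding left.mem_cycle_space_iff_orthogonal by (auto simp: half_bonds_def)
  have "bij_betw ext {a \<in> half_bonds. a \<in> cycle_space left_graph} (psi_fixed_bicycles G D)"
  proof (rule bij_betw_byWitness[of _ res])
    show "\<forall>a\<in>{a \<in> half_bonds. a \<in> cycle_space left_graph}. res (ext a) = a"
    proof
      fix a assume "a \<in> {a \<in> half_bonds. a \<in> cycle_space left_graph}"
      then have "a \<in> chains (EL \<union> EF)" by (simp add: half_bonds_def)
      then show "res (ext a) = a"
        by (intro chains_eqI[of _ "EL \<union> EF"])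
          (auto simp: res_def ext_def coef_chain_of arcs_Gp)
    qed
    have fixed: "u \<in> chains (arcs Gp)" "v \<in> chains ER" "\<And>e. e \<in> EL \<Longrightarrow> coef u (Whole e) = coef v (\<phi>E e)"
      "\<And>e. e \<in> EF \<Longrightarrow> coef u (First_half e) = coef u (Second_half e)"
      if "(u, v) \<in> psi_fixed_bicycles G D" for u v
    proof -
      show uv: "u \<in> chains (arcs Gp)" "v \<in> chains ER"
        using that plus.cycle_space_subset minus.cycle_space_subset
        by (auto simp: mem_psi_fixed_bicycles_iff bicycle_space_def)
      show "\<And>e. e \<in> EL \<Longrightarrow> coef u (Whole e) = coef v (\<phi>E e)"
        "\<And>e. e \<in> EF \<Longrightarrow> coef u (First_half e) = coef u (Second_half e)"
        using that psi_fixed_iff[OF uv] by (auto simp: mem_psi_fixed_bicycles_iff)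
    qed
    show "\<forall>w\<in>psi_fixed_bicycles G D. ext (res w) = w"
    proof
      fix w assume w: "w \<in> psi_fixed_bicycles G D"
      obtain u v where uv: "w = (u, v)" by fastforce
      note f = fixed[OF w[unfolded uv]]
      have "fst (ext (res w)) = u"
      proof (rule chains_eqI[OF _ f(1)])
        show "fst (ext (res w)) \<in> chains (arcs Gp)" by (simp add: ext_def)
        show "coef (fst (ext (res w))) x = coef u x" if "x \<in> arcs Gp" for x
          using that edge_classes_disjoint
          by (cases rule: arcs_Gp_cases) (auto simp: uv ext_def res_def coef_chain_of arcs_Gp f(4))
      qed
      moreover have "snd (ext (res w)) = v"
      proof (rule chains_eqI[OF _ f(2)])
        show "snd (ext (res w)) \<in> chains ER" by (simp add: ext_def)
        show "coef (snd (ext (res w))) e = coef v e" if "e \<in> ER" for e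
          using that phi_edge_ER[OF that] f(3)[OF phi_edge_ER[OF that]]
          by (simp add: uv ext_def res_def coef_chain_of)
      qed
      ultimately show "ext (res w) = w" by (simp add: uv prod_eq_iff)
    qed
    show "ext ` {a \<in> half_bonds. a \<in> cycle_space left_graph} \<subseteq> psi_fixed_bicycles G D"
    proof
      fix w assume "w \<in> ext ` {a \<in> half_bonds. a \<in> cycle_space left_graph}"
      then obtain a where a: "a \<in> half_bonds" "a \<in> cycle_space left_graph" "w = ext a" by blast
      have "(fst (ext a), snd (ext a)) \<in> psi_fixed_bicycles G D"
        using a by (subst psi_fixed_correspondence[of _ _ a])
          (auto simp: half_bonds_def ext_def coef_chain_of arcs_Gp phi_edge_EL)
      then show "w \<in> psi_fixed_bicycles G D" by (simp add: a(3))
    qed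
    show "res ` psi_fixed_bicycles G D \<subseteq> {a \<in> half_bonds. a \<in> cycle_space left_graph}"
    proof
      fix a assume "a \<in> res ` psi_fixed_bicycles G D"
      then obtain u v where uv: "(u, v) \<in> psi_fixed_bicycles G D" "a = res (u, v)" by auto
      note f = fixed[OF uv(1)]
      have "a \<in> half_bonds \<and> a \<in> cycle_space left_graph"
        using uv(1) edge_classes_disjoint
        by (subst psi_fixed_correspondence[OF f(1,2), symmetric])
          (auto simp: uv(2) res_def coef_chain_of f(3) f(4))
      then show "a \<in> {a \<in> half_bonds. a \<in> cycle_space left_graph}" by simp
    qed
  qed
  then show ?thesis unfolding S by (simp add: bij_betw_same_card)
qed

lemma card_phi_fixed_bicycles:
  "card (phi_fixed_bicycles G D) = card {b \<in> bond_space left_graph. \<forall>a\<in>half_bonds. dot (EL \<union> EF) a b = 0}"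
proof -
  let ?S = "{b \<in> bond_space left_graph. \<forall>a\<in>half_bonds. dot (EL \<union> EF) a b = 0}"
  define ext where "ext a = chain_of (arcs G) (\<lambda>e. if e \<in> ER then coef a (\<phi>E e) else coef a e)"
    for a :: "'e \<Rightarrow>\<^sub>0 bit"
  define res where "res c = chain_of (EL \<union> EF) (coef c)" for c :: "'e \<Rightarrow>\<^sub>0 bit"
  have S: "a \<in> chains (EL \<union> EF)" if "a \<in> ?S" for a
    using that left.bond_space_subset by auto
  have "bij_betw ext ?S (phi_fixed_bicycles G D)"
  proof (rule bij_betw_byWitness[of _ res])
    show "\<forall>a\<in>?S. res (ext a) = a"
    proof
      fix a assume "a \<in> ?S"
      then show "res (ext a) = a"
        using S[of a] edge_classes_disjoint arcs_partition
        by (intro chains_eqI[of _ "EL \<union> EF"]) (auto simp: res_def ext_def coef_chain_of)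
    qed
    show "\<forall>c\<in>phi_fixed_bicycles G D. ext (res c) = c"
    proof
      fix c assume "c \<in> phi_fixed_bicycles G D"
      then have c: "c \<in> chains (arcs G)" and fixed: "\<forall>e\<in>EL. coef c (\<phi>E e) = coef c e"
        using cycle_space_subset by (auto simp: mem_phi_fixed_bicycles_iff bicycle_space_def)
      show "ext (res c) = c"
      proof (rule chains_eqI[OF _ c])
        show "ext (res c) \<in> chains (arcs G)" by (simp add: ext_def)
        fix e assume e: "e \<in> arcs G"
        then show "coef (ext (res c)) e = coef c e"
        proof (cases rule: arcs_cases)
          case 3
          then show ?thesis
            using e phi_edge_ER[OF 3(1)] bspec[OF fixed phi_edge_ER[OF 3(1)]]
            by (simp add: ext_def res_def coef_chain_of)
        qed (use e in \<open>simp_all add: ext_def res_def coef_chain_of\<close>)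
      qed
    qed
    show "ext ` ?S \<subseteq> phi_fixed_bicycles G D"
    proof
      fix c assume "c \<in> ext ` ?S"
      then obtain a where a: "a \<in> ?S" "c = ext a" by blast
      have "coef (ext a) e = coef a e" if "e \<in> EL \<union> EF" for e
        using that edge_classes_disjoint arcs_partition by (auto simp: ext_def coef_chain_of)
      moreover have "coef (ext a) (\<phi>E e) = coef a e" if "e \<in> EL" for e
        using phi_edge_EL[OF that] that arcs_partition by (simp add: ext_def coef_chain_of)
      ultimately show "c \<in> phi_fixed_bicycles G D"
        using a(1) S[OF a(1)] unfolding a(2)
        by (subst phi_fixed_correspondence[of _ a]) (auto simp: ext_def)
    qed
    show "res ` phi_fixed_bicycles G D \<subseteq> ?S"
    proof
      fix a assume "a \<in> res ` phi_fixed_bicycles G D"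
      then obtain c where c: "c \<in> phi_fixed_bicycles G D" "a = res c" by blast
      then have mem: "c \<in> chains (arcs G)" and fixed: "\<forall>e\<in>EL. coef c (\<phi>E e) = coef c e"
        using cycle_space_subset by (auto simp: mem_phi_fixed_bicycles_iff bicycle_space_def)
      have "a \<in> bond_space left_graph \<and> (\<forall>m\<in>half_bonds. dot (EL \<union> EF) m a = 0)"
        using c(1) fixed
        by (subst phi_fixed_correspondence[OF mem, symmetric]) (auto simp: c(2) res_def coef_chain_of)
      then show "a \<in> ?S" by simp
    qed
  qed
  then show ?thesis by (simp add: bij_betw_same_card)
qed

section \<open>Cardinalities of the paired spaces when \<open>G_plus\<close> is connected\<close>

context
  assumes conn: "Digraph_Component.connected Gp"
    and VF_nonempty: "VF \<noteq> {}"
    and VF_endpoints: "VF \<subseteq> endpoints G (arcs G)"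
begin

abbreviation "V' \<equiv> endpoints G (EL \<union> EF)"

lemma finite_V': "finite V'"
  by (simp add: endpoints_def)

text \<open>A right edge at an axis vertex has a left mirror image at the same vertex. Isolated axis
  vertices, excluded by \<open>VF_endpoints\<close>, would count in \<open>card VF\<close> without
  lying in \<open>V'\<close>.\<close>

lemma VF_subset_V': "VF \<subseteq> V'"
proof
  fix v assume v: "v \<in> VF"
  then obtain e where e: "e \<in> arcs G" "v = tG e \<or> v = hG e"
    using VF_endpoints by (auto simp: endpoints_def)
  show "v \<in> V'" using e(1)
  proof (cases rule: arcs_cases)
    case 3
    have "v = tG (\<phi>E e) \<or> v = hG (\<phi>E e)" using e phi_vert_fix[OF v] by auto
    then show ?thesis using phi_edge_ER[OF 3(1)] by (auto simp: endpoints_def)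
  qed (use e in \<open>auto simp: endpoints_def\<close>)
qed

text \<open>Connectedness is assumed for the subdivided graph; giving each midpoint the value at the
  tail extends the function so that it is constant along both halves.\<close>

lemma potential_constant:
  assumes "\<And>e. e \<in> EL \<union> EF \<Longrightarrow> Y (hG e) = Y (tG e)" "u \<in> V'" "v \<in> V'"
  shows "Y u = Y v"
proof -
  define Z where "Z x = (case x of Old v \<Rightarrow> Y v | Mid e \<Rightarrow> Y (tG e))" for x
  have "Z (Old u) = Z (Old v)"
  proof (rule connected_potential_constant[OF conn])
    fix a assume "a \<in> arcs Gp"
    then show "Z (head Gp a) = Z (tail Gp a)"
      by (cases rule: arcs_Gp_cases) (simp_all add: Z_def assms(1))
  qed (use assms in \<open>auto simp: G_plus_def\<close>)
  then show ?thesis by (simp add: Z_def)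
qed

text \<open>Since the left half is connected, the kernel of its coboundary consists of the two
  constant potentials. The factor 2 avoids a subtraction in the exponent.\<close>

lemma card_bond_space_left: "2 * card (bond_space left_graph :: ('e \<Rightarrow>\<^sub>0 bit) set) = 2 ^ card V'"
proof -
  let ?A = "chains V' :: ('v \<Rightarrow>\<^sub>0 bit) set"
  let ?h = "coboundary left_graph :: ('v \<Rightarrow>\<^sub>0 bit) \<Rightarrow> ('e \<Rightarrow>\<^sub>0 bit)"
  have coef_h: "coef (?h y) e = (if e \<in> EL \<union> EF then coef y (hG e) - coef y (tG e) else 0)" for y e
    using coef_coboundary[of left_graph y e] by simp
  have "card ?A = card {y \<in> ?A. ?h y = 0} * card (?h ` ?A)"
  proof (rule card_additive_image)
    show "?h (x + y) = ?h x + ?h y" for x y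
      by (rule poly_mapping_eqI) (simp add: coef_h lookup_add add_ac)
  qed (simp_all add: card_chains_bit finite_V' add_closed_chains)
  moreover have "?h ` ?A = bond_space left_graph" by (simp add: bond_space_def)
  moreover have "{y \<in> ?A. ?h y = 0} = {0, chain_of V' (\<lambda>_. 1)}"
  proof (intro equalityI subsetI)
    fix y assume y: "y \<in> {y \<in> ?A. ?h y = 0}"
    obtain v where v: "v \<in> V'" using VF_nonempty VF_subset_V' by blast
    have eq: "coef y (hG e) = coef y (tG e)" if "e \<in> EL \<union> EF" for e
    proof -
      have "coef (?h y) e = 0" using y by simp
      then show ?thesis using that by (simp add: coef_h bit_add_eq_0_iff)
    qed
    have const: "coef y w = coef y v" if "w \<in> V'" for w
      using potential_constant[of "coef y", OF eq that v] .
    show "y \<in> {0, chain_of V' (\<lambda>_. 1)}"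
    proof (cases "coef y v = 0")
      case True
      then have "y = 0" using y const by (intro chains_eqI[of _ V']) auto
      then show ?thesis by simp
    next
      case False
      then have "coef y v = 1" by (simp add: bit_not_zero_iff)
      then have "y = chain_of V' (\<lambda>_. 1)"
        using y const finite_V' by (intro chains_eqI[of _ V']) (auto simp: coef_chain_of)
      then show ?thesis by simp
    qed
  next
    fix y :: "'v \<Rightarrow>\<^sub>0 bit" assume "y \<in> {0, chain_of V' (\<lambda>_. 1)}"
    moreover have "?h (chain_of V' (\<lambda>_. 1)) = 0"
      by (rule poly_mapping_eqI) (auto simp: coef_h coef_chain_of finite_V' endpoints_def)
    moreover have "?h 0 = 0" by (rule poly_mapping_eqI) (simp add: coef_h)
    ultimately show "y \<in> {y \<in> ?A. ?h y = 0}" using finite_V' by auto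
  qed
  moreover have "(0 :: 'v \<Rightarrow>\<^sub>0 bit) \<noteq> chain_of V' (\<lambda>_. 1)"
  proof
    assume eq: "(0 :: 'v \<Rightarrow>\<^sub>0 bit) = chain_of V' (\<lambda>_. 1)"
    obtain v where "v \<in> V'" using VF_nonempty VF_subset_V' by blast
    then show False using arg_cong[OF eq, of "\<lambda>y. coef y v"] finite_V' by (simp add: coef_chain_of)
  qed
  ultimately show ?thesis by (simp add: card_chains_bit finite_V')
qed

text \<open>An element amounts to a potential on \<open>V'\<close> vanishing on the axis together
  with free values on the axis edges. The potential is unique: two choices differ by a constant,
  which is 0 at an axis vertex, and here \<open>VF_nonempty\<close> is essential.\<close>

lemma card_half_bonds: "card half_bonds = 2 ^ (card (V' - VF) + card EF)"
proof -
  define g where "g = (\<lambda>(u :: 'v \<Rightarrow>\<^sub>0 bit, c :: 'e \<Rightarrow>\<^sub>0 bit).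
    chain_of (EL \<union> EF) (\<lambda>e. if e \<in> EL then coef u (hG e) - coef u (tG e) else coef c e))"
  have g_EL: "coef (g (u, c)) e = coef u (hG e) - coef u (tG e)" if "e \<in> EL" for u c e
    using that by (simp add: g_def coef_chain_of)
  have g_EF: "coef (g (u, c)) e = coef c e" if "e \<in> EF" for u c e
    using that edge_classes_disjoint by (auto simp: g_def coef_chain_of)
  have "bij_betw g (chains (V' - VF) \<times> chains EF) half_bonds"
    unfolding bij_betw_def
  proof
    show "inj_on g (chains (V' - VF) \<times> chains EF)"
    proof (rule inj_onI, clarify)
      fix u c u' c' assume u: "u \<in> chains (V' - VF)" "u' \<in> chains (V' - VF)"
        and c: "c \<in> chains EF" "c' \<in> chains EF" and eq: "g (u, c) = g (u', c')"
      have "c = c'" using c g_EF arg_cong[OF eq, of "\<lambda>x. coef x _"] by (intro chains_eqI[of _ EF]) metis+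
      moreover have "u = u'"
      proof (rule chains_eqI[OF u])
        fix v assume v: "v \<in> V' - VF"
        obtain w where w: "w \<in> VF" using VF_nonempty by blast
        have zero: "coef u x = 0" "coef u' x = 0" if "x \<in> VF" for x
          using u that by (auto intro: coef_outside)
        \<comment> \<open>Both potentials are 0 on the axis and have equal differences along left
          edges, so their sum, which modulo 2 is their difference, agrees at the two ends of every
          edge.\<close>
        have "coef u (hG e) + coef u' (hG e) = coef u (tG e) + coef u' (tG e)" if "e \<in> EL \<union> EF" for e
        proof (cases "e \<in> EL")
          case True
          then have "coef u (hG e) + coef u (tG e) = coef u' (hG e) + coef u' (tG e)"
            using arg_cong[OF eq, of "\<lambda>x. coef x e"] by (simp add: g_EL)
          then show ?thesis
            by (cases "coef u (hG e)"; cases "coef u (tG e)"; cases "coef u' (hG e)"; cases "coef u' (tG e)") auto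
        next
          case False
          with that show ?thesis by (simp add: zero EF_ends)
        qed
        then have "coef u v + coef u' v = coef u w + coef u' w"
          by (rule potential_constant) (use v w VF_subset_V' in auto)
        then show "coef u v = coef u' v" using zero[OF w] by (simp add: bit_add_eq_0_iff)
      qed
      ultimately show "u = u' \<and> c = c'" by simp
    qed
    show "g ` (chains (V' - VF) \<times> chains EF) = half_bonds"
    proof (intro equalityI subsetI)
      fix a assume "a \<in> g ` (chains (V' - VF) \<times> chains EF)"
      then obtain u c where u: "u \<in> chains (V' - VF)" and a: "a = g (u, c)" by auto
      have "a \<in> chains (EL \<union> EF)" unfolding a g_def by simp
      moreover have "\<forall>v\<in>VF. coef u v = 0" using u by (auto intro: coef_outside)
      ultimately show "a \<in> half_bonds" unfolding half_bonds_def using a g_EL by blast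
    next
      fix a assume "a \<in> half_bonds"
      then obtain w where a: "a \<in> chains (EL \<union> EF)" and w: "\<forall>v\<in>VF. w v = 0"
        "\<forall>e\<in>EL. coef a e = w (hG e) - w (tG e)" unfolding half_bonds_def by blast
      let ?u = "chain_of (V' - VF) w" and ?c = "chain_of EF (coef a)"
      have fin: "finite (V' - VF)" using finite_V' by simp
      have "coef ?u v = w v" if "v \<in> V'" for v
        using that w(1) fin by (auto simp: coef_chain_of)
      then have "coef (g (?u, ?c)) e = coef a e" if "e \<in> EL \<union> EF" for e
        using that w(2) by (cases "e \<in> EL") (auto simp: g_EL g_EF endpoints_def coef_chain_of)
      moreover have "g (?u, ?c) \<in> chains (EL \<union> EF)" unfolding g_def by simp
      ultimately have "a = g (?u, ?c)" using a by (intro chains_eqI[of _ "EL \<union> EF"]) auto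
      moreover have "(?u, ?c) \<in> chains (V' - VF) \<times> chains EF" using fin by simp
      ultimately show "a \<in> g ` (chains (V' - VF) \<times> chains EF)" by blast
    qed
  qed
  then have "card half_bonds = card (chains (V' - VF) \<times> chains EF :: (('v \<Rightarrow>\<^sub>0 bit) \<times> ('e \<Rightarrow>\<^sub>0 bit)) set)"
    by (simp add: bij_betw_same_card)
  then show ?thesis by (simp add: card_cartesian_product card_chains_bit finite_V' power_add)
qed

text \<open>By \<open>card_kernels_of_pairing\<close> the ratio is that of the paired spaces. After
  cancellation of \<open>2 ^ card (V' - VF)\<close>, the summand 1 in the exponent stems from the
  constant potentials in \<open>card_bond_space_left\<close>.\<close>

lemma fixed_bicycles_ratio:
  "card (phi_fixed_bicycles G D) * 2 ^ (card EF + 1) = card (psi_fixed_bicycles G D) * 2 ^ card VF"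
proof -
  let ?B = "bond_space left_graph :: ('e \<Rightarrow>\<^sub>0 bit) set"
  have finite_chains: "finite (chains (EL \<union> EF) :: ('e \<Rightarrow>\<^sub>0 bit) set)"
    by (simp add: card_chains_bit)
  have "card (psi_fixed_bicycles G D) * card ?B = card (phi_fixed_bicycles G D) * card half_bonds"
    unfolding card_psi_fixed_bicycles card_phi_fixed_bicycles
  proof (rule card_kernels_of_pairing)
    show "finite half_bonds" by (rule finite_subset[OF _ finite_chains]) (auto simp: half_bonds_def)
    show "finite ?B" by (rule finite_subset[OF _ finite_chains]) (use left.bond_space_subset in simp)
    show "add_closed ?B" by (simp add: add_closed_def left.bond_space_add)
  qed (simp_all add: add_closed_half_bonds dot_add_left dot_add_right)
  then have "card (psi_fixed_bicycles G D) * 2 ^ card V' =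
      2 * card (phi_fixed_bicycles G D) * 2 ^ (card (V' - VF) + card EF)"
    by (simp flip: card_bond_space_left add: card_half_bonds mult_ac)
  moreover have "card V' = card (V' - VF) + card VF"
    using VF_subset_V' finite_V' by (simp add: card_Diff_subset card_mono)
  ultimately have "2 ^ card (V' - VF) * (card (psi_fixed_bicycles G D) * 2 ^ card VF) =
      2 ^ card (V' - VF) * (card (phi_fixed_bicycles G D) * 2 ^ (card EF + 1))"
    by (simp add: power_add mult_ac)
  then show ?thesis by simp
qed

end

end

theorem mainTheorem1:
  fixes G :: "('v, 'e) pre_digraph" and D :: "('v, 'e) drawing"
  assumes symm: "reflective_symmetry G D"
    and orient: "phi_preserves_orientation G D"
  defines "Kp \<equiv> critical_group (G_plus G D)"
    and "Km \<equiv> critical_group (G_minus G D)"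
    and "K \<equiv> critical_group G"
  shows "\<exists>fs \<in> hom (Kp \<times>\<times> Km) K.
      (\<forall>x \<in> carrier (free_Abelian_group (arcs (G_plus G D))).
       \<forall>y \<in> carrier (free_Abelian_group (arcs (G_minus G D))).
         fs (critical_class (G_plus G D) x, critical_class (G_minus G D) y)
           = critical_class G (f_map G D (x, y))) \<and>
      two_torsion (ker_group (Kp \<times>\<times> Km) K fs) \<and>
      two_torsion (coker_group (Kp \<times>\<times> Km) K fs) \<and>
      ker_group (Kp \<times>\<times> Km) K fs \<cong> additive_group (psi_fixed_bicycles G D) \<and>
      coker_group (Kp \<times>\<times> Km) K fs \<cong> additive_group (phi_fixed_bicycles G D) \<and>
      (Digraph_Component.connected (G_plus G D) \<longrightarrow>
         real (order K) / real (order (Kp \<times>\<times> Km))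
           = real (order (coker_group (Kp \<times>\<times> Km) K fs))
             / real (order (ker_group (Kp \<times>\<times> Km) K fs)) \<and>
         (V_fix G D \<noteq> {} \<and> V_fix G D \<subseteq> endpoints G (arcs G) \<longrightarrow>
           real (order (coker_group (Kp \<times>\<times> Km) K fs))
             / real (order (ker_group (Kp \<times>\<times> Km) K fs))
           = 2 powi (int (card (V_fix G D)) - int (card (E_fix G D)) - 1)))"
proof -
  interpret reflective_graph G D by unfold_locales (rule symm, rule orient)
  interpret f: group_hom "Kp \<times>\<times> Km" K f_star
    unfolding Kp_def Km_def K_def by (rule group_hom_f_star)
  let ?ker = "ker_group (Kp \<times>\<times> Km) K f_star" and ?coker = "coker_group (Kp \<times>\<times> Km) K f_star"
  have finite_product: "finite (carrier (Kp \<times>\<times> Km))"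
    unfolding Kp_def Km_def DirProd_def
    using plus.finite_critical_group minus.finite_critical_group by simp
  have finite_K: "finite (carrier K)" unfolding K_def by (rule finite_critical_group)
  have pos_product: "order (Kp \<times>\<times> Km) > 0"
    unfolding order_def using finite_product f.G.one_closed card_gt_0_iff by blast
  have "kernel (Kp \<times>\<times> Km) K f_star \<subseteq> carrier (Kp \<times>\<times> Km)" by (auto simp: kernel_def)
  moreover have "\<one>\<^bsub>Kp \<times>\<times> Km\<^esub> \<in> kernel (Kp \<times>\<times> Km) K f_star"
    unfolding kernel_def using f.G.one_closed f.hom_one by blast
  ultimately have pos_ker: "order ?ker > 0"
    unfolding order_def ker_group_def using finite_product
    by (auto simp: card_gt_0_iff intro: finite_subset)
  have iso_ker: "?ker \<cong> additive_group (psi_fixed_bicycles G D)"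
    and iso_coker: "?coker \<cong> additive_group (phi_fixed_bicycles G D)"
    unfolding Kp_def Km_def K_def by (rule ker_f_star_iso coker_f_star_iso)+
  have order_ker: "order ?ker = card (psi_fixed_bicycles G D)"
    and order_coker: "order ?coker = card (phi_fixed_bicycles G D)"
    using iso_ker iso_coker
    by (auto simp: is_iso_def iso_def order_def additive_group_def dest: bij_betw_same_card)
  have "order K * order ?ker = order (Kp \<times>\<times> Km) * order ?coker"
    using finite_product comm_group_critical_group finite_K unfolding K_def by (rule f.order_kernel_cokernel[unfolded K_def])
  \<comment> \<open>Both denominators are orders of finite groups and hence positive, so the
    multiplicative identity may be divided.\<close>
  then have ratio: "real (order K) / real (order (Kp \<times>\<times> Km)) = real (order ?coker) / real (order ?ker)"
    using pos_product pos_ker by (simp add: field_simps flip: of_nat_mult)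
  have power: "real (order ?coker) / real (order ?ker) = 2 powi (int (card (V_fix G D)) - int (card (E_fix G D)) - 1)"
    if "Digraph_Component.connected (G_plus G D)" "V_fix G D \<noteq> {}" "V_fix G D \<subseteq> endpoints G (arcs G)"
  proof -
    have "real (order ?coker) * 2 ^ (card EF + 1) = real (order ?ker) * 2 ^ card VF"
      using arg_cong[OF fixed_bicycles_ratio[OF that], of real] unfolding order_ker order_coker by simp
    then have "real (order ?coker) / real (order ?ker) = 2 ^ card VF / 2 ^ (card EF + 1)"
      using pos_ker by (simp add: field_simps)
    also have "\<dots> = 2 powi (int (card VF) - int (card EF + 1))"
      by (simp only: power_int_diff[OF disjI1] power_int_of_nat)
    finally show ?thesis by (simp add: algebra_simps)
  qed
  show ?thesis
  proof (rule bexI[of _ f_star], intro conjI impI)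
    show "f_star \<in> hom (Kp \<times>\<times> Km) K" by (rule f.homh)
    show "\<forall>x \<in> carrier (free_Abelian_group (arcs (G_plus G D))).
       \<forall>y \<in> carrier (free_Abelian_group (arcs (G_minus G D))).
         f_star (critical_class (G_plus G D) x, critical_class (G_minus G D) y)
           = critical_class G (f_map G D (x, y))"
      unfolding carrier_free_Abelian_group by (simp add: f_star_class)
    show "two_torsion ?ker" "two_torsion ?coker"
      unfolding Kp_def Km_def K_def by (rule two_torsion_ker two_torsion_coker)+
  qed (use iso_ker iso_coker ratio power in auto)
qed

end
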